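(* There exists $\Delta_0>0$ such that for every $0<\Delta\leq\Delta_0$ the following holds for all sufficiently large $N$ divisible by $3$. Let $G=(V_1,V_2,V_3;E)$ be a balanced tripartite graph on $3N$ vertices such that each vertex is adjacent to at least $(2/3)N$ vertices in each of the other two vertex classes. Suppose further that there are sets $A_1\subseteq V_1$, $A_2\subseteq V_2$, $A_3\subseteq V_3$, each of size $N/3$, with $d(A_i,A_j)\leq\Delta$ for all $i\neq j$. Then either $G$ contains $N$ vertex-disjoint triangles, or $G$ is (isomorphic, as a tripartite graph, to) $\Gamma_3(N/3)$.
   Context: For disjoint nonempty vertex sets $A,B$, $d(A,B)=e(A,B)/(|A||B|)$, where $e(A,B)$ is the number of edges between $A$ and $B$. The graph $\Gamma_3$ has vertex set $\{h_{i,j}: i,j\in\{1,2,3\}\}$ with adjacency: $h_{i,j}\sim h_{i',j'}$ if $i\neq i'$, $j\neq j'$ and $1\in\{j,j'\}$; moreover $h_{i,2}\sim h_{i',2}$ and $h_{i,3}\sim h_{i',3}$ for $i\neq i'$; no other edges. $\Gamma_3(t)$ is obtained by replacing each vertex by an independent set of $t$ vertices and each edge by $K_{t,t}$; its $i$-th vertex class is the union of the clusters of $h_{i,1},h_{i,2},h_{i,3}$. *)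

theory Defs
  imports Complex_Main "HOL-Library.Disjoint_Sets"
begin

text \<open>A tripartite graph is given by its labelled vertex classes \<open>V 1\<close>, \<open>V 2\<close>, \<open>V 3\<close> (the values of
  \<open>V\<close> at other indices are ignored) and its adjacency relation. Irreflexivity is implied, because
  the classes are disjoint.\<close>

definition tripartite_graph :: "(nat \<Rightarrow> 'a set) \<Rightarrow> ('a \<Rightarrow> 'a \<Rightarrow> bool) \<Rightarrow> bool" where
  "tripartite_graph V E \<longleftrightarrow>
     (\<forall>i\<in>{1,2,3}. finite (V i)) \<and>
     disjoint_family_on V {1,2,3} \<and>
     (\<forall>u v. E u v \<longrightarrow> E v u) \<and>
     (\<forall>u v. E u v \<longrightarrow> (\<exists>i\<in>{1,2,3}. \<exists>j\<in>{1,2,3}. i \<noteq> j \<and> u \<in> V i \<and> v \<in> V j))"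

definition balanced_tripartite_graph ::
    "nat \<Rightarrow> (nat \<Rightarrow> 'a set) \<Rightarrow> ('a \<Rightarrow> 'a \<Rightarrow> bool) \<Rightarrow> bool" where
  "balanced_tripartite_graph N V E \<longleftrightarrow>
     tripartite_graph V E \<and> (\<forall>i\<in>{1,2,3}. card (V i) = N)"

text \<open>Counting ordered pairs counts every edge between \<open>A\<close> and \<open>B\<close> once, for disjoint \<open>A\<close> and \<open>B\<close>.\<close>

definition edges_between :: "('a \<Rightarrow> 'a \<Rightarrow> bool) \<Rightarrow> 'a set \<Rightarrow> 'a set \<Rightarrow> nat" where
  "edges_between E A B = card {(a, b). a \<in> A \<and> b \<in> B \<and> E a b}"

definition density :: "('a \<Rightarrow> 'a \<Rightarrow> bool) \<Rightarrow> 'a set \<Rightarrow> 'a set \<Rightarrow> real" where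
  "density E A B = real (edges_between E A B) / (real (card A) * real (card B))"

definition is_triangle :: "('a \<Rightarrow> 'a \<Rightarrow> bool) \<Rightarrow> 'a set \<Rightarrow> bool" where
  "is_triangle E T \<longleftrightarrow>
     (\<exists>u v w. u \<noteq> v \<and> v \<noteq> w \<and> u \<noteq> w \<and> T = {u, v, w} \<and> E u v \<and> E v w \<and> E u w)"

definition has_disjoint_triangles :: "('a \<Rightarrow> 'a \<Rightarrow> bool) \<Rightarrow> nat \<Rightarrow> bool" where
  "has_disjoint_triangles E n \<longleftrightarrow>
     (\<exists>\<T>. finite \<T> \<and> card \<T> = n \<and> (\<forall>T\<in>\<T>. is_triangle E T) \<and> disjoint \<T>)"

text \<open>The vertex \<open>h\<close> with indices \<open>i, j\<close> of \<open>\<Gamma>\<^sub>3\<close> is the pair \<open>(i, j)\<close>.\<close>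

definition gamma3_class :: "nat \<Rightarrow> (nat \<times> nat) set" where
  "gamma3_class i = {i} \<times> {1,2,3}"

definition gamma3_adj :: "nat \<times> nat \<Rightarrow> nat \<times> nat \<Rightarrow> bool" where
  "gamma3_adj = (\<lambda>(i, j) (i', j').
     i \<in> {1,2,3} \<and> j \<in> {1,2,3} \<and> i' \<in> {1,2,3} \<and> j' \<in> {1,2,3} \<and> i \<noteq> i' \<and>
     (j \<noteq> j' \<and> 1 \<in> {j, j'} \<or> j = 2 \<and> j' = 2 \<or> j = 3 \<and> j' = 3))"

text \<open>In the blow-up, \<open>(v, k)\<close> with \<open>k < t\<close> is the \<open>k\<close>-th of the \<open>t\<close> vertices replacing \<open>v\<close>.\<close>

definition blowup_class :: "(nat \<Rightarrow> 'b set) \<Rightarrow> nat \<Rightarrow> nat \<Rightarrow> ('b \<times> nat) set" where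
  "blowup_class V t i = V i \<times> {..<t}"

definition blowup_adj :: "('b \<Rightarrow> 'b \<Rightarrow> bool) \<Rightarrow> nat \<Rightarrow> 'b \<times> nat \<Rightarrow> 'b \<times> nat \<Rightarrow> bool" where
  "blowup_adj E t = (\<lambda>(u, k) (v, l). k < t \<and> l < t \<and> E u v)"

text \<open>Isomorphisms respect the labels of the classes. For \<open>\<Gamma>\<^sub>3(t)\<close> this is no restriction: permuting
  the first index of \<open>(i, j)\<close> is an automorphism.\<close>

definition tripartite_isomorphic ::
    "(nat \<Rightarrow> 'a set) \<Rightarrow> ('a \<Rightarrow> 'a \<Rightarrow> bool) \<Rightarrow> (nat \<Rightarrow> 'b set) \<Rightarrow> ('b \<Rightarrow> 'b \<Rightarrow> bool) \<Rightarrow> bool" where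
  "tripartite_isomorphic V E W F \<longleftrightarrow>
     (\<exists>f. bij_betw f (\<Union>i\<in>{1,2,3}. V i) (\<Union>i\<in>{1,2,3}. W i) \<and>
          (\<forall>i\<in>{1,2,3}. f ` V i = W i) \<and>
          (\<forall>u\<in>(\<Union>i\<in>{1,2,3}. V i). \<forall>v\<in>(\<Union>i\<in>{1,2,3}. V i). E u v \<longleftrightarrow> F (f u) (f v)))"

lemma tripartite_gamma3_blowup:
  "tripartite_graph (blowup_class gamma3_class t) (blowup_adj gamma3_adj t)"
proof -
  let ?V = "blowup_class gamma3_class t" and ?E = "blowup_adj gamma3_adj t"
  have "finite (?V i)" for i
    by (simp add: blowup_class_def gamma3_class_def)
  moreover have "disjoint_family_on ?V {1,2,3}"
    unfolding disjoint_family_on_def blowup_class_def gamma3_class_def by blast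
  moreover have "?E u v \<Longrightarrow> ?E v u" for u v
    unfolding blowup_adj_def gamma3_adj_def by (cases u, cases v) (simp split: prod.splits, blast)
  moreover have "\<exists>i\<in>{1,2,3}. \<exists>j\<in>{1,2,3}. i \<noteq> j \<and> u \<in> ?V i \<and> v \<in> ?V j" if E: "?E u v" for u v
  proof (intro bexI conjI)
    show "fst (fst u) \<noteq> fst (fst v)" "u \<in> ?V (fst (fst u))" "v \<in> ?V (fst (fst v))"
      "fst (fst v) \<in> {1,2,3}" "fst (fst u) \<in> {1,2,3}"
      using E unfolding blowup_adj_def gamma3_adj_def blowup_class_def gamma3_class_def
      by (simp_all only: case_prod_beta mem_Times_iff lessThan_iff singleton_iff simp_thms)
  qed
  ultimately show ?thesis
    unfolding tripartite_graph_def by blast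
qed

lemma balanced_gamma3_blowup:
  "balanced_tripartite_graph (3 * t) (blowup_class gamma3_class t) (blowup_adj gamma3_adj t)"
  unfolding balanced_tripartite_graph_def using tripartite_gamma3_blowup[of t]
  by (simp add: blowup_class_def gamma3_class_def card_cartesian_product)

end

theory Submission
  imports Defs
begin

text \<open>Write \<open>N = 3h\<close>, so that every vertex misses at most \<open>h\<close> vertices of each other class. A sparse
  triple is completed to the set \<open>L\<close> of all vertices with few neighbours in it; apart from a few
  exceptional vertices, all the others are adjacent to almost all of \<open>L\<close>.

  If there is a second sparse triple, the vertices fall into three types such that any two of them are
  almost completely joined. A type with too many vertices contains sufficiently many disjoint edges by
  the exact degree condition; triangles over such edges correct the sizes of the types, and the
  exceptional vertices can be covered greedily. What remains is matched up by Hall-type arguments.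

  Otherwise one corrects the size of \<open>L\<close> with triangles over edges inside \<open>L\<close> or outside \<open>L\<close>, and it
  remains to find a perfect matching of the rest \<open>H\<close> outside \<open>L\<close>. By Tutte's theorem and the degree
  condition, the only obstructions are an independent set, which would be a second sparse triple, and a
  partition of \<open>H\<close> into two odd parts without edges between them. The parity can be changed by
  exchanging one triangle, unless no triangle has been removed; in that case the graph is \<open>\<Gamma>\<^sub>3(h)\<close>.\<close>

section \<open>Perfect matchings and Tutte's theorem\<close>

text \<open>The degree condition is tight, so every estimate with an error term must finally be
  closed by exact counting. The approximate part runs on two scales: \<open>a\<close> bounds the
  atypical adjacencies of a single vertex, while \<open>w\<close>, much smaller than
  \<open>a\<close>, bounds the number of atypical vertices. Edge counts of order
  \<open>a * w\<close> link the two by Markov's inequality. Whatever is left over after removing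
  sparse sets is sparse only at a coarser level, which is why several values of \<open>w\<close>,
  far apart from each other, are used. The parity obstruction is genuine: a full packing of
  \<Gamma>_3(h) takes from every triangle one vertex with second index 1 and two vertices with a
  common second index 2 or 3. Each of these two types has 3h vertices, so this is impossible for odd
  h. To have a choice in all other cases, the size of \<open>L\<close> is corrected to one vertex
  below balance. Then exactly one further triangle outside \<open>L\<close> has to be removed, and
  it can be chosen according to the parity.\<close>

definition perfect_matching :: "'a set \<Rightarrow> ('a \<Rightarrow> 'a \<Rightarrow> bool) \<Rightarrow> bool" where
  "perfect_matching S E \<longleftrightarrow> (\<exists>f. \<forall>v\<in>S. f v \<in> S \<and> f (f v) = v \<and> E v (f v))"

lemma even_card_involution:
  assumes "finite S" "\<And>v. v \<in> S \<Longrightarrow> f v \<in> S \<and> f (f v) = v \<and> f v \<noteq> v"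
  shows "even (card S)"
  using assms
proof (induction S rule: finite_psubset_induct)
  case (psubset S)
  show ?case
  proof (cases "S = {}")
    case False
    then obtain v where v: "v \<in> S" by blast
    let ?S = "S - {v, f v}"
    have "even (card ?S)"
    proof (rule psubset.IH)
      show "?S \<subset> S" using v by blast
      show "f u \<in> ?S \<and> f (f u) = u \<and> f u \<noteq> u" if "u \<in> ?S" for u
        using psubset.prems[of u] psubset.prems[of v] that v by auto
    qed
    moreover have "card S = card ?S + 2"
    proof -
      have "card {v, f v} = 2" using psubset.prems[OF v] by auto
      moreover have "{v, f v} \<subseteq> S" using psubset.prems[OF v] v by auto
      ultimately show ?thesis
        using card_Diff_subset[of "{v, f v}" S] card_mono[of S "{v, f v}"] psubset.hyps by simp
    qed
    ultimately show ?thesis by simp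
  qed simp
qed

text \<open>The exchange step in Lovasz's proof of Tutte's theorem: \<open>f1\<close> and \<open>f2\<close> are perfect matchings of
  the graphs with the extra edges \<open>xz\<close> and \<open>yw\<close>, and one walks from \<open>y\<close> along the alternating path that
  starts with \<open>yw\<close> until it either meets \<open>{x, z}\<close> or closes.\<close>

lemma lovasz_exchange:
  assumes fin: "finite S" and sym: "\<And>u v. E u v \<Longrightarrow> E v u"
    and f1: "\<And>v. v \<in> S \<Longrightarrow> f1 v \<in> S \<and> f1 (f1 v) = v \<and> f1 v \<noteq> v"
    and e1: "\<And>v. v \<in> S \<Longrightarrow> v \<notin> {x, z} \<Longrightarrow> E v (f1 v)"
    and f2: "\<And>v. v \<in> S \<Longrightarrow> f2 v \<in> S \<and> f2 (f2 v) = v \<and> f2 v \<noteq> v"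
    and e2: "\<And>v. v \<in> S \<Longrightarrow> v \<notin> {y, w} \<Longrightarrow> E v (f2 v)"
    and xz: "f1 x = z" and yw: "f2 y = w"
    and S: "x \<in> S" "y \<in> S" "z \<in> S" "w \<in> S" and ne: "x \<noteq> y" "z \<noteq> y" "x \<noteq> z"
    and xy: "E x y" and zy: "E z y"
  shows "perfect_matching S E"
proof -
  \<comment> \<open>One application of \<open>t\<close> follows an \<open>f2\<close> edge and then
    an \<open>f1\<close> edge. The alternating path from \<open>y\<close> reads \<open>a 0\<close>,
    \<open>b 0\<close>, \<open>a 1\<close>, \<open>b 1\<close>, ..., with \<open>f2\<close> joining
    \<open>a k\<close> to \<open>b k\<close> and \<open>f1\<close> joining \<open>b k\<close> to
    \<open>a (Suc k)\<close>.\<close>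
  define t where "t = (\<lambda>u. f1 (f2 u))"
  define a where "a k = (t ^^ k) y" for k
  define b where "b k = f2 (a k)" for k
  have tS: "(t ^^ k) u \<in> S" if "u \<in> S" for k u
    using that by (induction k) (auto simp: t_def f1 f2)
  have aS: "a k \<in> S" for k using tS[OF S(2)] by (simp add: a_def)
  have bS: "b k \<in> S" for k using f2[OF aS] by (simp add: b_def)
  have f1b: "f1 (b k) = a (Suc k)" for k by (simp add: a_def b_def t_def)
  have f1a: "f1 (a (Suc k)) = b k" for k using f1[OF bS[of k]] f1b by metis
  have f2b: "f2 (b k) = a k" for k using f2[OF aS] by (simp add: b_def)
  have f2a: "f2 (a k) = b k" for k by (simp add: b_def)
  have a0: "a 0 = y" by (simp add: a_def)
  have b0: "b 0 = w" by (simp add: b_def a0 yw)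
  have zx: "f1 z = x" using xz f1[OF S(1)] by auto
  \<comment> \<open>The walk cannot run into its first edge from the far end: a coincidence after
    \<open>n\<close> steps from \<open>u\<close> yields one after \<open>n - 2\<close> steps from
    \<open>t u\<close>, and for \<open>n\<close> equal to 0 or 1 it would be a fixed point of
    \<open>f2\<close> or of \<open>f1\<close>.\<close>
  have R: "(t ^^ n) u \<noteq> f2 u" if "u \<in> S" for n u
    using that
  proof (induction n arbitrary: u rule: less_induct)
    case (less n)
    consider "n = 0" | "n = 1" | m where "n = Suc (Suc m)"
      by (cases n; cases "n - 1") auto
    then show ?case
    proof cases
      case 1 then show ?thesis using f2[OF less.prems] by auto
    next
      case 2 then show ?thesis using f1[of "f2 u"] f2[OF less.prems] by (auto simp: t_def)
    next
      case 3
      show ?thesis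
      proof
        assume eq: "(t ^^ n) u = f2 u"
        have tu: "t u \<in> S" using tS[OF less.prems, of 1] by simp
        have "(t ^^ n) u = (t ^^ Suc m) (t u)"
          using 3 funpow_swap1[of t "Suc m" u] by simp
        hence "f1 ((t ^^ Suc m) (t u)) = t u" using eq by (simp add: t_def)
        hence "f2 ((t ^^ m) (t u)) = t u"
          using f1[of "f2 ((t ^^ m) (t u))"] f2[OF tS[OF tu]] by (simp add: t_def)
        hence "(t ^^ m) (t u) = f2 (t u)" using f2[OF tS[OF tu, of m]] by metis
        thus False using less.IH[of m "t u"] 3 tu by simp
      qed
    qed
  qed
  have bny: "b j \<noteq> y" for j
  proof
    assume "b j = y"
    hence "a j = f2 y" using f2b by metis
    thus False using R[OF S(2), of j] by (simp add: a_def)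
  qed
  have per: "b (n + k) = b n" if "a k = y" for n k
    using that by (simp add: a_def b_def funpow_add)
  show ?thesis
  proof (cases "\<exists>k. b k \<in> {x, z}")
    case True
    define K where "K = (LEAST k. b k \<in> {x, z})"
    have K: "b K \<in> {x, z}" using LeastI_ex[OF True] by (simp add: K_def)
    have min: "b k \<notin> {x, z}" if "k < K" for k using not_less_Least[of k "\<lambda>k. b k \<in> {x, z}"] that unfolding K_def by blast
    define p where "p = b K"
    define q where "q = f1 p"
    have pq: "{p, q} = {x, z}" "p \<noteq> q" "f1 q = p" "f1 p = q" using K xz zx ne by (auto simp: p_def q_def)
    have py: "p \<noteq> y" "q \<noteq> y" using pq(1) ne by (auto simp: doubleton_eq_iff)
    have Epy: "E p y" using pq(1) xy zy by (auto simp: doubleton_eq_iff)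
    define Q where "Q = a ` {..K} \<union> b ` {..K}"
    have qQ: "q \<notin> Q"
    proof
      assume "q \<in> Q"
      then consider k where "k \<le> K" "q = a k" | k where "k \<le> K" "q = b k" unfolding Q_def by blast
      then show False
      proof cases
        case (1 k)
        show False
        proof (cases k)
          case 0
          then show ?thesis using 1 py a0 by simp
        next
          case (Suc m)
          hence "b m = p" using 1 f1a[of m] pq(3) by simp
          thus False using min[of m] Suc 1 pq(1) by auto
        qed
      next
        case 2
        then show False using pq min[of k] p_def by (cases "k = K") auto
      qed
    qed
    have yQ: "y \<in> Q" "p \<in> Q" "w \<in> Q" using a0 b0 unfolding Q_def p_def by force+
    \<comment> \<open>The \<open>f1\<close> edges cover the path \<open>Q\<close> except for its
      ends \<open>y\<close> and \<open>p\<close>, which are joined by an edge of \<open>E\<close>;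
      outside \<open>Q\<close> the matching \<open>f2\<close> is kept. The extra edge
      \<open>xz\<close> is avoided because \<open>p\<close> is paired with \<open>y\<close>, and
      \<open>yw\<close> because \<open>y\<close> and \<open>w\<close> lie in
      \<open>Q\<close>.\<close>
    define g where "g v = (if v = y then p else if v = p then y else if v \<in> Q then f1 v else f2 v)" for v
    have "g v \<in> S \<and> g (g v) = v \<and> E v (g v)" if v: "v \<in> S" for v
    proof -
      consider "v = y" | "v = p" | "v \<noteq> y" "v \<noteq> p" "v \<in> Q" | "v \<notin> Q" by blast
      then show ?thesis
      proof cases
        case 1 then show ?thesis using py bS Epy sym by (simp add: g_def p_def)
      next
        case 2 then show ?thesis using py S Epy by (simp add: g_def)
      next
        case 3
        have gv: "g v = f1 v" using 3 by (simp add: g_def)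
        have "v \<noteq> q" using 3 qQ by blast
        hence "v \<notin> {x, z}" using 3 pq(1) by blast
        hence Ev: "E v (f1 v)" using e1 v by blast
        have "f1 v \<in> Q \<and> f1 v \<noteq> y \<and> f1 v \<noteq> p"
        proof -
          consider k where "k \<le> K" "v = a k" | k where "k \<le> K" "v = b k" using 3 unfolding Q_def by blast
          then show ?thesis
          proof cases
            case (1 k)
            then obtain m where m: "k = Suc m" using 3 a0 by (cases k) auto
            have "b m \<notin> {x, z}" using min m 1 by auto
            hence "b m \<noteq> p" using pq(1) by blast
            moreover have "b m \<in> Q" using m 1 by (auto simp: Q_def)
            ultimately show ?thesis using 1 m f1a by (metis bny)
          next
            case (2 k)
            hence kK: "k < K" using 3 p_def by (cases "k = K") auto
            have "a (Suc k) \<noteq> p"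
            proof
              assume "a (Suc k) = p"
              hence "b k = q" using f1a pq by metis
              thus False using min[OF kK] pq(1) by blast
            qed
            moreover have "a (Suc k) \<noteq> y"
            proof
              assume "a (Suc k) = y"
              hence "b (K - Suc k) = b K" using per[of "Suc k" "K - Suc k"] kK by simp
              thus False using min[of "K - Suc k"] K kK by auto
            qed
            moreover have "a (Suc k) \<in> Q" using kK by (auto simp: Q_def)
            ultimately show ?thesis using 2 f1b by simp
          qed
        qed
        thus ?thesis using gv Ev f1[OF v] by (simp add: g_def)
      next
        case 4
        have ne: "v \<noteq> y" "v \<noteq> p" "v \<noteq> w" using 4 yQ by auto
        have "f2 v \<notin> Q"
        proof
          assume "f2 v \<in> Q"
          then consider k where "k \<le> K" "f2 v = a k" | k where "k \<le> K" "f2 v = b k" unfolding Q_def by blast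
          then show False
          proof cases
            case 1
            hence "v = b k" using f2[OF v] f2a by metis
            thus False using 4 1 by (auto simp: Q_def)
          next
            case 2
            hence "v = a k" using f2[OF v] f2b by metis
            thus False using 4 2 by (auto simp: Q_def)
          qed
        qed
        moreover have "f2 v \<noteq> y" "f2 v \<noteq> p" using calculation yQ by auto
        ultimately show ?thesis using 4 ne f2[OF v] e2[OF v] by (simp add: g_def)
      qed
    qed
    thus ?thesis unfolding perfect_matching_def by blast
  next
    case False
    have "finite (range a)" using fin aS by (meson finite_subset image_subsetI)
    hence "\<not> inj a" using finite_imageD[of a UNIV] infinite_UNIV_nat by blast
    then obtain k m where km: "k < m" "a k = a m" unfolding inj_def using nat_neq_iff by metis
    have inja: "a k = a m" if "a (Suc k) = a (Suc m)" for k m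
    proof -
      have "b k = b m" using that f1a[of k] f1a[of m] by simp
      thus ?thesis using f2b[of k] f2b[of m] by simp
    qed
    have "a (m - k) = a 0"
      using km
    proof (induction k arbitrary: m)
      case (Suc k)
      then obtain m' where m': "m = Suc m'" by (cases m) auto
      then have "a k = a m'" "k < m'" using Suc.prems inja[of k m'] by auto
      from Suc.IH[OF this(2,1)] show ?case using m' by simp
    qed simp
    then obtain n where n: "a (Suc n) = y" using km(1) a0 by (metis Suc_diff_Suc)
    \<comment> \<open>The walk closes without meeting \<open>x\<close> or \<open>z\<close>. Thus
      \<open>C\<close> is invariant under both matchings, contains \<open>y\<close> and
      \<open>w\<close>, and misses \<open>x\<close> and \<open>z\<close>; using \<open>f1\<close> on
      \<open>C\<close> and \<open>f2\<close> elsewhere avoids both extra edges.\<close>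
    define C where "C = range a \<union> range b"
    have f1C: "f1 v \<in> C" if v: "v \<in> C" for v
    proof -
      consider k where "v = a k" | k where "v = b k" using v unfolding C_def by blast
      then show ?thesis
      proof cases
        case (1 k)
        have "\<exists>m. a k = a (Suc m)" using a0 n by (cases k) metis+
        then show ?thesis using 1 f1a unfolding C_def by auto
      next
        case 2
        then show ?thesis using f1b unfolding C_def by auto
      qed
    qed
    have f2C: "f2 v \<in> C" if "v \<in> C" for v using that f2a f2b unfolding C_def by auto
    have yC: "y \<in> C" "w \<in> C" using a0[symmetric] b0[symmetric] unfolding C_def by simp_all
    have xC: "v \<notin> C" if v: "v \<in> {x, z}" for v
    proof
      assume "v \<in> C"
      moreover have "v \<noteq> b k" for k using False v by auto
      ultimately obtain k where k: "v = a k" unfolding C_def by blast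
      have "\<exists>m. a k = a (Suc m)" using a0 n by (cases k) metis+
      then obtain m where "v = a (Suc m)" using k by auto
      hence "f1 v = b m" by (simp add: f1a)
      moreover have "f1 v \<in> {x, z}" using v xz zx by auto
      ultimately show False using False by auto
    qed
    define g where "g v = (if v \<in> C then f1 v else f2 v)" for v
    have "g v \<in> S \<and> g (g v) = v \<and> E v (g v)" if v: "v \<in> S" for v
    proof (cases "v \<in> C")
      case True
      then show ?thesis using f1[OF v] f1C e1[OF v] xC by (auto simp: g_def)
    next
      case False
      have "f2 v \<notin> C" using False f2C f2[OF v] by metis
      moreover have "v \<notin> {y, w}" using False yC by blast
      ultimately show ?thesis using f2[OF v] False e2[OF v] by (auto simp: g_def)
    qed
    thus ?thesis unfolding perfect_matching_def by blast
  qed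
qed

text \<open>Take a maximum partial matching and assume that \<open>x\<close> and \<open>y\<close>
  are unmatched. Maximality confines the neighbours of both to matched vertices. As the two degrees
  add up to at least the full size, there is a matched pair \<open>x'\<close>, \<open>g x'\<close>
  with \<open>x'\<close> related to \<open>y\<close> and \<open>x\<close> related to
  \<open>g x'\<close>, and the matching can be augmented.\<close>

lemma bipartite_perfect_matching:
  fixes R :: "'a \<Rightarrow> 'b \<Rightarrow> bool"
  assumes fin: "finite X" "finite Y" and eq: "card X = card Y"
    and dX: "\<And>x. x \<in> X \<Longrightarrow> card Y \<le> 2 * card {y\<in>Y. R x y}"
    and dY: "\<And>y. y \<in> Y \<Longrightarrow> card X \<le> 2 * card {x\<in>X. R x y}"
  shows "\<exists>g. bij_betw g X Y \<and> (\<forall>x\<in>X. R x (g x))"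
proof -
  define ok where "ok D g \<longleftrightarrow> D \<subseteq> X \<and> inj_on g D \<and> g ` D \<subseteq> Y \<and> (\<forall>x\<in>D. R x (g x))" for D g
  have bound: "\<forall>p. ok (fst p) (snd p) \<longrightarrow> card (fst p) < Suc (card X)"
    using fin by (auto simp: ok_def card_mono less_Suc_eq_le)
  have "ok (fst ({}, undefined)) (snd ({}, undefined))" by (simp add: ok_def)
  from ex_has_greatest_nat[of "\<lambda>p. ok (fst p) (snd p)", OF this bound]
  obtain D g where D: "ok D g" and max: "\<And>D' g'. ok D' g' \<Longrightarrow> card D' \<le> card D"
    by auto
  have finD: "finite D" using D fin finite_subset by (auto simp: ok_def)
  have "D = X"
  proof (rule ccontr)
    assume "D \<noteq> X"
    then obtain x where x: "x \<in> X" "x \<notin> D" using D by (auto simp: ok_def)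
    have cgD: "card (g ` D) = card D" using D by (simp add: ok_def card_image)
    have lt: "card D < card X" using D x fin by (metis ok_def psubsetI psubset_card_mono)
    then obtain y where y: "y \<in> Y" "y \<notin> g ` D" using cgD eq fin(2) finD
      by (metis card_mono finite_imageI leD subsetI)
    have ND: "y' \<in> g ` D" if "y' \<in> Y" "R x y'" for y'
    proof (rule ccontr)
      assume "y' \<notin> g ` D"
      moreover have "(g(x := y')) ` D = g ` D" using x by auto
      moreover have "inj_on (g(x := y')) D" using D x by (auto simp: ok_def inj_on_def)
      ultimately have "ok (insert x D) (g(x := y'))" using D x that by (auto simp: ok_def)
      from max[OF this] show False using x finD by simp
    qed
    have ND': "x' \<in> D" if "x' \<in> X" "R x' y" for x'
    proof (rule ccontr)
      assume x': "x' \<notin> D"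
      have "(g(x' := y)) ` D = g ` D" using x' by auto
      moreover have "inj_on (g(x' := y)) D" using D x' by (auto simp: ok_def inj_on_def)
      ultimately have "ok (insert x' D) (g(x' := y))" using D x' that y by (auto simp: ok_def)
      from max[OF this] show False using x' finD by simp
    qed
    let ?N = "{y\<in>Y. R x y}" and ?N' = "{x'\<in>X. R x' y}"
    have "?N \<inter> g ` ?N' \<noteq> {}"
    proof
      assume dis: "?N \<inter> g ` ?N' = {}"
      have "inj_on g ?N'" using D ND' by (auto simp: ok_def intro: inj_on_subset)
      hence "card (?N \<union> g ` ?N') = card ?N + card ?N'"
        using card_Un_disjoint[of ?N "g ` ?N'"] dis fin by (simp add: card_image)
      moreover have "card (?N \<union> g ` ?N') \<le> card (g ` D)"
        using ND ND' finD by (intro card_mono) auto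
      ultimately show False using dX[OF x(1)] dY[OF y(1)] cgD lt eq by linarith
    qed
    then obtain x' where x': "x' \<in> X" "R x' y" "R x (g x')" by auto
    have x'D: "x' \<in> D" "x' \<noteq> x" using ND' x' x by auto
    define g' where "g' = g(x := g x', x' := y)"
    have "inj_on g' (insert x D)"
      using D x'D x y unfolding ok_def inj_on_def g'_def by (auto split: if_splits)
    moreover have "g' ` insert x D \<subseteq> Y" using D x'D x y x' unfolding ok_def g'_def by (auto split: if_splits)
    moreover have "\<forall>u\<in>insert x D. R u (g' u)" using D x'D x y x' unfolding ok_def g'_def by auto
    ultimately have "ok (insert x D) g'" using D x by (auto simp: ok_def)
    from max[OF this] show False using x finD by simp
  qed
  moreover have "bij_betw g X Y"
    using D calculation eq fin by (auto simp: ok_def bij_betw_def card_image card_subset_eq)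
  ultimately show ?thesis using D by (auto simp: ok_def)
qed

text \<open>The nontrivial direction of Tutte's theorem, proved in a maximal supergraph without a
  perfect matching: outside its universal vertices \<open>U\<close>, adjacency is transitive, so
  that it is a disjoint union of cliques. The odd cliques are read off from a maximum matching. The
  surplus is two because a set of even size has an even, positive number of unmatched
  vertices.\<close>

lemma not_perfect_matching_obstruction:
  assumes fin: "finite S" and ev: "even (card S)"
    and sym: "\<And>u v. E u v \<Longrightarrow> E v u" and irr: "\<And>u. \<not> E u u"
    and npm: "\<not> perfect_matching S E"
  shows "\<exists>U K. U \<subseteq> S \<and> disjoint K \<and> card U + 2 \<le> card K \<and>
    (\<forall>X\<in>K. X \<subseteq> S - U \<and> odd (card X) \<and> (\<forall>u\<in>X. \<forall>v\<in>S - U - X. \<not> E u v))"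
proof -
  define good where "good R \<longleftrightarrow> R \<subseteq> S \<times> S \<and> (\<forall>u v. (u, v) \<in> R \<longrightarrow> (v, u) \<in> R \<and> u \<noteq> v) \<and>
      (\<forall>u\<in>S. \<forall>v\<in>S. E u v \<longrightarrow> (u, v) \<in> R) \<and> \<not> perfect_matching S (\<lambda>u v. (u, v) \<in> R)" for R
  have "finite {R. good R}"
    by (rule finite_subset[of _ "Pow (S \<times> S)"]) (use fin in \<open>auto simp: good_def\<close>)
  moreover have "good {(u, v). u \<in> S \<and> v \<in> S \<and> E u v}"
    unfolding good_def
  proof (intro conjI)
    show "\<not> perfect_matching S (\<lambda>u v. (u, v) \<in> {(u, v). u \<in> S \<and> v \<in> S \<and> E u v})"
      using npm unfolding perfect_matching_def by fastforce
  qed (use sym irr in auto)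
  ultimately obtain R where R: "good R" and Rmax: "\<And>R'. good R' \<Longrightarrow> R \<subseteq> R' \<Longrightarrow> R' = R"
    using finite_has_maximal[of "{R. good R}"] by auto
  have RS: "u \<in> S" "v \<in> S" "(v, u) \<in> R" "u \<noteq> v" if "(u, v) \<in> R" for u v
    using R that unfolding good_def by blast+
  have nrefl: "(u, u) \<notin> R" for u using RS(4) by blast
  have ER: "(u, v) \<in> R" if "E u v" "u \<in> S" "v \<in> S" for u v using R that unfolding good_def by blast
  have nR: "\<not> perfect_matching S (\<lambda>u v. (u, v) \<in> R)" using R unfolding good_def by blast
  \<comment> \<open>By maximality the graph with the additional edge \<open>xz\<close> has a perfect
    matching, and that matching has to use \<open>xz\<close>.\<close>
  have add: "\<exists>f. (\<forall>v\<in>S. f v \<in> S \<and> f (f v) = v \<and> f v \<noteq> v) \<and> f x = z \<and> (\<forall>v\<in>S. v \<notin> {x, z} \<longrightarrow> (v, f v) \<in> R)"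
    if xz: "x \<in> S" "z \<in> S" "x \<noteq> z" "(x, z) \<notin> R" for x z
  proof -
    let ?R = "R \<union> {(x, z), (z, x)}"
    have "\<not> good ?R" using Rmax[of ?R] xz by blast
    hence "perfect_matching S (\<lambda>u v. (u, v) \<in> ?R)"
      using R xz unfolding good_def by auto
    then obtain f where f: "\<And>v. v \<in> S \<Longrightarrow> f v \<in> S \<and> f (f v) = v \<and> (v, f v) \<in> ?R"
      unfolding perfect_matching_def by blast
    have ne: "f v \<noteq> v" if "v \<in> S" for v using f[OF that] nrefl[of v] xz by auto
    have fx: "f x = z"
    proof (rule ccontr)
      assume n: "f x \<noteq> z"
      hence "f z \<noteq> x" using f xz by metis
      hence "(v, f v) \<in> R" if "v \<in> S" for v using f[OF that] n by auto
      hence "perfect_matching S (\<lambda>u v. (u, v) \<in> R)" unfolding perfect_matching_def using f by blast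
      thus False using nR by blast
    qed
    show ?thesis
      by (rule exI[of _ f]) (use f ne fx in auto)
  qed
  define U where "U = {u\<in>S. \<forall>v\<in>S. v \<noteq> u \<longrightarrow> (u, v) \<in> R}"
  have US: "U \<subseteq> S" by (auto simp: U_def)
  \<comment> \<open>If \<open>x\<close> and \<open>z\<close> were nonadjacent, then together with a
    nonneighbour \<open>w\<close> of \<open>y\<close> there would be two perfect matchings with
    extra edges \<open>xz\<close> and \<open>yw\<close>, as \<open>lovasz_exchange\<close>
    requires.\<close>
  have tr: "(x, z) \<in> R" if xy: "(x, y) \<in> R" and yz: "(y, z) \<in> R" and ne: "x \<noteq> z" and y: "y \<notin> U" for x y z
  proof (rule ccontr)
    assume nxz: "(x, z) \<notin> R"
    have S: "x \<in> S" "y \<in> S" "z \<in> S" using RS xy yz by blast+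
    obtain w where w: "w \<in> S" "w \<noteq> y" "(y, w) \<notin> R" using y S unfolding U_def by blast
    from add[OF S(1,3) ne nxz] obtain f1 where f1:
      "\<And>v. v \<in> S \<Longrightarrow> f1 v \<in> S \<and> f1 (f1 v) = v \<and> f1 v \<noteq> v" "f1 x = z"
      "\<And>v. v \<in> S \<Longrightarrow> v \<notin> {x, z} \<Longrightarrow> (v, f1 v) \<in> R" by blast
    from add[OF S(2) w(1) w(2)[symmetric] w(3)] obtain f2 where f2:
      "\<And>v. v \<in> S \<Longrightarrow> f2 v \<in> S \<and> f2 (f2 v) = v \<and> f2 v \<noteq> v" "f2 y = w"
      "\<And>v. v \<in> S \<Longrightarrow> v \<notin> {y, w} \<Longrightarrow> (v, f2 v) \<in> R" by blast
    have "perfect_matching S (\<lambda>u v. (u, v) \<in> R)"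
      using lovasz_exchange[where E = "\<lambda>u v. (u, v) \<in> R", OF fin RS(3) f1(1,3) f2(1,3) f1(2) f2(2) S w(1)
        RS(4)[OF xy] RS(4)[OF yz, symmetric] ne xy RS(3)[OF yz]] .
    thus False using nR by blast
  qed
  \<comment> \<open>Matchings are encoded as involutions whose fixed points are the unmatched
    vertices. Minimizing the number of fixed points gives a maximum matching; the identity shows
    that there is one.\<close>
  define inv where "inv f \<longleftrightarrow> (\<forall>v\<in>S. f v \<in> S \<and> f (f v) = v \<and> (f v \<noteq> v \<longrightarrow> (v, f v) \<in> R))" for f
  have "inv id" by (simp add: inv_def)
  from ex_has_least_nat[of inv, OF this, of "\<lambda>f. card {v\<in>S. f v = v}"]
  obtain f where f: "inv f" and min: "\<And>g. inv g \<Longrightarrow> card {v\<in>S. f v = v} \<le> card {v\<in>S. g v = v}" by blast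
  define F where "F = {v\<in>S. f v = v}"
  have finF: "finite F" using fin by (simp add: F_def)
  have fS: "f v \<in> S" "f (f v) = v" if "v \<in> S" for v using f that unfolding inv_def by blast+
  have fR: "(v, f v) \<in> R" if "v \<in> S" "v \<notin> F" for v using f that unfolding inv_def F_def by blast
  have Ff: "f v = v" "v \<in> S" if "v \<in> F" for v using that by (auto simp: F_def)
  have fF: "f v \<notin> F" if "v \<in> S" "v \<notin> F" for v using that fS[of v] by (auto simp: F_def)
  have "F \<noteq> {}"
  proof
    assume "F = {}"
    hence "\<forall>v\<in>S. f v \<in> S \<and> f (f v) = v \<and> (v, f v) \<in> R" using fS fR by auto
    thus False using nR unfolding perfect_matching_def by blast
  qed
  moreover have "even (card F)"
  proof -
    have "even (card (S - F))"
      by (rule even_card_involution[of _ f]) (use fin fS fF in \<open>auto simp: F_def\<close>)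
    moreover have "card S = card F + card (S - F)"
      using card_Diff_subset[OF finF, of S] card_mono[OF fin, of F] by (auto simp: F_def)
    ultimately show ?thesis using ev by simp
  qed
  ultimately have F2: "card F \<ge> 2" using finF
    by (metis One_nat_def card_0_eq less_2_cases_iff linorder_not_le odd_one)
  have other: "\<exists>x'\<in>F. x' \<noteq> x" for x
  proof (rule ccontr)
    assume "\<not> ?thesis"
    hence "F \<subseteq> {x}" by blast
    hence "card F \<le> 1" using card_mono[of "{x}" F] by simp
    thus False using F2 by simp
  qed
  have contra: False if "inv g" "\<And>v. g v = f v \<or> g v \<noteq> v" "x \<in> F" "g x \<noteq> x" for g x
  proof -
    have "{v\<in>S. g v = v} \<subseteq> F - {x}" using that(2,4) unfolding F_def by force
    hence "{v\<in>S. g v = v} \<subset> F" using that(3) by blast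
    hence "card {v\<in>S. g v = v} < card F" using finF by (rule psubset_card_mono[rotated])
    thus False using min[OF that(1)] by (simp add: F_def)
  qed
  \<comment> \<open>The three facts \<open>aug1\<close>, \<open>aug2\<close> and \<open>aug3\<close>
    exclude augmenting paths with one, three and five edges. Longer ones are not considered, since
    universal vertices are joined to every unmatched vertex.\<close>
  have aug1: "(x, x') \<notin> R" if x: "x \<in> F" "x' \<in> F" for x x'
  proof
    assume r: "(x, x') \<in> R"
    have ne: "x \<noteq> x'" using RS r by blast
    have "inv (f(x := x', x' := x))" unfolding inv_def
    proof
      fix v assume v: "v \<in> S"
      show "(f(x := x', x' := x)) v \<in> S \<and> (f(x := x', x' := x)) ((f(x := x', x' := x)) v) = v \<and>
        ((f(x := x', x' := x)) v \<noteq> v \<longrightarrow> (v, (f(x := x', x' := x)) v) \<in> R)"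
        using r RS(3)[OF r] ne Ff[OF x(1)] Ff[OF x(2)] fS[OF v] fR[OF v] by (auto simp: F_def)
    qed
    thus False by (rule contra[of _ x]) (use x ne Ff in auto)
  qed
  have aug2: "(f u, x') \<notin> R" if x: "x \<in> F" "x' \<in> F" "x \<noteq> x'" and u: "u \<in> S" "u \<notin> F" and r: "(x, u) \<in> R" for x x' u
  proof
    assume r': "(f u, x') \<in> R"
    have ne: "x \<noteq> u" "x' \<noteq> u" "f u \<noteq> x" "f u \<noteq> x'" "f u \<noteq> u" using x u fF[OF u] by (auto simp: F_def)
    define g where "g = f(x := u, u := x, f u := x', x' := f u)"
    have "inv g" unfolding inv_def
    proof
      fix v assume v: "v \<in> S"
      consider "v = x" | "v = u" | "v = f u" | "v = x'" | "v \<notin> {x, u, f u, x'}" by blast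
      then show "g v \<in> S \<and> g (g v) = v \<and> (g v \<noteq> v \<longrightarrow> (v, g v) \<in> R)"
      proof cases
        case 5
        hence "f v \<notin> {x, u, f u, x'}" using fS[OF v] fS[OF u(1)] Ff x by (metis insertE insertI1 insertI2 singletonD)
        then show ?thesis using 5 fS[OF v] fR[OF v] Ff[of v] by (auto simp: g_def)
      qed (use r r' RS[OF r] RS[OF r'] ne x(3) u in \<open>auto simp: g_def\<close>)
    qed
    thus False by (rule contra[of _ x]) (use x ne Ff[OF x(2)] in \<open>auto simp: g_def\<close>)
  qed
  have aug3: "(f u, f u') \<notin> R" if x: "x \<in> F" "x' \<in> F" "x \<noteq> x'" and u: "u \<in> S" "u \<notin> F" "u' \<in> S" "u' \<notin> F" "u \<noteq> u'" "f u \<noteq> u'"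
      and r: "(x, u) \<in> R" "(x', u') \<in> R" for x x' u u'
  proof
    assume r': "(f u, f u') \<in> R"
    have ne: "x \<noteq> u" "x' \<noteq> u" "f u \<noteq> x" "f u \<noteq> x'" "f u \<noteq> u" "x \<noteq> u'" "x' \<noteq> u'" "f u' \<noteq> x" "f u' \<noteq> x'" "f u' \<noteq> u'"
        "f u' \<noteq> f u" "f u' \<noteq> u"
      using x u fF[OF u(1,2)] fF[OF u(3,4)] fS[OF u(1)] fS[OF u(3)] by (auto simp: F_def)
    define g where "g = f(x := u, u := x, x' := u', u' := x', f u := f u', f u' := f u)"
    have "inv g" unfolding inv_def
    proof
      fix v assume v: "v \<in> S"
      consider "v = x" | "v = u" | "v = f u" | "v = x'" | "v = u'" | "v = f u'"
        | "v \<notin> {x, u, f u, x', u', f u'}" by blast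
      then show "g v \<in> S \<and> g (g v) = v \<and> (g v \<noteq> v \<longrightarrow> (v, g v) \<in> R)"
      proof cases
        case 7
        hence "f v \<notin> {x, u, f u, x', u', f u'}" using fS[OF v] fS[OF u(1)] fS[OF u(3)] Ff x
          by (metis insertE insertI1 insertI2 singletonD)
        then show ?thesis using 7 fS[OF v] fR[OF v] Ff[of v] by (auto simp: g_def)
      qed (use r r' RS[OF r(1)] RS[OF r(2)] RS[OF r'] ne x(3) u(5,6) in \<open>auto simp: g_def\<close>)
    qed
    thus False by (rule contra[of _ x]) (use x ne u Ff[OF x(2)] in \<open>auto simp: g_def\<close>)
  qed
  have UF: "u \<notin> F" if "u \<in> U" for u
  proof
    assume "u \<in> F"
    moreover obtain x' where "x' \<in> F" "x' \<noteq> u" using other by blast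
    ultimately show False using aug1[of u x'] that Ff[of x'] by (auto simp: U_def)
  qed
  have Uadj: "(x, u) \<in> R" if "u \<in> U" "x \<in> S" "x \<noteq> u" for u x
    using that RS(3) unfolding U_def by blast
  obtain x1 where x1: "x1 \<in> F" using other by blast
  obtain x2 where x2: "x2 \<in> F" "x2 \<noteq> x1" using other by blast
  have fU: "f u \<notin> U" if u: "u \<in> U" for u
  proof
    assume fu: "f u \<in> U"
    have uS: "u \<in> S" using u US by blast
    have "(x1, u) \<in> R" using Uadj[OF u] Ff[OF x1] UF[OF u] x1 by blast
    moreover have "(x2, f u) \<in> R" using Uadj[OF fu] Ff[OF x2(1)] UF[OF fu] x2 by blast
    hence "(f u, x2) \<in> R" using RS by blast
    ultimately show False using aug2[OF x1 x2(1) x2(2)[symmetric] uS UF[OF u]] by blast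
  qed
  \<comment> \<open>Vertices of \<open>U\<close> are matched outside \<open>U\<close>. Their
    partners and the unmatched vertices are pairwise nonadjacent, so they lie in different cliques,
    and their number exceeds \<open>card U\<close> by the number of unmatched vertices.\<close>
  define D where "D = f ` U \<union> F"
  have DS: "D \<subseteq> S - U" using US fS fU UF Ff by (auto simp: D_def)
  have PF: "f ` U \<inter> F = {}" using fF US UF by blast
  have cardD: "card D = card U + card F"
  proof -
    have "inj_on f U" using fS US by (metis inj_on_inverseI subsetD)
    thus ?thesis using PF finF finite_subset[OF US fin] by (simp add: D_def card_Un_disjoint card_image)
  qed
  have PFn: "(p, x') \<notin> R" if px: "p \<in> f ` U" "x' \<in> F" for p x'
  proof -
    obtain u where u: "u \<in> U" "p = f u" using px by blast
    obtain x where x: "x \<in> F" "x \<noteq> x'" using other by blast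
    have "(x, u) \<in> R" using Uadj[OF u(1)] Ff[OF x(1)] UF[OF u(1)] x by blast
    thus ?thesis using aug2[OF x(1) that(2) x(2)] u UF US by blast
  qed
  have Dn: "(d, d') \<notin> R" if dd: "d \<in> D" "d' \<in> D" "d \<noteq> d'" for d d'
  proof -
    consider "d \<in> F" "d' \<in> F" | "d \<in> f ` U" "d' \<in> F" | "d \<in> F" "d' \<in> f ` U" | "d \<in> f ` U" "d' \<in> f ` U"
      using dd unfolding D_def by blast
    then show ?thesis
    proof cases
      case 3 then show ?thesis using PFn RS(3) by blast
    next
      case 4
      then obtain u u' where u: "u \<in> U" "d = f u" "u' \<in> U" "d' = f u'" by blast
      have "(x1, u) \<in> R" using Uadj[OF u(1)] Ff[OF x1] UF[OF u(1)] x1 by blast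
      moreover have "(x2, u') \<in> R" using Uadj[OF u(3)] Ff[OF x2(1)] UF[OF u(3)] x2 by blast
      moreover have "f u \<noteq> u'" using fU u by blast
      ultimately show ?thesis
        using aug3[OF x1 x2(1) x2(2)[symmetric], of u u'] u US UF that(3) by blast
    qed (use aug1 PFn in auto)
  qed
  define K where "K d = {v\<in>S - U. v = d \<or> (d, v) \<in> R}" for d
  have dK: "d \<in> K d" if "d \<in> D" for d using that DS by (auto simp: K_def)
  have disjK: "K d \<inter> K d' = {}" if d: "d \<in> D" "d' \<in> D" "d \<noteq> d'" for d d'
  proof (rule ccontr)
    assume "K d \<inter> K d' \<noteq> {}"
    then obtain v where v: "v \<notin> U" "v = d \<or> (d, v) \<in> R" "v = d' \<or> (d', v) \<in> R" by (auto simp: K_def)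
    have "(d, d') \<in> R"
    proof (cases "v = d \<or> v = d'")
      case True then show ?thesis using v RS(3) d by blast
    next
      case False then show ?thesis using v tr[of d v d'] RS(3) d by blast
    qed
    thus False using Dn d by blast
  qed
  have noedge: "(u, v) \<notin> R" if "d \<in> D" "u \<in> K d" "v \<in> S - U - K d" for d u v
  proof
    assume r: "(u, v) \<in> R"
    have "v \<noteq> d" using that dK by blast
    have "(d, v) \<in> R"
    proof (cases "u = d")
      case False
      then show ?thesis using tr[of d u v] that r \<open>v \<noteq> d\<close> by (auto simp: K_def)
    qed (use r in simp)
    thus False using that by (auto simp: K_def)
  qed
  \<comment> \<open>The matching preserves the clique of \<open>d\<close> up to \<open>d\<close>
    itself, which is either unmatched or has its partner in \<open>U\<close>.\<close>
  have oddK: "odd (card (K d))" if d: "d \<in> D" for d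
  proof -
    have "even (card (K d - {d}))"
    proof (rule even_card_involution[of _ f])
      show "finite (K d - {d})" using fin by (simp add: K_def)
      fix v assume v: "v \<in> K d - {d}"
      have vS: "v \<in> S" "v \<notin> U" "(d, v) \<in> R" using v by (auto simp: K_def)
      have vD: "v \<notin> D" using Dn[of d v] d vS v by blast
      hence vF: "v \<notin> F" by (auto simp: D_def)
      have fvU: "f v \<notin> U"
      proof
        assume "f v \<in> U"
        hence "f (f v) \<in> D" by (auto simp: D_def)
        thus False using vD fS[OF vS(1)] by simp
      qed
      have "f v \<in> K d" using noedge[OF d, of v "f v"] v fvU fS[OF vS(1)] fR[OF vS(1) vF] by blast
      moreover have "f v \<noteq> d"
      proof
        assume "f v = d"
        hence "v = f d" using fS[OF vS(1)] by simp
        moreover have "f d \<in> U \<or> f d = d"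
        proof (cases "d \<in> F")
          case False
          then obtain u where "u \<in> U" "d = f u" using d by (auto simp: D_def)
          then show ?thesis using fS(2)[of u] US by auto
        qed (simp add: Ff)
        ultimately show False using vS v by auto
      qed
      ultimately show "f v \<in> K d - {d} \<and> f (f v) = v \<and> f v \<noteq> v" using fS[OF vS(1)] vF vS(1) by (auto simp: F_def)
    qed
    moreover have "card (K d) = Suc (card (K d - {d}))"
    proof -
      have "finite (K d)" using fin by (simp add: K_def)
      from card_Suc_Diff1[OF this dK[OF d]] show ?thesis by simp
    qed
    ultimately show ?thesis by simp
  qed
  have "inj_on K D"
  proof (rule inj_onI, rule ccontr)
    fix d d' assume d: "d \<in> D" "d' \<in> D" "K d = K d'" "d \<noteq> d'"
    thus False using disjK[OF d(1,2,4)] dK[OF d(1)] by simp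
  qed
  hence "card (K ` D) = card U + card F" using cardD by (simp add: card_image)
  moreover have "disjoint (K ` D)" using disjK unfolding disjoint_def by blast
  moreover have "\<forall>X\<in>K ` D. X \<subseteq> S - U \<and> odd (card X) \<and> (\<forall>u\<in>X. \<forall>v\<in>S - U - X. \<not> E u v)"
  proof
    fix X assume "X \<in> K ` D"
    then obtain d where d: "d \<in> D" "X = K d" by blast
    have "\<not> E u v" if "u \<in> K d" "v \<in> S - U - K d" for u v
      using noedge[OF d(1) that] ER that by (auto simp: K_def)
    thus "X \<subseteq> S - U \<and> odd (card X) \<and> (\<forall>u\<in>X. \<forall>v\<in>S - U - X. \<not> E u v)"
      using oddK[OF d(1)] d(2) by (auto simp: K_def)
  qed
  ultimately show ?thesis using US F2 by (intro exI[of _ U] exI[of _ "K ` D"]) simp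
qed

section \<open>Greedy choice of disjoint sets\<close>

text \<open>The induction also keeps the sets already extended disjoint from the members of
  \<open>J\<close> that are still waiting. Extended and waiting members together are at most
  \<open>card J\<close> sets of at most three elements, hence the bound on the forbidden set
  \<open>Z\<close>.\<close>

lemma greedy_disjoint_extension:
  assumes "finite J" "disjoint J" "\<And>t. t \<in> J \<Longrightarrow> finite t \<and> card t \<le> 3"
    and ext: "\<And>t Z. t \<in> J \<Longrightarrow> finite Z \<Longrightarrow> card Z \<le> 3 * card J \<Longrightarrow> Z \<inter> t = {} \<Longrightarrow>
       \<exists>T. P t T \<and> t \<subseteq> T \<and> finite T \<and> card T \<le> 3 \<and> T \<inter> Z = {}"
  shows "\<exists>F. (\<forall>t\<in>J. P t (F t) \<and> t \<subseteq> F t \<and> finite (F t) \<and> card (F t) \<le> 3) \<and> disjoint_family_on F J"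
proof -
  have "\<exists>F. (\<forall>t\<in>J'. P t (F t) \<and> t \<subseteq> F t \<and> finite (F t) \<and> card (F t) \<le> 3 \<and> F t \<inter> \<Union>(J - J') = {}) \<and> disjoint_family_on F J'"
    if "finite J'" "J' \<subseteq> J" for J'
    using that
  proof (induction J' rule: finite_induct)
    case empty then show ?case by (simp add: disjoint_family_on_def)
  next
    case (insert t J')
    have tJ: "t \<in> J" and J'J: "J' \<subseteq> J" using insert.prems by blast+
    from insert.IH[OF J'J]
    obtain F where F: "\<forall>s\<in>J'. P s (F s) \<and> s \<subseteq> F s \<and> finite (F s) \<and> card (F s) \<le> 3 \<and> F s \<inter> \<Union>(J - J') = {}"
      and dF: "disjoint_family_on F J'" by (elim exE conjE)
    let ?Z = "(\<Union>s\<in>J'. F s) \<union> \<Union>(J - insert t J')"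
    have finZ: "finite ?Z" using F insert.hyps assms(1,3) by auto
    have "card ?Z \<le> card (\<Union>s\<in>J'. F s) + card (\<Union>(J - insert t J'))" by (rule card_Un_le)
    also have "card (\<Union>s\<in>J'. F s) \<le> (\<Sum>s\<in>J'. card (F s))" using insert.hyps by (intro card_UN_le) auto
    also have "\<dots> \<le> (\<Sum>s\<in>J'. 3)" using F by (intro sum_mono) auto
    also have "card (\<Union>(J - insert t J')) \<le> (\<Sum>s\<in>J - insert t J'. card s)"
      using card_UN_le[of "J - insert t J'" "\<lambda>x. x"] assms(1) by simp
    also have "\<dots> \<le> (\<Sum>s\<in>J - insert t J'. 3)" using assms(3) by (intro sum_mono) auto
    finally have "card ?Z \<le> 3 * (card J' + card (J - insert t J'))" by simp
    also have "card J' + card (J - insert t J') \<le> card J"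
    proof -
      have "card J' + card (J - insert t J') = card (J' \<union> (J - insert t J'))"
        using insert.hyps assms(1) by (subst card_Un_disjoint) auto
      also have "\<dots> \<le> card J" using insert.prems assms(1) by (intro card_mono) auto
      finally show ?thesis .
    qed
    finally have cZ: "card ?Z \<le> 3 * card J" by simp
    have "?Z \<inter> t = {}"
    proof -
      have "F s \<inter> t = {}" if "s \<in> J'" for s using bspec[OF F that] tJ insert.hyps by blast
      moreover have "s \<inter> t = {}" if "s \<in> J - insert t J'" for s
        using that tJ assms(2) unfolding disjoint_def by blast
      ultimately show ?thesis by blast
    qed
    from ext[OF tJ finZ cZ this] obtain T where
      T: "P t T" "t \<subseteq> T" "finite T" "card T \<le> 3" "T \<inter> ?Z = {}" by blast
    have ts: "s \<in> J' \<Longrightarrow> s \<noteq> t" for s using insert.hyps by blast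
    show ?case
    proof (intro exI[of _ "F(t := T)"] conjI)
      show "\<forall>s\<in>insert t J'. P s ((F(t := T)) s) \<and> s \<subseteq> (F(t := T)) s \<and> finite ((F(t := T)) s) \<and>
         card ((F(t := T)) s) \<le> 3 \<and> (F(t := T)) s \<inter> \<Union> (J - insert t J') = {}"
        using F T by auto
      show "disjoint_family_on (F(t := T)) (insert t J')"
        using dF T(5) ts unfolding disjoint_family_on_def by auto
    qed
  qed
  from this[of J] assms(1) show ?thesis by auto
qed

lemma greedy_disjoint_sets:
  assumes "\<And>Z. finite Z \<Longrightarrow> card Z \<le> 3 * k \<Longrightarrow> \<exists>T. P T \<and> finite T \<and> T \<noteq> {} \<and> card T \<le> 3 \<and> T \<inter> Z = {}"
  shows "\<exists>M. finite M \<and> card M = k \<and> disjoint M \<and> (\<forall>T\<in>M. P T \<and> finite T \<and> card T \<le> 3)"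
proof -
  have "\<exists>M. finite M \<and> card M = m \<and> disjoint M \<and> (\<forall>T\<in>M. P T \<and> finite T \<and> card T \<le> 3)" if "m \<le> k" for m
    using that
  proof (induction m)
    case 0
    show ?case by (rule exI[of _ "{}"]) simp
  next
    case (Suc m)
    then obtain M where M: "finite M" "card M = m" "disjoint M" "\<forall>T\<in>M. P T \<and> finite T \<and> card T \<le> 3" by auto
    have "card (\<Union>M) \<le> (\<Sum>s\<in>M. card s)" using card_UN_le[of M "\<lambda>x. x"] M by simp
    also have "\<dots> \<le> (\<Sum>s\<in>M. 3)" using M by (intro sum_mono) auto
    finally have "card (\<Union>M) \<le> 3 * k" using M Suc.prems by simp
    then obtain T where T: "P T" "finite T" "T \<noteq> {}" "card T \<le> 3" "T \<inter> \<Union>M = {}"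
      using assms[of "\<Union>M"] M by auto
    \<comment> \<open>Nonemptiness makes the new set different from all earlier ones, so that the
      cardinality really grows.\<close>
    have "T \<notin> M" using T by blast
    moreover have "disjoint (insert T M)" using M T unfolding disjoint_def by blast
    ultimately show ?case using M T by (intro exI[of _ "insert T M"]) auto
  qed
  thus ?thesis by blast
qed

section \<open>Neighbour counts and sparse triples\<close>

text \<open>Markov's inequality in multiplied form.\<close>

lemma card_exceeding_le:
  fixes f :: "'b \<Rightarrow> real"
  assumes "finite P" "\<And>v. v \<in> P \<Longrightarrow> 0 \<le> f v"
  shows "real (card {v\<in>P. f v > t}) * t \<le> sum f P"
proof -
  have "real (card {v\<in>P. f v > t}) * t = (\<Sum>v\<in>{v\<in>P. f v > t}. t)" by simp
  also have "\<dots> \<le> (\<Sum>v\<in>{v\<in>P. f v > t}. f v)" by (intro sum_mono) auto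
  also have "\<dots> \<le> sum f P" using assms by (intro sum_mono2) auto
  finally show ?thesis .
qed

text \<open>Counts are real numbers, so that the later estimates are linear arithmetic without
  truncated subtraction.\<close>

definition nbrs :: "('a \<Rightarrow> 'a \<Rightarrow> bool) \<Rightarrow> 'a \<Rightarrow> 'a set \<Rightarrow> real" where
  "nbrs E v S = real (card {u\<in>S. E v u})"

definition nonnbrs :: "('a \<Rightarrow> 'a \<Rightarrow> bool) \<Rightarrow> 'a \<Rightarrow> 'a set \<Rightarrow> real" where
  "nonnbrs E v S = real (card {u\<in>S. \<not> E v u})"

lemma nonnbrs_as_nbrs: "nonnbrs E = nbrs (\<lambda>u v. \<not> E u v)"
  by (simp add: nonnbrs_def nbrs_def fun_eq_iff)

lemma nbrs_nonneg [simp]: "0 \<le> nbrs E v S" and nonnbrs_nonneg [simp]: "0 \<le> nonnbrs E v S"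
  by (simp_all add: nbrs_def nonnbrs_def)

lemma nbrs_plus_nonnbrs: "finite S \<Longrightarrow> nbrs E v S + nonnbrs E v S = real (card S)"
proof -
  assume "finite S"
  hence "card ({u\<in>S. E v u} \<union> {u\<in>S. \<not> E v u}) = card {u\<in>S. E v u} + card {u\<in>S. \<not> E v u}"
    by (intro card_Un_disjoint) auto
  moreover have "{u\<in>S. E v u} \<union> {u\<in>S. \<not> E v u} = S" by blast
  ultimately show ?thesis by (simp add: nbrs_def nonnbrs_def)
qed

lemma nbrs_mono: "S \<subseteq> S' \<Longrightarrow> finite S' \<Longrightarrow> nbrs E v S \<le> nbrs E v S'"
  unfolding nbrs_def by (intro of_nat_mono card_mono) auto

lemma nonnbrs_mono: "S \<subseteq> S' \<Longrightarrow> finite S' \<Longrightarrow> nonnbrs E v S \<le> nonnbrs E v S'"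
  unfolding nonnbrs_as_nbrs by (rule nbrs_mono)

lemma nbrs_le_card: "finite S \<Longrightarrow> nbrs E v S \<le> real (card S)"
  unfolding nbrs_def by (intro of_nat_mono card_mono) auto

lemma nbrs_Un: "finite S \<Longrightarrow> finite S' \<Longrightarrow> S \<inter> S' = {} \<Longrightarrow> nbrs E v (S \<union> S') = nbrs E v S + nbrs E v S'"
proof -
  assume "finite S" "finite S'" "S \<inter> S' = {}"
  hence "card ({u\<in>S. E v u} \<union> {u\<in>S'. E v u}) = card {u\<in>S. E v u} + card {u\<in>S'. E v u}"
    by (intro card_Un_disjoint) auto
  moreover have "{u\<in>S \<union> S'. E v u} = {u\<in>S. E v u} \<union> {u\<in>S'. E v u}" by blast
  ultimately show ?thesis by (simp add: nbrs_def)
qed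

lemma nonnbrs_Un: "finite S \<Longrightarrow> finite S' \<Longrightarrow> S \<inter> S' = {} \<Longrightarrow> nonnbrs E v (S \<union> S') = nonnbrs E v S + nonnbrs E v S'"
  unfolding nonnbrs_as_nbrs by (rule nbrs_Un)

lemma nbrs_le_plus_card: "finite S \<Longrightarrow> finite S' \<Longrightarrow> nbrs E v S \<le> nbrs E v S' + real (card (S - S'))"
proof -
  assume fin: "finite S" "finite S'"
  have "nbrs E v S \<le> nbrs E v (S' \<union> (S - S'))" using fin by (intro nbrs_mono) auto
  also have "\<dots> = nbrs E v S' + nbrs E v (S - S')" using fin by (intro nbrs_Un) auto
  finally show ?thesis using nbrs_le_card[of "S - S'" E v] fin by simp
qed

lemma nonnbrs_le_plus_card: "finite S \<Longrightarrow> finite S' \<Longrightarrow> nonnbrs E v S \<le> nonnbrs E v S' + real (card (S - S'))"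
  unfolding nonnbrs_as_nbrs by (rule nbrs_le_plus_card)

lemma card_le_plus_Diff: "finite S \<Longrightarrow> finite S' \<Longrightarrow> real (card S) \<le> real (card S') + real (card (S - S'))"
  using nbrs_le_plus_card[of S S' "\<lambda>u v. True" undefined] by (simp add: nbrs_def)

lemma obtain_nbr:
  assumes "finite S" "finite Z" "nbrs E v S > real (card Z)"
  obtains u where "u \<in> S" "E v u" "u \<notin> Z"
proof -
  have "\<not> {u\<in>S. E v u} \<subseteq> Z" using assms card_mono[of Z "{u\<in>S. E v u}"] by (auto simp: nbrs_def)
  thus ?thesis using that by blast
qed

lemma obtain_common_nbr:
  assumes "finite S" "finite Z" "nbrs E v S > nonnbrs E v' S + real (card Z)"
  obtains u where "u \<in> S" "E v u" "E v' u" "u \<notin> Z"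
proof -
  let ?Z = "{u\<in>S. \<not> E v' u} \<union> Z"
  have "real (card ?Z) \<le> nonnbrs E v' S + real (card Z)"
    using card_Un_le[of "{u\<in>S. \<not> E v' u}" Z] by (simp add: nonnbrs_def flip: of_nat_add)
  then obtain u where "u \<in> S" "E v u" "u \<notin> ?Z"
    using obtain_nbr[of S ?Z E v] assms by auto
  thus ?thesis using that by blast
qed

lemma sum_nbrs_swap:
  assumes "finite P" "finite Q" "\<And>u v. E u v \<longleftrightarrow> E v u"
  shows "(\<Sum>v\<in>P. nbrs E v Q) = (\<Sum>u\<in>Q. nbrs E u P)"
proof -
  have "nbrs E v Q = (\<Sum>u\<in>Q. if E v u then 1 else 0)" if "finite Q" for v Q
    using that by (simp add: nbrs_def sum.If_cases Int_def)
  then show ?thesis using sum.swap[of "\<lambda>v u. if E v u then 1 else (0::real)" Q P] assms by simp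
qed

lemma sum_nonnbrs_swap:
  assumes "finite P" "finite Q" "\<And>u v. E u v \<longleftrightarrow> E v u"
  shows "(\<Sum>v\<in>P. nonnbrs E v Q) = (\<Sum>u\<in>Q. nonnbrs E u P)"
  unfolding nonnbrs_as_nbrs by (rule sum_nbrs_swap) (use assms in auto)

lemma edges_between_eq_sum_nbrs:
  assumes "finite A" "finite B"
  shows "real (edges_between E A B) = (\<Sum>a\<in>A. nbrs E a B)"
proof -
  have "{(a, b). a \<in> A \<and> b \<in> B \<and> E a b} = Sigma A (\<lambda>a. {b\<in>B. E a b})" by blast
  thus ?thesis using assms by (simp add: edges_between_def nbrs_def card_SigmaI)
qed

section \<open>The setting: three classes of \<open>3 * h\<close> vertices\<close>

definition I3 :: "nat set" where "I3 = {1, 2, 3}"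

lemma finite_I3 [simp]: "finite I3" and card_I3 [simp]: "card I3 = 3"
  by (simp_all add: I3_def)

lemma I3_third:
  assumes "i \<in> I3" "j \<in> I3" "i \<noteq> j"
  obtains k where "k \<in> I3" "k \<noteq> i" "k \<noteq> j" "I3 = {i, j, k}"
proof -
  \<comment> \<open>The three indices add up to 6, which gives an explicit formula for the third
    one.\<close>
  have "6 - i - j \<in> I3 \<and> 6 - i - j \<noteq> i \<and> 6 - i - j \<noteq> j \<and> I3 = {i, j, 6 - i - j}"
    using assms unfolding I3_def by (elim insertE emptyE) (simp_all add: insert_commute)
  thus ?thesis using that by blast
qed

lemma I3_other:
  obtains j where "j \<in> I3" "j \<noteq> i"
proof (cases "i = 1")
  case True
  then show thesis by (intro that[of 2]) (auto simp: I3_def)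
next
  case False
  then show thesis by (intro that[of 1]) (auto simp: I3_def)
qed

lemma I3_others:
  assumes "i \<in> I3"
  obtains j k where "j \<in> I3" "k \<in> I3" "j \<noteq> i" "k \<noteq> i" "j \<noteq> k" "I3 = {i, j, k}"
proof -
  obtain j where j: "j \<in> I3" "j \<noteq> i" by (rule I3_other)
  obtain k where "k \<in> I3" "k \<noteq> i" "k \<noteq> j" "I3 = {i, j, k}"
    by (rule I3_third[OF assms j(1) j(2)[symmetric]])
  thus ?thesis using j by (intro that[of j k]) auto
qed

text \<open>Here \<open>h\<close> is a third of the class size. The minimum degree is stated as a
  bound on nonneighbours: a vertex has a neighbour in every set of more than \<open>h\<close>
  vertices of another class.\<close>

locale tripartite =
  fixes V :: "nat \<Rightarrow> 'a set" and E :: "'a \<Rightarrow> 'a \<Rightarrow> bool" and h :: nat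
  assumes fin: "i \<in> I3 \<Longrightarrow> finite (V i)"
    and disj: "i \<in> I3 \<Longrightarrow> j \<in> I3 \<Longrightarrow> i \<noteq> j \<Longrightarrow> V i \<inter> V j = {}"
    and sym: "E u v \<Longrightarrow> E v u"
    and cross: "E u v \<Longrightarrow> \<exists>i\<in>I3. \<exists>j\<in>I3. i \<noteq> j \<and> u \<in> V i \<and> v \<in> V j"
    and card_V: "i \<in> I3 \<Longrightarrow> card (V i) = 3 * h"
    and nonadj: "i \<in> I3 \<Longrightarrow> j \<in> I3 \<Longrightarrow> i \<noteq> j \<Longrightarrow> v \<in> V i \<Longrightarrow> nonnbrs E v (V j) \<le> real h"
begin

abbreviation nb where "nb \<equiv> nbrs E"
abbreviation nn where "nn \<equiv> nonnbrs E"

definition vtx :: "'a set" where "vtx = (\<Union>i\<in>I3. V i)"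

lemma sym_iff: "E u v \<longleftrightarrow> E v u" using sym by blast

lemma fin_Int [simp]: "i \<in> I3 \<Longrightarrow> finite (S \<inter> V i)" and fin_Int' [simp]: "i \<in> I3 \<Longrightarrow> finite (V i \<inter> S)"
  and fin_Diff [simp]: "i \<in> I3 \<Longrightarrow> finite (V i - S)"
  using fin by auto

lemma fin_vtx: "finite vtx" unfolding vtx_def using fin by simp

lemma class_unique: "i \<in> I3 \<Longrightarrow> j \<in> I3 \<Longrightarrow> v \<in> V i \<Longrightarrow> v \<in> V j \<Longrightarrow> i = j" using disj by blast

lemma not_adj_same: "i \<in> I3 \<Longrightarrow> u \<in> V i \<Longrightarrow> v \<in> V i \<Longrightarrow> \<not> E u v"
  using cross class_unique by metis

lemma irrefl: "\<not> E u u" using cross class_unique by metis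

lemma nn_le: 
  assumes "i \<in> I3" "j \<in> I3" "i \<noteq> j" "v \<in> V i" "S \<subseteq> V j"
  shows "nn v S \<le> real h"
  using nonnbrs_mono[OF assms(5) fin[OF assms(2)], of E v] nonadj[OF assms(1-4)] by linarith

definition likes :: "(nat \<Rightarrow> 'a set) \<Rightarrow> real \<Rightarrow> 'a set" where
  "likes A a = {v. \<exists>i\<in>I3. v \<in> V i \<and> (\<forall>j\<in>I3. j \<noteq> i \<longrightarrow> nb v (A j) \<le> a)}"

lemma likes_iff: "i \<in> I3 \<Longrightarrow> v \<in> V i \<Longrightarrow> v \<in> likes A a \<longleftrightarrow> (\<forall>j\<in>I3. j \<noteq> i \<longrightarrow> nb v (A j) \<le> a)"
  unfolding likes_def mem_Collect_eq using class_unique by metis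

text \<open>The properties of a completed sparse triple \<open>L\<close> that all later arguments
  rely on. The core \<open>P\<close> consists of its especially typical vertices: such a vertex
  misses at most \<open>a / 2\<close> vertices outside \<open>L\<close> in another class, whereas a
  vertex outside \<open>L\<close> has at least \<open>a - w\<close> neighbours in some part of
  \<open>P\<close>. This gap produces common neighbours.\<close>

definition like_set :: "real \<Rightarrow> real \<Rightarrow> 'a set \<Rightarrow> 'a set \<Rightarrow> bool" where
  "like_set a w L P \<longleftrightarrow> L \<subseteq> vtx \<and> P \<subseteq> L \<and>
    (\<forall>i\<in>I3. real h - w \<le> real (card (L \<inter> V i)) \<and> real (card (L \<inter> V i)) \<le> real h + w) \<and>
    (\<forall>i\<in>I3. \<forall>j\<in>I3. i \<noteq> j \<longrightarrow> (\<forall>v\<in>L \<inter> V i. nn v (V j - L) \<le> 2 * a \<and> nb v (L \<inter> V j) \<le> 2 * a)) \<and>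
    (\<forall>i\<in>I3. \<forall>j\<in>I3. i \<noteq> j \<longrightarrow> (\<forall>v\<in>P \<inter> V i. nn v (V j - L) \<le> a / 2)) \<and>
    (\<forall>i\<in>I3. real (card (L \<inter> V i - P)) \<le> 2 * w) \<and>
    (\<forall>i\<in>I3. \<forall>v\<in>V i - L. \<exists>j\<in>I3. j \<noteq> i \<and> nb v (P \<inter> V j) \<ge> a - w) \<and>
    (\<forall>i\<in>I3. real (card {v\<in>V i - L. \<exists>j\<in>I3. j \<noteq> i \<and> nn v (L \<inter> V j) > 2 * a}) \<le> 2 * w)"

text \<open>The parameter \<open>d\<close> bounds numbers of edges rather than densities; it is of
  order \<open>h * h\<close> in the applications.\<close>

definition sparse_triple :: "real \<Rightarrow> (nat \<Rightarrow> 'a set) \<Rightarrow> bool" where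
  "sparse_triple d A \<longleftrightarrow> (\<forall>i\<in>I3. A i \<subseteq> V i \<and> card (A i) = h) \<and>
     (\<forall>i\<in>I3. \<forall>j\<in>I3. i \<noteq> j \<longrightarrow> (\<Sum>v\<in>A i. nb v (A j)) \<le> d)"

lemma card_bad_le:
  assumes i: "i \<in> I3" and fin: "finite S" and bad: "\<And>v. v \<in> S \<Longrightarrow> \<exists>j\<in>I3. j \<noteq> i \<and> v \<in> T j"
    and T: "\<And>j. j \<in> I3 \<Longrightarrow> j \<noteq> i \<Longrightarrow> finite (T j) \<and> real (card (T j)) \<le> x"
  shows "real (card S) \<le> 2 * x"
proof -
  have "S \<subseteq> (\<Union>j\<in>I3 - {i}. T j)" using bad by blast
  hence "card S \<le> card (\<Union>j\<in>I3 - {i}. T j)" using T by (intro card_mono) auto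
  also have "\<dots> \<le> (\<Sum>j\<in>I3 - {i}. card (T j))" by (intro card_UN_le) auto
  finally have "real (card S) \<le> (\<Sum>j\<in>I3 - {i}. real (card (T j)))" by (simp flip: of_nat_sum)
  also have "\<dots> \<le> (\<Sum>j\<in>I3 - {i}. x)" using T by (intro sum_mono) auto
  also have "\<dots> = 2 * x" using i by (simp add: card_Diff_singleton)
  finally show ?thesis .
qed

text \<open>Since \<open>A j\<close> has exactly \<open>h\<close> vertices, the largest possible
  number of nonneighbours, a vertex with few neighbours in \<open>A j\<close> has almost all its
  nonneighbours there and is joined to nearly everything else in \<open>V j\<close>. Markov's
  inequality bounds the number of vertices that deviate from this.\<close>

lemma sparse_triple_like_set:
  assumes A: "sparse_triple (a * w / 8) A" and w: "0 < w" and wa: "8 * w \<le> a" and ah: "8 * a \<le> real h"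
  obtains P where "like_set a w (likes A a) P"
    and "\<And>i. i \<in> I3 \<Longrightarrow> real (card (A i - likes A a)) \<le> w"
    and "\<And>i. i \<in> I3 \<Longrightarrow> real (card (likes A a \<inter> V i - A i)) \<le> w"
proof -
  define L where "L = likes A a"
  \<comment> \<open>The threshold is a quarter of the one in \<open>likes\<close>. Together with the
    loss \<open>w\<close> in passing from \<open>A\<close> to \<open>L\<close>, it stays below the
    \<open>a / 2\<close> demanded of the core.\<close>
  define P where "P = {v. \<exists>i\<in>I3. v \<in> A i \<and> (\<forall>j\<in>I3. j \<noteq> i \<longrightarrow> nb v (A j) \<le> a / 4)}"
  have a: "a > 0" using w wa by simp
  have AV: "A i \<subseteq> V i" and cA: "card (A i) = h" if "i \<in> I3" for i
    using A that unfolding sparse_triple_def by auto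
  have eA: "(\<Sum>v\<in>A i. nb v (A j)) \<le> a * w / 8" if "i \<in> I3" "j \<in> I3" "i \<noteq> j" for i j
    using A that unfolding sparse_triple_def by blast
  have finA: "finite (A i)" if "i \<in> I3" for i using AV fin that finite_subset by metis
  have nbnn: "nb v (A j) + nn v (A j) = h" if "j \<in> I3" for v j
    using nbrs_plus_nonnbrs[OF finA[OF that]] cA[OF that] by simp
  have nnsplit: "nn v (A j) + nn v (V j - A j) \<le> h" if "i \<in> I3" "j \<in> I3" "i \<noteq> j" "v \<in> V i" for v i j
  proof -
    have "V j = A j \<union> (V j - A j)" using AV[OF that(2)] by blast
    hence "nn v (V j) = nn v (A j) + nn v (V j - A j)"
      using nonnbrs_Un[of "A j" "V j - A j" E v] finA fin that by auto
    thus ?thesis using nonadj[OF that] by simp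
  qed
  have out: "nn v (V j - A j) \<le> nb v (A j)" if "i \<in> I3" "j \<in> I3" "i \<noteq> j" "v \<in> V i" for v i j
    using nnsplit[OF that] nbnn[of j v] that by linarith
  have Piff: "v \<in> P \<longleftrightarrow> (\<forall>j\<in>I3. j \<noteq> i \<longrightarrow> nb v (A j) \<le> a / 4)" if "i \<in> I3" "v \<in> A i" for i v
    unfolding P_def using that class_unique AV by blast
  have PA: "P \<inter> V i \<subseteq> A i" if "i \<in> I3" for i
    unfolding P_def using that class_unique AV by blast
  have Liff: "v \<in> L \<longleftrightarrow> (\<forall>j\<in>I3. j \<noteq> i \<longrightarrow> nb v (A j) \<le> a)" if "i \<in> I3" "v \<in> V i" for i v
    using likes_iff[OF that] by (simp add: L_def)
  have PL: "P \<subseteq> L"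
  proof
    fix v assume "v \<in> P"
    then obtain i where i: "i \<in> I3" "v \<in> A i" unfolding P_def by blast
    have "nb v (A j) \<le> a" if "j \<in> I3" "j \<noteq> i" for j
      using Piff[OF i] \<open>v \<in> P\<close> that a by fastforce
    thus "v \<in> L" using Liff[of i v] i AV by blast
  qed
  have LV: "L \<subseteq> vtx" unfolding L_def likes_def vtx_def by blast
  have cAP: "real (card (A i - P)) \<le> w" if i: "i \<in> I3" for i
  proof -
    have "real (card (A i - P)) \<le> 2 * (w / 2)"
    proof (rule card_bad_le[OF i, where T = "\<lambda>j. {v\<in>A i. nb v (A j) > a / 4}"])
      show "finite (A i - P)" using finA[OF i] by simp
      show "\<exists>j\<in>I3. j \<noteq> i \<and> v \<in> {v \<in> A i. a / 4 < nb v (A j)}" if "v \<in> A i - P" for v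
        using that Piff[OF i, of v] by fastforce
      fix j assume j: "j \<in> I3" "j \<noteq> i"
      have "real (card {v\<in>A i. nb v (A j) > a / 4}) * (a / 4) \<le> a * w / 8"
        by (rule order_trans[OF card_exceeding_le eA[OF i j(1) j(2)[symmetric]]]) (use finA[OF i] in auto)
      hence "real (card {v\<in>A i. nb v (A j) > a / 4}) \<le> w / 2" using a by (simp add: field_simps)
      thus "finite {v \<in> A i. a / 4 < nb v (A j)} \<and> real (card {v \<in> A i. a / 4 < nb v (A j)}) \<le> w / 2"
        using finA[OF i] by simp
    qed
    thus ?thesis by simp
  qed
  have cAL: "real (card (A i - L)) \<le> w" if i: "i \<in> I3" for i
  proof -
    have "card (A i - L) \<le> card (A i - P)" using PL finA[OF i] by (intro card_mono) auto
    thus ?thesis using cAP[OF i] by linarith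
  qed
  \<comment> \<open>Nonadjacent pairs are counted from \<open>A j\<close>: by \<open>out\<close>, a
    vertex there misses at most as many vertices outside \<open>A i\<close> as it has neighbours
    inside, and the latter are few in total.\<close>
  have outsum: "(\<Sum>v\<in>V i - A i. nn v (A j)) \<le> a * w / 8" if ij: "i \<in> I3" "j \<in> I3" "i \<noteq> j" for i j
  proof -
    have "(\<Sum>v\<in>V i - A i. nn v (A j)) = (\<Sum>u\<in>A j. nn u (V i - A i))"
      using sum_nonnbrs_swap[of "V i - A i" "A j" E] fin finA ij sym_iff by auto
    also have "\<dots> \<le> (\<Sum>u\<in>A j. nb u (A i))"
      using out[of j i] AV ij by (intro sum_mono) blast
    also have "\<dots> \<le> a * w / 8" using eA[of j i] ij by blast
    finally show ?thesis .
  qed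
  have cOut: "real (card {v\<in>V i - A i. nn v (A j) > a}) \<le> w / 8" if ij: "i \<in> I3" "j \<in> I3" "i \<noteq> j" for i j
  proof -
    have "real (card {v\<in>V i - A i. nn v (A j) > a}) * a \<le> a * w / 8"
      by (rule order_trans[OF card_exceeding_le outsum[OF ij]]) (use fin ij in auto)
    thus ?thesis using a by (simp add: field_simps)
  qed
  have cLA: "real (card (L \<inter> V i - A i)) \<le> w / 8" if i: "i \<in> I3" for i
  proof -
    obtain j where j: "j \<in> I3" "i \<noteq> j" using I3_other[of i] by auto
    \<comment> \<open>A vertex of \<open>L\<close> has at most \<open>a\<close> neighbours in
      \<open>A j\<close>, hence at least \<open>h - a\<close> nonneighbours, and this exceeds
      \<open>a\<close>.\<close>
    have "L \<inter> V i - A i \<subseteq> {v\<in>V i - A i. nn v (A j) > a}"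
    proof
      fix v assume v: "v \<in> L \<inter> V i - A i"
      hence "nb v (A j) \<le> a" using Liff[OF i, of v] j by auto
      thus "v \<in> {v\<in>V i - A i. nn v (A j) > a}" using v nbnn[of j v] j ah a by auto
    qed
    hence "card (L \<inter> V i - A i) \<le> card {v\<in>V i - A i. nn v (A j) > a}"
      using fin[OF i] by (intro card_mono) auto
    thus ?thesis using cOut[OF i j] by linarith
  qed
  have VL: "nn v (V j - L) \<le> nn v (V j - A j) + w" if "j \<in> I3" for v j
  proof -
    have "nn v (V j - L) \<le> nn v (V j - A j) + real (card ((V j - L) - (V j - A j)))"
      using that by (intro nonnbrs_le_plus_card) auto
    moreover have "card ((V j - L) - (V j - A j)) \<le> card (A j - L)"
      using finA[OF that] by (intro card_mono) auto
    ultimately show ?thesis using cAL[OF that] by linarith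
  qed
  have LA: "nn v (L \<inter> V j) \<le> nn v (A j) + w / 8" "nb v (L \<inter> V j) \<le> nb v (A j) + w / 8" if "j \<in> I3" for v j
    using nonnbrs_le_plus_card[of "L \<inter> V j" "A j" E v] nbrs_le_plus_card[of "L \<inter> V j" "A j" E v]
      cLA[OF that] fin_Int[OF that] finA[OF that] by auto
  have "like_set a w L P" unfolding like_set_def
  proof (intro conjI ballI impI)
    fix i assume i: "i \<in> I3"
    show "real h - w \<le> real (card (L \<inter> V i))"
    proof -
      have "A i - L \<inter> V i = A i - L" using AV[OF i] by blast
      thus ?thesis using card_le_plus_Diff[of "A i" "L \<inter> V i"] cAL[OF i] cA[OF i] finA[OF i] i by simp
    qed
    show "real (card (L \<inter> V i)) \<le> real h + w"
      using card_le_plus_Diff[of "L \<inter> V i" "A i"] cLA[OF i] cA[OF i] finA[OF i] i w by simp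
    show "real (card (L \<inter> V i - P)) \<le> 2 * w"
    proof -
      have "card (L \<inter> V i - P) \<le> card ((L \<inter> V i - A i) \<union> (A i - P))"
        using i finA[OF i] by (intro card_mono) auto
      also have "\<dots> \<le> card (L \<inter> V i - A i) + card (A i - P)" by (rule card_Un_le)
      finally show ?thesis using cLA[OF i] cAP[OF i] w by linarith
    qed
    show "real (card {v\<in>V i - L. \<exists>j\<in>I3. j \<noteq> i \<and> nn v (L \<inter> V j) > 2 * a}) \<le> 2 * w"
    proof -
      let ?S = "{v\<in>V i - L. \<exists>j\<in>I3. j \<noteq> i \<and> nn v (L \<inter> V j) > 2 * a}"
      have "real (card (?S - A i)) \<le> 2 * (w / 8)"
      proof (rule card_bad_le[OF i, where T = "\<lambda>j. {v\<in>V i - A i. nn v (A j) > a}"])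
        show "finite (?S - A i)" using fin[OF i] by simp
        show "\<exists>j\<in>I3. j \<noteq> i \<and> v \<in> {v \<in> V i - A i. a < nn v (A j)}" if "v \<in> ?S - A i" for v
        proof -
          from that obtain j where j: "j \<in> I3" "j \<noteq> i" "nn v (L \<inter> V j) > 2 * a" by blast
          hence "nn v (A j) > a" using LA(1)[OF j(1), of v] w wa by linarith
          thus ?thesis using j that by blast
        qed
        fix j assume j: "j \<in> I3" "j \<noteq> i"
        show "finite {v \<in> V i - A i. a < nn v (A j)} \<and> real (card {v \<in> V i - A i. a < nn v (A j)}) \<le> w / 8"
          using cOut[OF i j(1)] j fin[OF i] by auto
      qed
      moreover have "card ?S \<le> card ((?S - A i) \<union> (A i - L))"
        using fin[OF i] finA[OF i] by (intro card_mono) auto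
      moreover have "\<dots> \<le> card (?S - A i) + card (A i - L)" by (rule card_Un_le)
      ultimately show ?thesis using cAL[OF i] w by linarith
    qed
    fix v assume v: "v \<in> V i - L"
    then obtain j where j: "j \<in> I3" "j \<noteq> i" "nb v (A j) > a" using Liff[OF i] by fastforce
    have "A j - (P \<inter> V j) = A j - P" using AV[OF j(1)] by blast
    hence "nb v (A j) \<le> nb v (P \<inter> V j) + w"
      using nbrs_le_plus_card[of "A j" "P \<inter> V j" E v] cAP[OF j(1)] finA[OF j(1)] j(1) by simp
    thus "\<exists>j\<in>I3. j \<noteq> i \<and> a - w \<le> nb v (P \<inter> V j)" using j by (intro bexI[of _ j]) auto
  next
    fix i j v assume ij: "i \<in> I3" "j \<in> I3" "i \<noteq> j" and v: "v \<in> L \<inter> V i"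
    have nba: "nb v (A j) \<le> a" using Liff[OF ij(1), of v] v ij by auto
    show "nn v (V j - L) \<le> 2 * a"
      using VL[OF ij(2), of v] out[OF ij, of v] nba v w wa by auto
    show "nb v (L \<inter> V j) \<le> 2 * a"
      using LA(2)[OF ij(2), of v] nba w wa by auto
  next
    fix i j v assume ij: "i \<in> I3" "j \<in> I3" "i \<noteq> j" and v: "v \<in> P \<inter> V i"
    have nba: "nb v (A j) \<le> a / 4" using Piff[OF ij(1), of v] PA[OF ij(1)] v ij by auto
    show "nn v (V j - L) \<le> a / 2"
      using VL[OF ij(2), of v] out[OF ij, of v] nba v w wa by auto
  qed (use LV PL in auto)
  moreover have "real (card (L \<inter> V i - A i)) \<le> w" if "i \<in> I3" for i using cLA[OF that] w by linarith
  ultimately show ?thesis using that[of P] cAL unfolding L_def by blast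
qed

end

section \<open>Triangle packings from perfect matchings\<close>

context tripartite
begin

text \<open>The vertex set \<open>X\<close> is a parameter so that packings of disjoint sets can be
  combined.\<close>

definition triangle_packing :: "'a set \<Rightarrow> nat \<Rightarrow> bool" where
  "triangle_packing X n \<longleftrightarrow>
     (\<exists>\<T>. finite \<T> \<and> card \<T> = n \<and> (\<forall>T\<in>\<T>. is_triangle E T) \<and> disjoint \<T> \<and> \<Union>\<T> \<subseteq> X)"

lemma triangleI: "E u v \<Longrightarrow> E v w \<Longrightarrow> E u w \<Longrightarrow> is_triangle E {u, v, w}"
  unfolding is_triangle_def using irrefl by metis

lemma triangle_props:
  assumes "is_triangle E T"
  shows "finite T" "card T = 3" "T \<subseteq> vtx" "T \<noteq> {}" "i \<in> I3 \<Longrightarrow> card (T \<inter> V i) = 1"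
proof -
  obtain u v w where T: "T = {u, v, w}" and d: "u \<noteq> v" "v \<noteq> w" "u \<noteq> w" and e: "E u v" "E v w" "E u w"
    using assms unfolding is_triangle_def by blast
  show "finite T" "card T = 3" "T \<noteq> {}" using T d by auto
  obtain a b where ab: "a \<in> I3" "b \<in> I3" "a \<noteq> b" "u \<in> V a" "v \<in> V b" using cross[OF e(1)] by blast
  obtain c where c: "c \<in> I3" "w \<in> V c" using cross[OF e(2)] by blast
  have ca: "c \<noteq> a" using not_adj_same[OF c(1), of u w] ab c e by auto
  have cb: "c \<noteq> b" using not_adj_same[OF c(1), of v w] ab c e by auto
  show "T \<subseteq> vtx" using T ab c unfolding vtx_def by blast
  assume i: "i \<in> I3"
  obtain k where "I3 = {a, b, k}" "k \<noteq> a" "k \<noteq> b" by (rule I3_third[OF ab(1,2,3)])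
  hence I: "I3 = {a, b, c}" using c ca cb by auto
  have "T \<inter> V i = {u} \<or> T \<inter> V i = {v} \<or> T \<inter> V i = {w}"
  proof -
    have n: "u \<notin> V b" "u \<notin> V c" "v \<notin> V a" "v \<notin> V c" "w \<notin> V a" "w \<notin> V b"
      using class_unique ab c ca cb by metis+
    consider "i = a" | "i = b" | "i = c" using i I by blast
    then show ?thesis by cases (use T ab c n in auto)
  qed
  thus "card (T \<inter> V i) = 1" by auto
qed

lemma triangle_packing_Un:
  assumes "triangle_packing X n" "triangle_packing Y m" "X \<inter> Y = {}"
  shows "triangle_packing (X \<union> Y) (n + m)"
proof -
  obtain S where S: "finite S" "card S = n" "\<forall>T\<in>S. is_triangle E T" "disjoint S" "\<Union>S \<subseteq> X"
    using assms(1) unfolding triangle_packing_def by blast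
  obtain R where R: "finite R" "card R = m" "\<forall>T\<in>R. is_triangle E T" "disjoint R" "\<Union>R \<subseteq> Y"
    using assms(2) unfolding triangle_packing_def by blast
  have dis: "T \<inter> T' = {}" if "T \<in> S" "T' \<in> R" for T T' using that S R assms(3) by blast
  have "S \<inter> R = {}" using dis triangle_props(4) S(3) by fastforce
  hence "card (S \<union> R) = n + m" using S R by (simp add: card_Un_disjoint)
  moreover have "disjoint (S \<union> R)" using S(4) R(4) dis unfolding disjoint_def by (metis Int_commute UnE)
  moreover have "\<Union>(S \<union> R) \<subseteq> X \<union> Y" using S(5) R(5) by blast
  ultimately show ?thesis unfolding triangle_packing_def using S R by (intro exI[of _ "S \<union> R"]) auto
qed

lemma triangle_packing_family:
  assumes "finite J" "disjoint_family_on F J" "\<And>t. t \<in> J \<Longrightarrow> is_triangle E (F t)" "\<And>t. t \<in> J \<Longrightarrow> F t \<subseteq> X"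
  shows "triangle_packing X (card J)"
proof -
  have "inj_on F J"
  proof (rule inj_onI, rule ccontr)
    fix s t assume st: "s \<in> J" "t \<in> J" "F s = F t" "s \<noteq> t"
    hence "F s \<inter> F t = {}" using assms(2) unfolding disjoint_family_on_def by blast
    thus False using st triangle_props(4)[OF assms(3)[OF st(1)]] by simp
  qed
  moreover have "disjoint (F ` J)"
    using assms(2) unfolding disjoint_def disjoint_family_on_def by (intro ballI impI; elim imageE; hypsubst) metis
  ultimately show ?thesis unfolding triangle_packing_def
    using assms by (intro exI[of _ "F ` J"]) (auto simp: card_image)
qed

definition acomp :: "real \<Rightarrow> 'a set \<Rightarrow> 'a set \<Rightarrow> bool" where
  "acomp e P Q \<longleftrightarrow> (\<forall>i\<in>I3. \<forall>j\<in>I3. i \<noteq> j \<longrightarrow>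
     (\<forall>v\<in>P \<inter> V i. nn v (Q \<inter> V j) \<le> e) \<and> (\<forall>v\<in>Q \<inter> V i. nn v (P \<inter> V j) \<le> e))"

lemma acomp_sym: "acomp e P Q \<longleftrightarrow> acomp e Q P" unfolding acomp_def by blast

lemma acompD: "acomp e P Q \<Longrightarrow> i \<in> I3 \<Longrightarrow> j \<in> I3 \<Longrightarrow> i \<noteq> j \<Longrightarrow> v \<in> P \<Longrightarrow> v \<in> V i \<Longrightarrow> nn v (Q \<inter> V j) \<le> e"
  unfolding acomp_def by blast

lemma acomp_mono:
  assumes "acomp e P Q" "P' \<subseteq> P" "Q' \<subseteq> Q"
  shows "acomp e P' Q'"
proof -
  have "nn v (Q' \<inter> V j) \<le> e" if "i \<in> I3" "j \<in> I3" "i \<noteq> j" "v \<in> P' \<inter> V i" for i j v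
    by (rule order_trans[OF nonnbrs_mono acompD[OF assms(1) that(1,2,3), of v]]) (use that assms in auto)
  moreover have "nn v (P' \<inter> V j) \<le> e" if "i \<in> I3" "j \<in> I3" "i \<noteq> j" "v \<in> Q' \<inter> V i" for i j v
    by (rule order_trans[OF nonnbrs_mono acompD[OF assms(1)[unfolded acomp_sym[of e P]] that(1,2,3), of v]])
      (use that assms in auto)
  ultimately show ?thesis unfolding acomp_def by blast
qed

lemma vtx_eq: "I3 = {i, j, k} \<Longrightarrow> vtx = V i \<union> V j \<union> V k"
  unfolding vtx_def by (erule ssubst) auto

lemma card_vtx_split:
  assumes "I3 = {i, j, k}" "i \<noteq> j" "k \<noteq> i" "k \<noteq> j" "S \<subseteq> vtx"
  shows "card S = card (S \<inter> V i) + card (S \<inter> V j) + card (S \<inter> V k)"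
proof -
  have I: "i \<in> I3" "j \<in> I3" "k \<in> I3" using assms by auto
  have d: "V i \<inter> V j = {}" "V i \<inter> V k = {}" "V j \<inter> V k = {}"
    using disj[OF I(1,2)] disj[OF I(1,3)] disj[OF I(2,3)] assms(2-4) by auto
  have "S = (S \<inter> V i \<union> S \<inter> V j) \<union> S \<inter> V k"
    using assms(5) vtx_eq[OF assms(1)] by blast
  also have "card \<dots> = card (S \<inter> V i \<union> S \<inter> V j) + card (S \<inter> V k)"
    by (rule card_Un_disjoint) (use I in simp, use I in simp, use d in blast)
  also have "card (S \<inter> V i \<union> S \<inter> V j) = card (S \<inter> V i) + card (S \<inter> V j)"
    by (rule card_Un_disjoint) (use I in simp, use I in simp, use d in blast)
  finally show ?thesis .
qed

text \<open>Every perfect matching of \<open>B\<close> has exactly as many edges between two of the classes as \<open>A\<close> has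
  vertices in the third one, so that the edges only have to be matched with the vertices of \<open>A\<close>.\<close>

lemma packing_of_perfect_matching:
  assumes AB: "A \<subseteq> vtx" "B \<subseteq> vtx" "A \<inter> B = {}"
    and n: "\<And>i. i \<in> I3 \<Longrightarrow> card ((A \<union> B) \<inter> V i) = n" and cA: "card A = n"
    and ac: "acomp e A B" and e: "\<And>i. i \<in> I3 \<Longrightarrow> 4 * e \<le> real (card (A \<inter> V i))"
    and pm: "perfect_matching B E"
  shows "triangle_packing (A \<union> B) n"
proof -
  obtain f where f: "\<And>v. v \<in> B \<Longrightarrow> f v \<in> B \<and> f (f v) = v \<and> E v (f v)"
    using pm unfolding perfect_matching_def by blast
  define m where "m i j = card {v\<in>B \<inter> V i. f v \<in> V j}" for i j
  have finB: "finite B" and finA: "finite A" using AB fin_vtx finite_subset by blast+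
  have mm: "m i j = m j i" for i j
  proof -
    have "bij_betw f {v\<in>B \<inter> V i. f v \<in> V j} {v\<in>B \<inter> V j. f v \<in> V i}"
      by (rule bij_betwI[of _ _ _ f]) (use f in auto)
    thus ?thesis unfolding m_def by (rule bij_betw_same_card)
  qed
  have split: "card (B \<inter> V i) = m i j + m i k" if I: "I3 = {i, j, k}" "i \<noteq> j" "k \<noteq> i" "k \<noteq> j" for i j k
  proof -
    have ijk: "i \<in> I3" "j \<in> I3" "k \<in> I3" using I by auto
    have "B \<inter> V i = {v\<in>B \<inter> V i. f v \<in> V j} \<union> {v\<in>B \<inter> V i. f v \<in> V k}"
    proof -
      have "f v \<in> V j \<or> f v \<in> V k" if "v \<in> B" "v \<in> V i" for v
      proof -
        have "f v \<in> vtx" using f[OF that(1)] AB by blast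
        moreover have "f v \<notin> V i" using not_adj_same[OF ijk(1) that(2)] f[OF that(1)] by blast
        ultimately show ?thesis using vtx_eq[OF I(1)] by blast
      qed
      thus ?thesis by blast
    qed
    also have "card \<dots> = m i j + m i k" unfolding m_def
      using disj[OF ijk(2,3)] I finB by (intro card_Un_disjoint) auto
    finally show ?thesis .
  qed
  have cAB: "card (A \<inter> V i) + card (B \<inter> V i) = n" if "i \<in> I3" for i
  proof -
    have "(A \<union> B) \<inter> V i = A \<inter> V i \<union> B \<inter> V i" by blast
    thus ?thesis using n[OF that] AB(3) finA finB by (subst card_Un_disjoint[symmetric]) auto
  qed
  have key: "\<exists>g. inj_on g (A \<inter> V k) \<and> (\<exists>i\<in>I3. \<forall>a\<in>A \<inter> V k. g a \<in> B \<inter> V i \<and> E a (g a) \<and> E a (f (g a)))"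
    if k: "k \<in> I3" for k
  proof -
    obtain i j where ij: "i \<in> I3" "j \<in> I3" "i \<noteq> k" "j \<noteq> k" "i \<noteq> j" "I3 = {k, i, j}"
      by (rule I3_others[OF k])
    \<comment> \<open>Doubling \<open>m i j\<close> gives the size of \<open>B\<close> in classes
      \<open>i\<close> and \<open>j\<close> minus its size in class \<open>k\<close>. As
      \<open>A\<close> and \<open>B\<close> together have \<open>n\<close> vertices in each class
      and \<open>A\<close> has \<open>n\<close> in total, this is twice the size of
      \<open>A \<inter> V k\<close>.\<close>
    have mA: "m i j = card (A \<inter> V k)"
    proof -
      have "card (B \<inter> V k) = m k i + m k j" "card (B \<inter> V i) = m i j + m i k" "card (B \<inter> V j) = m j i + m j k"
        using split[of k i j] split[of i j k] split[of j i k] ij by (auto simp: insert_commute)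
      moreover have "card A = card (A \<inter> V k) + card (A \<inter> V i) + card (A \<inter> V j)"
        using card_vtx_split[of k i j A] ij AB by auto
      ultimately show ?thesis using mm[of k i] mm[of k j] mm[of j i] cAB[OF k] cAB[OF ij(1)] cAB[OF ij(2)] cA by linarith
    qed
    \<comment> \<open>An edge between classes \<open>i\<close> and \<open>j\<close> is represented
      by its end in \<open>V i\<close>. A vertex of \<open>A \<inter> V k\<close> fits all but
      \<open>2 * e\<close> of these edges and conversely, so half-degree matching applies.\<close>
    define Y where "Y = {v\<in>B \<inter> V i. f v \<in> V j}"
    have finY: "finite Y" using finB by (simp add: Y_def)
    have eqc: "card (A \<inter> V k) = card Y" using mA by (simp add: m_def Y_def)
    have injf: "inj_on f Y" by (rule inj_on_inverseI[of _ f]) (use f in \<open>auto simp: Y_def\<close>)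
    have "\<exists>g. bij_betw g (A \<inter> V k) Y \<and> (\<forall>x\<in>A \<inter> V k. E x (g x) \<and> E x (f (g x)))"
    proof (rule bipartite_perfect_matching)
      show "finite (A \<inter> V k)" "finite Y" using finA finY by auto
      show "card (A \<inter> V k) = card Y" by fact
      show "card Y \<le> 2 * card {y\<in>Y. E x y \<and> E x (f y)}" if x: "x \<in> A \<inter> V k" for x
      proof -
        have "card {y\<in>Y. \<not> E x (f y)} = card (f ` {y\<in>Y. \<not> E x (f y)})"
          using injf by (intro card_image[symmetric]) (auto intro: inj_on_subset)
        also have "\<dots> \<le> card {u\<in>B \<inter> V j. \<not> E x u}"
          using f finB by (intro card_mono) (auto simp: Y_def)
        finally have 1: "real (card {y\<in>Y. \<not> E x (f y)}) \<le> e"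
          using acompD[OF ac k ij(2) ij(4)[symmetric], of x] x by (auto simp: nonnbrs_def)
        have "card {y\<in>Y. \<not> E x y} \<le> card {u\<in>B \<inter> V i. \<not> E x u}"
          using finB by (intro card_mono) (auto simp: Y_def)
        hence 2: "real (card {y\<in>Y. \<not> E x y}) \<le> e"
          using acompD[OF ac k ij(1) ij(3)[symmetric], of x] x by (auto simp: nonnbrs_def)
        have "Y \<subseteq> {y\<in>Y. E x y \<and> E x (f y)} \<union> ({y\<in>Y. \<not> E x y} \<union> {y\<in>Y. \<not> E x (f y)})" by blast
        hence "card Y \<le> card ({y\<in>Y. E x y \<and> E x (f y)} \<union> ({y\<in>Y. \<not> E x y} \<union> {y\<in>Y. \<not> E x (f y)}))"
          using finY by (intro card_mono) auto
        also have "\<dots> \<le> card {y\<in>Y. E x y \<and> E x (f y)} + (card {y\<in>Y. \<not> E x y} + card {y\<in>Y. \<not> E x (f y)})"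
          by (meson card_Un_le add_left_mono order_trans)
        finally have "real (card Y) \<le> real (card {y\<in>Y. E x y \<and> E x (f y)}) + 2 * e" using 1 2 by linarith
        moreover have "4 * e \<le> real (card Y)" using e[OF k] eqc by simp
        ultimately show ?thesis by linarith
      qed
      show "card (A \<inter> V k) \<le> 2 * card {x\<in>A \<inter> V k. E x y \<and> E x (f y)}" if y: "y \<in> Y" for y
      proof -
        let ?X = "A \<inter> V k"
        have yB: "y \<in> B" "y \<in> V i" "f y \<in> B" "f y \<in> V j" using y f by (auto simp: Y_def)
        have 1: "real (card {x\<in>?X. \<not> E x y}) \<le> e"
          using acompD[OF ac[unfolded acomp_sym[of e A]] ij(1) k ij(3) yB(1,2)] sym_iff[of y]
          by (simp add: nonnbrs_def)
        have 2: "real (card {x\<in>?X. \<not> E x (f y)}) \<le> e"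
          using acompD[OF ac[unfolded acomp_sym[of e A]] ij(2) k ij(4) yB(3,4)] sym_iff[of "f y"]
          by (simp add: nonnbrs_def)
        have "?X \<subseteq> {x\<in>?X. E x y \<and> E x (f y)} \<union> ({x\<in>?X. \<not> E x y} \<union> {x\<in>?X. \<not> E x (f y)})" by blast
        hence "card ?X \<le> card ({x\<in>?X. E x y \<and> E x (f y)} \<union> ({x\<in>?X. \<not> E x y} \<union> {x\<in>?X. \<not> E x (f y)}))"
          using finA by (intro card_mono) auto
        also have "\<dots> \<le> card {x\<in>?X. E x y \<and> E x (f y)} + (card {x\<in>?X. \<not> E x y} + card {x\<in>?X. \<not> E x (f y)})"
          by (meson card_Un_le add_left_mono order_trans)
        finally have "real (card ?X) \<le> real (card {x\<in>?X. E x y \<and> E x (f y)}) + 2 * e" using 1 2 by linarith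
        thus ?thesis using e[OF k] by linarith
      qed
    qed
    then obtain g where "bij_betw g (A \<inter> V k) Y" "\<forall>x\<in>A \<inter> V k. E x (g x) \<and> E x (f (g x))" by blast
    hence "inj_on g (A \<inter> V k)" "\<forall>a\<in>A \<inter> V k. g a \<in> B \<inter> V i \<and> E a (g a) \<and> E a (f (g a))"
      by (auto simp: bij_betw_def Y_def)
    thus ?thesis using ij(1) by blast
  qed
  then obtain G where G: "\<And>k. k \<in> I3 \<Longrightarrow> inj_on (G k) (A \<inter> V k)"
    and G': "\<And>k. k \<in> I3 \<Longrightarrow> \<exists>i\<in>I3. \<forall>a\<in>A \<inter> V k. G k a \<in> B \<inter> V i \<and> E a (G k a) \<and> E a (f (G k a))"
    by metis
  have "\<forall>a\<in>A. \<exists>k\<in>I3. a \<in> V k" using AB unfolding vtx_def by blast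
  then obtain c where c: "\<And>a. a \<in> A \<Longrightarrow> c a \<in> I3" "\<And>a. a \<in> A \<Longrightarrow> a \<in> V (c a)" by metis
  define g where "g a = G (c a) a" for a
  have g: "g a \<in> B" "E a (g a)" "E a (f (g a))" if aA: "a \<in> A" for a
  proof -
    obtain i where "\<forall>b\<in>A \<inter> V (c a). G (c a) b \<in> B \<inter> V i \<and> E b (G (c a) b) \<and> E b (f (G (c a) b))"
      using G'[OF c(1)[OF aA]] by metis
    from bspec[OF this, of a] show "g a \<in> B" "E a (g a)" "E a (f (g a))"
      using c(2)[OF that] that unfolding g_def by auto
  qed
  have fg: "f (g a) \<in> B" "f (f (g a)) = g a" "E (g a) (f (g a))" if "a \<in> A" for a
    using f[OF g(1)[OF that]] by simp_all
  have dis: "{g a, f (g a)} \<inter> {g a', f (g a')} = {}" if a: "a \<in> A" "a' \<in> A" "a \<noteq> a'" for a a'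
  proof (rule ccontr)
    assume "{g a, f (g a)} \<inter> {g a', f (g a')} \<noteq> {}"
    then consider "g a = g a'" | "g a = f (g a')" | "f (g a) = g a'" | "f (g a) = f (g a')" by blast
    hence eq: "g a = g a' \<or> g a = f (g a')"
      by cases (use fg(2)[OF a(1)] fg(2)[OF a(2)] in \<open>simp, simp, metis, metis\<close>)
    show False
    proof (cases "c a = c a'")
      case True
      obtain i where i: "i \<in> I3" "\<forall>a\<in>A \<inter> V (c a'). G (c a') a \<in> B \<inter> V i" using G'[OF c(1)[OF a(2)]] by blast
      have "g a \<in> V i" "g a' \<in> V i" using i True c[OF a(1)] c[OF a(2)] a by (auto simp: g_def)
      hence "g a \<noteq> f (g a')" using not_adj_same[OF i(1), of "g a'"] fg(3)[OF a(2)] by metis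
      hence "g a = g a'" using eq by blast
      thus False using G[OF c(1)[OF a(2)]] True c[OF a(1)] c[OF a(2)] a unfolding g_def inj_on_def by auto
    next
      case False
      \<comment> \<open>Since the two pairs meet, they are the same matching edge. Both its ends are
        then adjacent to \<open>a\<close> and to \<open>a'\<close>, which lie in different classes,
        so both ends lie in the third class, which contains no edge.\<close>
      have adj: "E a (g a)" "E a (f (g a))" "E a' (g a)" "E a' (f (g a))" "E (g a) (f (g a))"
        using g[OF a(1)] g[OF a(2)] fg[OF a(1)] fg[OF a(2)] eq by auto
      obtain k where k: "k \<in> I3" "I3 = {c a, c a', k}"
        using I3_third[OF c(1)[OF a(1)] c(1)[OF a(2)] False] by metis
      have "x \<in> V k" if "E a x" "E a' x" for x
      proof -
        have "x \<in> vtx" using cross[OF that(1)] unfolding vtx_def by blast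
        moreover have "x \<notin> V (c a)" "x \<notin> V (c a')"
          using not_adj_same[OF c(1)[OF a(1)] c(2)[OF a(1)]] not_adj_same[OF c(1)[OF a(2)] c(2)[OF a(2)]] that by blast+
        ultimately show ?thesis using vtx_eq[OF k(2)] by blast
      qed
      thus False using not_adj_same[OF k(1)] adj by blast
    qed
  qed
  have "triangle_packing (A \<union> B) (card A)"
  proof (rule triangle_packing_family[OF finA, of "\<lambda>a. {a, g a, f (g a)}"])
    show "disjoint_family_on (\<lambda>a. {a, g a, f (g a)}) A"
      unfolding disjoint_family_on_def
    proof (intro ballI impI)
      fix a a' assume a: "a \<in> A" "a' \<in> A" "a \<noteq> a'"
      thus "{a, g a, f (g a)} \<inter> {a', g a', f (g a')} = {}"
        using dis[OF a] g(1)[OF a(1)] g(1)[OF a(2)] fg(1)[OF a(1)] fg(1)[OF a(2)] AB(3) by auto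
    qed
    show "is_triangle E {a, g a, f (g a)}" if "a \<in> A" for a
      using triangleI g[OF that] fg[OF that] by blast
    show "{a, g a, f (g a)} \<subseteq> A \<union> B" if "a \<in> A" for a using g(1) fg(1) that by blast
  qed
  thus ?thesis using cA by simp
qed

text \<open>Half-degree matching between \<open>I\<close> and \<open>S\<close>. A vertex loses all
  vertices of its own class and at most \<open>e\<close> in each of the other two; the size
  conditions keep this loss below one half.\<close>

lemma perfect_matching_acomp:
  assumes IS: "I \<subseteq> vtx" "S \<subseteq> vtx" "I \<inter> S = {}" "card I = card S" and ac: "acomp e I S"
    and sz: "\<And>i. i \<in> I3 \<Longrightarrow> 2 * real (card (S \<inter> V i)) + 4 * e \<le> real (card S)"
      "\<And>i. i \<in> I3 \<Longrightarrow> 2 * real (card (I \<inter> V i)) + 4 * e \<le> real (card I)"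
  shows "perfect_matching (I \<union> S) E"
proof -
  have finI: "finite I" and finS: "finite S" using IS fin_vtx finite_subset by blast+
  have deg: "card Q \<le> 2 * card {y\<in>Q. E x y}"
    if PQ: "acomp e P Q" "Q \<subseteq> vtx" "finite Q" "x \<in> P" "P \<subseteq> vtx" "\<And>i. i \<in> I3 \<Longrightarrow> 2 * real (card (Q \<inter> V i)) + 4 * e \<le> real (card Q)"
    for P Q x
  proof -
    obtain i where i: "i \<in> I3" "x \<in> V i" using PQ(4,5) unfolding vtx_def by blast
    obtain j k where jk: "j \<in> I3" "k \<in> I3" "j \<noteq> i" "k \<noteq> i" "j \<noteq> k" "I3 = {i, j, k}"
      by (rule I3_others[OF i(1)])
    have "{y\<in>Q. \<not> E x y} = {y\<in>Q. \<not> E x y} \<inter> V i \<union> ({y\<in>Q \<inter> V j. \<not> E x y} \<union> {y\<in>Q \<inter> V k. \<not> E x y})"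
      using PQ(2) vtx_eq[OF jk(6)] by blast
    hence "card {y\<in>Q. \<not> E x y} \<le> card (Q \<inter> V i \<union> ({y\<in>Q \<inter> V j. \<not> E x y} \<union> {y\<in>Q \<inter> V k. \<not> E x y}))"
      using PQ(3) by (intro card_mono) auto
    also have "\<dots> \<le> card (Q \<inter> V i) + (card {y\<in>Q \<inter> V j. \<not> E x y} + card {y\<in>Q \<inter> V k. \<not> E x y})"
      by (meson card_Un_le add_left_mono order_trans)
    finally have "nn x Q \<le> real (card (Q \<inter> V i)) + (nn x (Q \<inter> V j) + nn x (Q \<inter> V k))"
      unfolding nonnbrs_def by linarith
    also have "\<dots> \<le> real (card (Q \<inter> V i)) + 2 * e"
      using acompD[OF PQ(1) i(1) jk(1) jk(3)[symmetric] PQ(4) i(2)]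
        acompD[OF PQ(1) i(1) jk(2) jk(4)[symmetric] PQ(4) i(2)] by linarith
    finally have "2 * nn x Q \<le> real (card Q)" using PQ(6)[OF i(1)] by linarith
    hence "real (card Q) \<le> 2 * nb x Q" using nbrs_plus_nonnbrs[OF PQ(3), of E x] by linarith
    thus ?thesis unfolding nbrs_def by linarith
  qed
  have "\<exists>g. bij_betw g I S \<and> (\<forall>x\<in>I. E x (g x))"
  proof (rule bipartite_perfect_matching[OF finI finS IS(4)])
    show "card S \<le> 2 * card {y\<in>S. E x y}" if "x \<in> I" for x
      using deg[OF ac IS(2) finS that IS(1) sz(1)] by blast
    show "card I \<le> 2 * card {x\<in>I. E x y}" if "y \<in> S" for y
      using deg[OF ac[unfolded acomp_sym[of e I]] IS(1) finI that IS(2) sz(2)] sym_iff[of y] by simp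
  qed
  then obtain g where g: "bij_betw g I S" "\<And>x. x \<in> I \<Longrightarrow> E x (g x)" by blast
  define f where "f v = (if v \<in> I then g v else inv_into I g v)" for v
  have "f v \<in> I \<union> S \<and> f (f v) = v \<and> E v (f v)" if "v \<in> I \<union> S" for v
  proof (cases "v \<in> I")
    case True
    have "g v \<in> S" using g(1) True by (auto simp: bij_betw_def)
    hence "g v \<notin> I" using IS(3) by blast
    moreover have "inv_into I g (g v) = v" using g(1) True by (simp add: bij_betw_def)
    ultimately show ?thesis using True \<open>g v \<in> S\<close> g(2) by (simp add: f_def)
  next
    case False
    hence v: "v \<in> S" using that by blast
    let ?u = "inv_into I g v"
    have u: "?u \<in> I" "g ?u = v"
      using g(1) v by (auto simp: bij_betw_def inv_into_into f_inv_into_f)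
    hence "E ?u v" using g(2)[OF u(1)] by simp
    thus ?thesis using False u sym by (simp add: f_def)
  qed
  thus ?thesis unfolding perfect_matching_def by blast
qed

end

section \<open>Disjoint edges and three types of vertices\<close>

text \<open>Serves to hand leftover vertices or surplus edges over to types that are too small, the
  capacity \<open>n t\<close> being the deficit of type \<open>t\<close>.\<close>

lemma prescribed_fibres:
  assumes "finite I" "finite S" "card S \<le> (\<Sum>t\<in>I. n t)"
  shows "\<exists>f. (\<forall>s\<in>S. f s \<in> I) \<and> (\<forall>t\<in>I. card {s\<in>S. f s = t} \<le> n t)"
  using assms
proof (induction I arbitrary: S rule: finite_induct)
  case empty
  then show ?case by simp
next
  case (insert t I)
  obtain R where R: "R \<subseteq> S" "card R = min (n t) (card S)"
    using obtain_subset_with_card_n[of "min (n t) (card S)" S] by auto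
  have "card (S - R) \<le> (\<Sum>t\<in>I. n t)"
    using insert.prems insert.hyps R card_Diff_subset[of R S] finite_subset by fastforce
  then obtain f where f: "\<forall>s\<in>S - R. f s \<in> I" "\<forall>t\<in>I. card {s\<in>S - R. f s = t} \<le> n t"
    using insert.IH[of "S - R"] insert.prems(1) by blast
  let ?g = "\<lambda>s. if s \<in> R then t else f s"
  have "card {s\<in>S. ?g s = t'} \<le> n t'" if "t' \<in> insert t I" for t'
  proof (cases "t' = t")
    case True
    have "{s\<in>S. ?g s = t} = R" using R(1) f(1) insert.hyps by auto
    then show ?thesis using True R(2) by simp
  next
    case False
    hence "{s\<in>S. ?g s = t'} = {s\<in>S - R. f s = t'}" by auto
    then show ?thesis using False f(2) that by auto
  qed
  moreover have "\<forall>s\<in>S. ?g s \<in> insert t I" using f(1) by auto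
  ultimately show ?case by (intro exI[of _ ?g]) blast
qed

lemma prescribed_fibres_eq:
  assumes "finite I" "finite S" "card S = (\<Sum>t\<in>I. n t)"
  shows "\<exists>f. (\<forall>s\<in>S. f s \<in> I) \<and> (\<forall>t\<in>I. card {s\<in>S. f s = t} = n t)"
proof -
  obtain f where f: "\<forall>s\<in>S. f s \<in> I" "\<forall>t\<in>I. card {s\<in>S. f s = t} \<le> n t"
    using prescribed_fibres[OF assms(1,2), of n] assms(3) by auto
  have "(\<Union>t\<in>I. {s\<in>S. f s = t}) = S" using f(1) by blast
  moreover have "card (\<Union>t\<in>I. {s\<in>S. f s = t}) = (\<Sum>t\<in>I. card {s\<in>S. f s = t})"
    by (rule card_UN_disjoint) (use assms in auto)
  ultimately have eq: "(\<Sum>t\<in>I. card {s\<in>S. f s = t}) = (\<Sum>t\<in>I. n t)" using assms(3) by simp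
  have "card {s\<in>S. f s = t} = n t" if "t \<in> I" for t
    by (rule sum_mono_inv[OF eq]) (use f(2) that assms in auto)
  thus ?thesis using f(1) by blast
qed

lemma card_Int_UN_disjoint_family:
  assumes "finite J" "disjoint_family_on F J" "\<And>t. t \<in> J \<Longrightarrow> finite (F t)"
  shows "card (S \<inter> (\<Union>t\<in>J. F t)) = (\<Sum>t\<in>J. card (S \<inter> F t))"
proof -
  have "S \<inter> (\<Union>t\<in>J. F t) = (\<Union>t\<in>J. S \<inter> F t)" by blast
  also have "card \<dots> = (\<Sum>t\<in>J. card (S \<inter> F t))"
    using assms unfolding disjoint_family_on_def by (intro card_UN_disjoint) blast+
  finally show ?thesis .
qed

lemma sum_indicator_eq_card: "finite J \<Longrightarrow> (\<Sum>t\<in>J. if P t then 1 else 0 :: int) = int (card {t\<in>J. P t})"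
  by (simp add: sum.If_cases Int_def)

context tripartite
begin

section \<open>Edges inside a type that is too large\<close>

lemma like_setD:
  assumes "like_set a w L P"
  shows "L \<subseteq> vtx" "P \<subseteq> L"
    and "i \<in> I3 \<Longrightarrow> real h - w \<le> real (card (L \<inter> V i))"
    and "i \<in> I3 \<Longrightarrow> real (card (L \<inter> V i)) \<le> real h + w"
    and "i \<in> I3 \<Longrightarrow> j \<in> I3 \<Longrightarrow> i \<noteq> j \<Longrightarrow> v \<in> L \<Longrightarrow> v \<in> V i \<Longrightarrow> nn v (V j - L) \<le> 2 * a"
    and "i \<in> I3 \<Longrightarrow> j \<in> I3 \<Longrightarrow> i \<noteq> j \<Longrightarrow> v \<in> L \<Longrightarrow> v \<in> V i \<Longrightarrow> nb v (L \<inter> V j) \<le> 2 * a"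
    and "i \<in> I3 \<Longrightarrow> j \<in> I3 \<Longrightarrow> i \<noteq> j \<Longrightarrow> v \<in> P \<Longrightarrow> v \<in> V i \<Longrightarrow> nn v (V j - L) \<le> a / 2"
    and "i \<in> I3 \<Longrightarrow> real (card (L \<inter> V i - P)) \<le> 2 * w"
    and "i \<in> I3 \<Longrightarrow> v \<in> V i \<Longrightarrow> v \<notin> L \<Longrightarrow> \<exists>j\<in>I3. j \<noteq> i \<and> nb v (P \<inter> V j) \<ge> a - w"
    and "i \<in> I3 \<Longrightarrow> real (card {v\<in>V i - L. \<exists>j\<in>I3. j \<noteq> i \<and> nn v (L \<inter> V j) > 2 * a}) \<le> 2 * w"
  using assms unfolding like_set_def by blast+

lemma like_set_core_card:
  assumes "like_set a w L P" "i \<in> I3"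
  shows "real h - 3 * w \<le> real (card (P \<inter> V i))"
proof -
  have "L \<inter> V i - (P \<inter> V i) = L \<inter> V i - P" by blast
  thus ?thesis using card_le_plus_Diff[of "L \<inter> V i" "P \<inter> V i"] like_setD(3,8)[OF assms] assms(2) by simp
qed

lemma exists_class: "v \<in> vtx \<Longrightarrow> \<exists>i\<in>I3. v \<in> V i" unfolding vtx_def by blast

text \<open>Some class \<open>i\<close> has \<open>x > 0\<close> vertices of \<open>L\<close> beyond
  \<open>h\<close>, so every vertex of another class has at least \<open>x\<close> neighbours in
  \<open>L \<inter> V i\<close>. If \<open>Z\<close> met all edges in \<open>L\<close>, these
  neighbours of the vertices in \<open>L \<inter> V j - Z\<close> would all lie in \<open>Z\<close>,
  whose at most \<open>18 * x\<close> vertices accept at most \<open>2 * a\<close> each: too few.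
  Allowing \<open>k\<close> up to twice the excess permits one more edge than the excess, which the
  parity argument needs.\<close>

lemma edge_in_like_set:
  assumes L: "like_set a w L P" and a: "100 * a \<le> real h" and w: "100 * w \<le> real h" and h: "0 < h"
    and k: "3 * h < card L" "k \<le> 2 * (card L - 3 * h)" and Z: "finite Z" "card Z \<le> 3 * k"
  shows "\<exists>u\<in>L - Z. \<exists>v\<in>L - Z. E u v"
proof (rule ccontr)
  assume none: "\<not> ?thesis"
  have L3: "card L = card (L \<inter> V 1) + card (L \<inter> V 2) + card (L \<inter> V 3)"
    using card_vtx_split[of 1 2 3 L] like_setD(1)[OF L] by (simp add: I3_def)
  \<comment> \<open>Averaging over the classes. A class with fewer than \<open>h\<close> vertices of
    \<open>L\<close> counts as zero under truncated subtraction, so the three truncated terms still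
    add up to at least the excess of \<open>L\<close>.\<close>
  have "\<exists>i\<in>I3. card L - 3 * h \<le> 3 * (card (L \<inter> V i) - h)"
  proof (rule ccontr)
    assume "\<not> ?thesis"
    hence "3 * (card (L \<inter> V 1) - h) < card L - 3 * h" "3 * (card (L \<inter> V 2) - h) < card L - 3 * h"
      "3 * (card (L \<inter> V 3) - h) < card L - 3 * h" by (auto simp: I3_def not_le)
    thus False using L3 k by linarith
  qed
  then obtain i where i: "i \<in> I3" "card L - 3 * h \<le> 3 * (card (L \<inter> V i) - h)" by blast
  define x where "x = real (card (L \<inter> V i)) - real h"
  have x: "x > 0" "real k \<le> 6 * x" 
  proof -
    have n: "h < card (L \<inter> V i)" "k + 6 * h \<le> 6 * card (L \<inter> V i)" using i k by linarith+
    show "x > 0" using n(1) by (simp add: x_def)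
    show "real k \<le> 6 * x" using of_nat_mono[OF n(2), where 'a = real] by (simp add: x_def)
  qed
  have xw: "x \<le> w" using like_setD(4)[OF L i(1)] by (simp add: x_def)
  have Z18: "real (card Z) \<le> 18 * x" using Z(2) x by linarith
  obtain j where j: "j \<in> I3" "j \<noteq> i" by (rule I3_other)
  have "L \<inter> V i \<noteq> {}" using x(1) by (auto simp: x_def)
  then obtain u where "u \<in> L" "u \<in> V i" by blast
  hence a0: "0 \<le> 2 * a"
    using like_setD(6)[OF L i(1) j(1) j(2)[symmetric], of u] nbrs_nonneg[of E u "L \<inter> V j"] by linarith
  have big: "nb v (L \<inter> V i) \<ge> x" if "v \<in> V j" for v
    using nn_le[OF j(1) i(1) j(2) that, of "L \<inter> V i"] nbrs_plus_nonnbrs[of "L \<inter> V i" E v] i(1) by (simp add: x_def)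
  let ?Q = "L \<inter> V j - Z" and ?R = "L \<inter> V i \<inter> Z"
  have finQ: "finite ?Q" "finite ?R" using i j by auto
  have "x \<le> nb v ?R" if v: "v \<in> ?Q" for v
  proof -
    have "{u\<in>L \<inter> V i. E v u} = {u\<in>?R. E v u}" using none v by blast
    thus ?thesis using big[of v] v by (simp add: nbrs_def)
  qed
  hence "(\<Sum>v\<in>?Q. x) \<le> (\<Sum>v\<in>?Q. nb v ?R)" by (intro sum_mono) blast
  also have "\<dots> = (\<Sum>u\<in>?R. nb u ?Q)" by (rule sum_nbrs_swap[OF finQ]) (rule sym_iff)
  also have "\<dots> \<le> (\<Sum>u\<in>?R. 2 * a)"
  proof (rule sum_mono)
    fix u assume u: "u \<in> ?R"
    have "nb u ?Q \<le> nb u (L \<inter> V j)" using j by (intro nbrs_mono) auto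
    thus "nb u ?Q \<le> 2 * a" using like_setD(6)[OF L i(1) j(1) j(2)[symmetric], of u] u by auto
  qed
  also have "\<dots> \<le> real (card Z) * (2 * a)"
  proof -
    have "card ?R \<le> card Z" using Z(1) by (intro card_mono) auto
    thus ?thesis using a0 by (simp add: mult_right_mono)
  qed
  also have "\<dots> \<le> 18 * x * (real h / 50)"
    using Z18 a x a0 by (intro mult_mono) auto
  finally have 1: "real (card ?Q) * x \<le> 18 * x * (real h / 50)" by simp
  hence "real (card ?Q) \<le> 18 * (real h / 50)" using x(1) by (simp add: field_simps)
  moreover have "real (card (L \<inter> V j)) \<le> real (card ?Q) + 18 * x"
  proof -
    have "card (L \<inter> V j - ?Q) \<le> card Z" using Z(1) by (intro card_mono) auto
    thus ?thesis using card_le_plus_Diff[of "L \<inter> V j" ?Q] finQ j(1) Z18 by simp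
  qed
  ultimately show False using like_setD(3)[OF L j(1)] xw w h by linarith
qed

text \<open>Every vertex of \<open>Z\<close> has at most \<open>3 * h\<close> neighbours in either
  class, so \<open>Z\<close> destroys at most \<open>6 * h * card Z\<close> of the counted
  pairs.\<close>

lemma edge_in_dense_pair:
  assumes ij: "i \<in> I3" "j \<in> I3" and Z: "finite Z"
    and dense: "(\<Sum>v\<in>S \<inter> V i. nb v (S \<inter> V j)) > 6 * real h * real (card Z)"
  shows "\<exists>u\<in>S - Z. \<exists>v\<in>S - Z. E u v"
proof (rule ccontr)
  assume none: "\<not> ?thesis"
  have fin: "finite (S \<inter> V i)" "finite (S \<inter> V j)" using ij by auto
  have le: "nb v (S \<inter> V k) \<le> 3 * h" if "k \<in> I3" for v k
  proof -
    have "nb v (S \<inter> V k) \<le> nb v (V k)" using that fin_Int' tripartite.fin[OF tripartite_axioms that] by (intro nbrs_mono) auto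
    thus ?thesis using nbrs_le_card[OF tripartite.fin[OF tripartite_axioms that], of E v] card_V[OF that] by simp
  qed
  have "(\<Sum>v\<in>S \<inter> V i. nb v (S \<inter> V j)) = (\<Sum>v\<in>S \<inter> V i \<inter> Z. nb v (S \<inter> V j)) + (\<Sum>v\<in>S \<inter> V i - Z. nb v (S \<inter> V j))"
    by (rule sum.Int_Diff[OF fin(1)])
  also have "(\<Sum>v\<in>S \<inter> V i \<inter> Z. nb v (S \<inter> V j)) \<le> (\<Sum>v\<in>S \<inter> V i \<inter> Z. 3 * real h)"
    using le[OF ij(2)] by (intro sum_mono) simp
  also have "\<dots> \<le> 3 * real h * real (card Z)"
    using Z card_mono[of Z "S \<inter> V i \<inter> Z"] by (simp add: mult_left_mono mult.commute[of _ "3 * real h"])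
  also have "(\<Sum>v\<in>S \<inter> V i - Z. nb v (S \<inter> V j)) = (\<Sum>v\<in>S \<inter> V i - Z. nb v (S \<inter> V j \<inter> Z))"
  proof (rule sum.cong[OF refl])
    fix v assume v: "v \<in> S \<inter> V i - Z"
    have "{u\<in>S \<inter> V j. E v u} = {u\<in>S \<inter> V j \<inter> Z. E v u}" using none v by blast
    thus "nb v (S \<inter> V j) = nb v (S \<inter> V j \<inter> Z)" by (simp add: nbrs_def)
  qed
  also have "\<dots> = (\<Sum>u\<in>S \<inter> V j \<inter> Z. nb u (S \<inter> V i - Z))"
    by (rule sum_nbrs_swap) (use fin sym_iff in auto)
  also have "\<dots> \<le> (\<Sum>u\<in>S \<inter> V j \<inter> Z. 3 * real h)"
  proof (rule sum_mono)
    fix u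
    have "nb u (S \<inter> V i - Z) \<le> nb u (S \<inter> V i)" using fin by (intro nbrs_mono) auto
    thus "nb u (S \<inter> V i - Z) \<le> 3 * real h" using le[OF ij(1), of u] by simp
  qed
  also have "\<dots> \<le> 3 * real h * real (card Z)"
    using Z card_mono[of Z "S \<inter> V j \<inter> Z"] by (simp add: mult_left_mono mult.commute[of _ "3 * real h"])
  finally show False using dense by simp
qed

lemma disjoint_edges:
  assumes "\<And>Z. finite Z \<Longrightarrow> card Z \<le> 3 * k \<Longrightarrow> \<exists>u\<in>S - Z. \<exists>v\<in>S - Z. E u v"
  shows "\<exists>M. finite M \<and> card M = k \<and> disjoint M \<and> (\<forall>T\<in>M. \<exists>u\<in>S. \<exists>v\<in>S. T = {u, v} \<and> E u v)"
proof -
  have "\<exists>M. finite M \<and> card M = k \<and> disjoint M \<and>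
     (\<forall>T\<in>M. (\<exists>u\<in>S. \<exists>v\<in>S. T = {u, v} \<and> E u v) \<and> finite T \<and> card T \<le> 3)"
  proof (rule greedy_disjoint_sets)
    fix Z :: "'a set" assume Z: "finite Z" "card Z \<le> 3 * k"
    obtain u v where uv: "u \<in> S - Z" "v \<in> S - Z" "E u v" using assms[OF Z] by blast
    show "\<exists>T. (\<exists>u\<in>S. \<exists>v\<in>S. T = {u, v} \<and> E u v) \<and> finite T \<and> T \<noteq> {} \<and> card T \<le> 3 \<and> T \<inter> Z = {}"
      using uv by (intro exI[of _ "{u, v}"]) (auto simp: card_insert_if)
  qed
  thus ?thesis by blast
qed

text \<open>The cores fill about \<open>2 * h\<close> vertices of each class, so in either other
  class \<open>v\<close> has many neighbours in at least one core. A neighbour \<open>x\<close> in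
  one core misses at most \<open>a / 2\<close> of the other core in another class, where
  \<open>v\<close> has at least \<open>a - w\<close> neighbours and \<open>Z\<close> spoils at most
  \<open>a / 4\<close> of them.\<close>

lemma two_like_sets_triangle:
  assumes L: "like_set a w L P" and L': "like_set a w L' P'" and dis: "L \<inter> L' = {}"
    and v: "v \<in> vtx" "v \<notin> L" "v \<notin> L'"
    and Z: "finite Z" "real (card Z) \<le> a / 4" and a: "100 * w \<le> a" "0 < w" "100 * a \<le> real h"
  shows "\<exists>x\<in>L - Z. \<exists>y\<in>L' - Z. E v x \<and> E v y \<and> E x y"
proof -
  obtain i where i: "i \<in> I3" "v \<in> V i" using exists_class v by blast
  obtain j k where jk: "j \<in> I3" "k \<in> I3" "j \<noteq> i" "k \<noteq> i" "j \<noteq> k" "I3 = {i, j, k}"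
    by (rule I3_others[OF i(1)])
  have one: "nb v (P \<inter> V m) \<ge> a - w \<or> nb v (P' \<inter> V m) \<ge> a - w" if m: "m \<in> I3" "m \<noteq> i" for m
  proof (rule ccontr)
    assume no: "\<not> ?thesis"
    have PP: "P \<inter> V m \<inter> (P' \<inter> V m) = {}" using dis like_setD(2)[OF L] like_setD(2)[OF L'] by blast
    have finm: "finite (V m)" using fin[OF m(1)] .
    have "nb v (V m) \<le> nb v (P \<inter> V m \<union> P' \<inter> V m) + real (card (V m - (P \<inter> V m \<union> P' \<inter> V m)))"
      using finm by (intro nbrs_le_plus_card) auto
    moreover have "nb v (P \<inter> V m \<union> P' \<inter> V m) = nb v (P \<inter> V m) + nb v (P' \<inter> V m)"
      using PP finm by (intro nbrs_Un) auto
    moreover have "real (card (V m - (P \<inter> V m \<union> P' \<inter> V m))) = 3 * h - card (P \<inter> V m) - card (P' \<inter> V m)"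
      using PP finm card_V[OF m(1)] by (simp add: card_Diff_subset card_Un_disjoint)
    moreover have "nb v (V m) \<ge> 2 * h"
      using nbrs_plus_nonnbrs[OF finm, of E v] nonadj[OF i(1) m(1) m(2)[symmetric] i(2)] card_V[OF m(1)] by simp
    ultimately show False
      using no like_set_core_card[OF L m(1)] like_set_core_card[OF L' m(1)] a by linarith
  qed
  have build: "\<exists>x\<in>L - Z. \<exists>y\<in>L' - Z. E v x \<and> E v y \<and> E x y"
    if mm: "m \<in> I3" "m' \<in> I3" "m \<noteq> m'" and big: "nb v (P \<inter> V m) \<ge> a - w" "nb v (P' \<inter> V m') \<ge> a - w" for m m'
  proof -
    have "nb v (P \<inter> V m) > real (card Z)" using big(1) Z(2) a by linarith
    then obtain x where x: "x \<in> P \<inter> V m" "E v x" "x \<notin> Z"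
      by (rule obtain_nbr[OF fin_Int[OF mm(1)] Z(1)])
    have "nn x (P' \<inter> V m') \<le> nn x (V m' - L)"
      using dis like_setD(2)[OF L'] mm by (intro nonnbrs_mono) auto
    hence "nn x (P' \<inter> V m') \<le> a / 2" using like_setD(7)[OF L mm, of x] x by auto
    hence "nb v (P' \<inter> V m') > nn x (P' \<inter> V m') + real (card Z)" using big(2) Z(2) a by linarith
    then obtain y where "y \<in> P' \<inter> V m'" "E v y" "E x y" "y \<notin> Z"
      by (rule obtain_common_nbr[OF fin_Int[OF mm(2)] Z(1)])
    thus ?thesis using x like_setD(2)[OF L] like_setD(2)[OF L'] by blast
  qed
  have A: "nb v (P \<inter> V j) \<ge> a - w \<or> nb v (P \<inter> V k) \<ge> a - w"
    using like_setD(9)[OF L i v(2)] jk(6) by auto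
  have B: "nb v (P' \<inter> V j) \<ge> a - w \<or> nb v (P' \<inter> V k) \<ge> a - w"
    using like_setD(9)[OF L' i v(3)] jk(6) by auto
  \<comment> \<open>Each of the two classes offers a large neighbourhood in one of the cores, and
    each core offers one in one of the classes. In every combination, the two cores can be served in
    different classes.\<close>
  show ?thesis
    using A B one[OF jk(1,3)] one[OF jk(2,4)] build[OF jk(1,2) jk(5)] build[OF jk(2,1) jk(5)[symmetric]] by argo
qed

section \<open>Packing when the vertices fall into three types\<close>

lemma vtx_Int_class: "i \<in> I3 \<Longrightarrow> vtx \<inter> V i = V i"
  unfolding vtx_def by blast

lemma card_vtx: "card vtx = 9 * h"
  using card_vtx_split[of 1 2 3 vtx] card_V[of 1] card_V[of 2] card_V[of 3] by (simp add: I3_def vtx_Int_class)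

lemma nbrs_plus_nonnbrs_Int: "i \<in> I3 \<Longrightarrow> nb v (S \<inter> V i) + nn v (S \<inter> V i) = real (card (S \<inter> V i))"
  by (rule nbrs_plus_nonnbrs) simp

text \<open>A surplus edge of an overfull type is assigned to a type that is too small and completed
  in the remaining type, so that its triangle takes two, zero and one vertices of them. A vertex of
  \<open>W\<close> goes into a triangle with one vertex of each type. Then all types have equal
  size. \<open>K\<close> bounds the number of these triangles, hence at most \<open>3 * K\<close>
  vertices have to be avoided at a time.\<close>

lemma three_types:
  fixes C :: "nat \<Rightarrow> 'a set" and M :: "nat \<Rightarrow> 'a set set" and K :: nat
  assumes cover: "(\<Union>t\<in>I3. C t) = vtx" and dC: "\<And>s t. s \<in> I3 \<Longrightarrow> t \<in> I3 \<Longrightarrow> s \<noteq> t \<Longrightarrow> C s \<inter> C t = {}"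
    and W: "W \<subseteq> vtx"
    and ac: "\<And>s t. s \<in> I3 \<Longrightarrow> t \<in> I3 \<Longrightarrow> s \<noteq> t \<Longrightarrow> acomp e (C s - W) (C t - W)"
    and lo: "\<And>t i. t \<in> I3 \<Longrightarrow> i \<in> I3 \<Longrightarrow> real h - d \<le> real (card ((C t - W) \<inter> V i))"
    and up: "\<And>t i. t \<in> I3 \<Longrightarrow> i \<in> I3 \<Longrightarrow> real (card (C t \<inter> V i)) \<le> real h + d"
    and rob: "\<And>w Z. w \<in> W \<Longrightarrow> finite Z \<Longrightarrow> card Z \<le> 3 * K \<Longrightarrow> w \<notin> Z \<Longrightarrow>
        \<exists>T. is_triangle E T \<and> w \<in> T \<and> T \<inter> Z = {} \<and> (\<forall>t\<in>I3. card (T \<inter> C t) = 1)"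
    and M: "\<And>t. t \<in> I3 \<Longrightarrow> finite (M t) \<and> card (M t) = card (C t) - 3 * h \<and> disjoint (M t)"
    and M': "\<And>t T. t \<in> I3 \<Longrightarrow> T \<in> M t \<Longrightarrow> \<exists>u\<in>C t - W. \<exists>v\<in>C t - W. T = {u, v} \<and> E u v"
    and K: "card W + (\<Sum>t\<in>I3. card (M t)) \<le> K"
    and num: "100 * e \<le> real h" "100 * d \<le> real h" "100 * real K \<le> real h" "0 < h"
  shows "triangle_packing vtx (3 * h)"
proof -
  have Cv: "C t \<subseteq> vtx" if "t \<in> I3" for t using cover that by blast
  have finC: "finite (C t)" if "t \<in> I3" for t using Cv[OF that] fin_vtx finite_subset by blast
  have finW: "finite W" using W fin_vtx finite_subset by blast
  define ME where "ME = (\<Union>t\<in>I3. M t)"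
  define J where "J = (\<lambda>w. {w}) ` W \<union> ME"
  have MC: "T \<subseteq> C t - W" "T \<noteq> {}" if "t \<in> I3" "T \<in> M t" for T t
    using M'[OF that] by auto
  have Mst: "s = t" if "T \<in> M s" "T \<in> M t" "s \<in> I3" "t \<in> I3" for T s t
  proof (rule ccontr)
    assume "s \<noteq> t"
    hence "C s \<inter> C t = {}" using dC that(3,4) by simp
    thus False using MC[OF that(3,1)] MC(1)[OF that(4,2)] by blast
  qed
  have finME: "finite ME" using M by (simp add: ME_def)
  have cME: "card ME = (\<Sum>t\<in>I3. card (M t))" unfolding ME_def
  proof (rule card_UN_disjoint)
    show "\<forall>i\<in>I3. \<forall>j\<in>I3. i \<noteq> j \<longrightarrow> M i \<inter> M j = {}" using Mst by blast
  qed (use M in auto)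
  have sumC: "(\<Sum>t\<in>I3. card (C t)) = 9 * h"
  proof -
    have "card (\<Union>t\<in>I3. C t) = (\<Sum>t\<in>I3. card (C t))"
      by (rule card_UN_disjoint) (use finC dC in auto)
    thus ?thesis using cover card_vtx by simp
  qed
  \<comment> \<open>The sizes of the three types add up to \<open>9 * h\<close>, so the total of the
    truncated excesses equals the total of the truncated deficits.\<close>
  have "card ME = (\<Sum>t\<in>I3. 3 * h - card (C t))"
  proof -
    have "card ME = (\<Sum>t\<in>I3. card (C t) - 3 * h)" using cME M by simp
    thus ?thesis using sumC unfolding I3_def by simp
  qed
  from prescribed_fibres_eq[OF finite_I3 finME this] obtain und where
    und: "\<And>T. T \<in> ME \<Longrightarrow> und T \<in> I3" and und_card: "\<And>t. t \<in> I3 \<Longrightarrow> card {T\<in>ME. und T = t} = 3 * h - card (C t)"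
    by blast
  have und_ne: "und T \<noteq> s" if "T \<in> M s" "s \<in> I3" for T s
  proof
    assume "und T = s"
    hence "T \<in> {T\<in>ME. und T = s}" using that unfolding ME_def by blast
    hence "card {T\<in>ME. und T = s} > 0" using finME by (subst card_gt_0_iff) auto
    moreover have "card (M s) > 0" using that M[OF that(2)] by (subst card_gt_0_iff) auto
    ultimately show False using und_card[OF that(2)] M[OF that(2)] by simp
  qed
  \<comment> \<open>This is the deviation from one vertex of type \<open>t\<close> in the triangle
    that is to contain \<open>T\<close>. It vanishes for the singletons coming from
    \<open>W\<close>.\<close>
  define \<delta> :: "'a set \<Rightarrow> nat \<Rightarrow> int" where
    "\<delta> T t = (if T \<in> M t then 1 else 0) - (if T \<in> ME \<and> und T = t then 1 else 0)" for T t
  define P where "P T F \<longleftrightarrow> is_triangle E F \<and> (\<forall>t\<in>I3. int (card (F \<inter> C t)) = 1 + \<delta> T t)" for T F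
  have MEW: "T \<inter> W = {}" "T \<noteq> {}" "finite T" "card T \<le> 3" "T \<subseteq> vtx" if TM: "T \<in> ME" for T
  proof -
    obtain t where t: "t \<in> I3" "T \<in> M t" using TM by (auto simp: ME_def)
    obtain u v where uv: "u \<in> C t - W" "v \<in> C t - W" "T = {u, v}" using M'[OF t] by blast
    show "T \<inter> W = {}" "T \<noteq> {}" "finite T" using uv by auto
    show "card T \<le> 3" using uv by (simp add: card_insert_if)
    show "T \<subseteq> vtx" using uv Cv[OF t(1)] by blast
  qed
  have finJ: "finite J" using finW finME by (simp add: J_def)
  have cJ: "card J \<le> K"
  proof -
    have "card J \<le> card ((\<lambda>w. {w}) ` W) + card ME" unfolding J_def by (rule card_Un_le)
    also have "card ((\<lambda>w. {w}) ` W) \<le> card W" by (rule card_image_le[OF finW])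
    finally show ?thesis using K cME by linarith
  qed
  have disME: "S \<inter> T = {}" if ST: "S \<in> ME" "T \<in> ME" "S \<noteq> T" for S T
  proof -
    obtain s t where st: "s \<in> I3" "S \<in> M s" "t \<in> I3" "T \<in> M t" using ST by (auto simp: ME_def)
    show ?thesis
    proof (cases "s = t")
      case True
      then show ?thesis using M[OF st(1)] st ST(3) unfolding disjoint_def by blast
    next
      case False
      hence "C s \<inter> C t = {}" using dC st(1,3) by simp
      then show ?thesis using MC(1)[OF st(1,2)] MC(1)[OF st(3,4)] by blast
    qed
  qed
  have disJ: "disjoint J"
    unfolding disjoint_def
  proof (intro ballI impI)
    fix S T assume ST: "S \<in> J" "T \<in> J" "S \<noteq> T"
    then consider w w' where "S = {w}" "T = {w'}" | w where "w \<in> W" "S = {w}" "T \<in> ME"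
      | w where "w \<in> W" "T = {w}" "S \<in> ME" | "S \<in> ME" "T \<in> ME" unfolding J_def by blast
    then show "S \<inter> T = {}"
    proof cases
      case 1 then show ?thesis using ST(3) by auto
    next
      case 2 then show ?thesis using MEW(1)[of T] by auto
    next
      case 3 then show ?thesis using MEW(1)[of S] by auto
    next
      case 4 then show ?thesis using disME ST(3) by blast
    qed
  qed
  have "\<exists>F. (\<forall>T\<in>J. P T (F T) \<and> T \<subseteq> F T \<and> finite (F T) \<and> card (F T) \<le> 3) \<and> disjoint_family_on F J"
  proof (rule greedy_disjoint_extension[OF finJ disJ])
    show "finite T \<and> card T \<le> 3" if "T \<in> J" for T using that MEW(3,4) unfolding J_def by auto
    fix T Z assume T: "T \<in> J" and Z: "finite Z" "card Z \<le> 3 * card J" "Z \<inter> T = {}"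
    have Z3: "card Z \<le> 3 * K" using Z(2) cJ by linarith
    show "\<exists>F. P T F \<and> T \<subseteq> F \<and> finite F \<and> card F \<le> 3 \<and> F \<inter> Z = {}"
    proof (cases "T \<in> ME")
      case False
      then obtain w where w: "w \<in> W" "T = {w}" using T by (auto simp: J_def)
      have "w \<notin> Z" using Z(3) w by blast
      from rob[OF w(1) Z(1) Z3 this] obtain F where
        F: "is_triangle E F" "w \<in> F" "F \<inter> Z = {}" "\<forall>t\<in>I3. card (F \<inter> C t) = 1" by blast
      have "\<delta> T t = 0" if "t \<in> I3" for t using False that by (auto simp: \<delta>_def ME_def)
      hence "P T F" using F by (simp add: P_def)
      thus ?thesis using F w triangle_props(1,2)[OF F(1)] by auto
    next
      case True
      then obtain s where s: "s \<in> I3" "T \<in> M s" by (auto simp: ME_def)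
      define r where "r = und T"
      have r: "r \<in> I3" "s \<noteq> r" using und[OF True] und_ne[OF s(2,1)] by (auto simp: r_def)
      \<comment> \<open>The edge lies in the overfull type \<open>s\<close> and was assigned to
        \<open>r\<close>; the third vertex is taken from the remaining type \<open>t\<close>, in the
        class that the edge does not meet.\<close>
      obtain t where t: "t \<in> I3" "t \<noteq> s" "t \<noteq> r" "I3 = {s, r, t}" by (rule I3_third[OF s(1) r])
      obtain u v where uv: "u \<in> C s - W" "v \<in> C s - W" "T = {u, v}" "E u v" using M'[OF s] by blast
      obtain i j where ij: "i \<in> I3" "j \<in> I3" "i \<noteq> j" "u \<in> V i" "v \<in> V j" using cross[OF uv(4)] by blast
      obtain k where k: "k \<in> I3" "k \<noteq> i" "k \<noteq> j" by (rule I3_third[OF ij(1,2,3)])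
      let ?S = "(C t - W) \<inter> V k"
      have "nn u ?S \<le> e" "nn v ?S \<le> e"
        using acompD[OF ac[OF s(1) t(1) t(2)[symmetric]] ij(1) k(1) k(2)[symmetric] uv(1) ij(4)]
          acompD[OF ac[OF s(1) t(1) t(2)[symmetric]] ij(2) k(1) k(3)[symmetric] uv(2) ij(5)] by auto
      moreover have "real (card Z) \<le> 3 * real K" using Z3 by linarith
      ultimately have "nb u ?S > nn v ?S + real (card Z)"
        using nbrs_plus_nonnbrs_Int[OF k(1), of u "C t - W"] lo[OF t(1) k(1)] num by linarith
      then obtain b where b: "b \<in> ?S" "E u b" "E v b" "b \<notin> Z"
        by (rule obtain_common_nbr[OF fin_Int[OF k(1)] Z(1)])
      let ?F = "{u, v, b}"
      have tri: "is_triangle E ?F" using triangleI[OF uv(4) b(3) b(2)] .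
      have mem: "u \<notin> C r" "v \<notin> C r" "b \<notin> C r" "u \<notin> C t" "v \<notin> C t" "b \<notin> C s"
        using uv b dC[OF s(1) r(1) r(2)] dC[OF s(1) t(1) t(2)[symmetric]] dC[OF r(1) t(1) t(3)[symmetric]] by blast+
      have Fs: "?F \<inter> C s = {u, v}" "?F \<inter> C r = {}" "?F \<inter> C t = {b}" using uv b mem by blast+
      have uvne: "u \<noteq> v" using uv(4) irrefl by blast
      have notM: "T \<notin> M r" "T \<notin> M t" using Mst[OF s(2) _ s(1) r(1)] Mst[OF s(2) _ s(1) t(1)] r t by blast+
      have ds: "\<delta> T s = 1" "\<delta> T r = -1" "\<delta> T t = 0"
        using s(2) notM True r(2) t(2,3) unfolding \<delta>_def r_def by auto
      have "int (card (?F \<inter> C t')) = 1 + \<delta> T t'" if t': "t' \<in> I3" for t'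
      proof -
        consider "t' = s" | "t' = r" | "t' = t" using t' unfolding t(4) by blast
        then show ?thesis
        proof cases
          case 1
          show ?thesis unfolding 1 Fs ds using uvne by simp
        next
          case 2
          show ?thesis unfolding 2 Fs ds by simp
        next
          case 3
          show ?thesis unfolding 3 Fs ds by simp
        qed
      qed
      hence "P T ?F" using tri by (simp add: P_def)
      moreover have "?F \<inter> Z = {}" using Z(3) uv b by blast
      ultimately show ?thesis using uv(3) triangle_props(1,2)[OF tri] by (intro exI[of _ ?F]) auto
    qed
  qed
  then obtain F where F: "\<And>T. T \<in> J \<Longrightarrow> P T (F T) \<and> T \<subseteq> F T \<and> finite (F T)" and dF: "disjoint_family_on F J"
    by blast
  have triF: "is_triangle E (F T)" if "T \<in> J" for T using F[OF that] by (simp add: P_def)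
  define Y where "Y = (\<Union>T\<in>J. F T)"
  have Yv: "Y \<subseteq> vtx" unfolding Y_def using triF triangle_props(3) by blast
  have packY: "triangle_packing Y (card J)"
    by (rule triangle_packing_family[OF finJ dF triF]) (auto simp: Y_def)
  have finF: "\<And>T. T \<in> J \<Longrightarrow> finite (F T)" using F by blast
  have YV: "card (Y \<inter> V i) = card J" if "i \<in> I3" for i
  proof -
    have "card (V i \<inter> Y) = (\<Sum>T\<in>J. card (V i \<inter> F T))"
      unfolding Y_def by (rule card_Int_UN_disjoint_family[OF finJ dF finF])
    also have "\<dots> = (\<Sum>T\<in>J. 1)"
      by (rule sum.cong[OF refl]) (metis triF triangle_props(5) that Int_commute)
    finally show ?thesis by (simp add: Int_commute)
  qed
  \<comment> \<open>The deviations add up to the signed excess of type \<open>t\<close>, which is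
    why integers are used. Consequently every type keeps \<open>3 * h - card J\<close>
    vertices.\<close>
  have YC: "int (card (Y \<inter> C t)) = int (card J) + int (card (C t)) - 3 * int h" if t: "t \<in> I3" for t
  proof -
    have "card (C t \<inter> Y) = (\<Sum>T\<in>J. card (C t \<inter> F T))"
      unfolding Y_def by (rule card_Int_UN_disjoint_family[OF finJ dF finF])
    hence "int (card (C t \<inter> Y)) = (\<Sum>T\<in>J. int (card (C t \<inter> F T)))" by simp
    also have "\<dots> = (\<Sum>T\<in>J. 1 + \<delta> T t)"
      by (rule sum.cong[OF refl]) (use F t in \<open>auto simp: P_def Int_commute\<close>)
    also have "\<dots> = int (card J) + (\<Sum>T\<in>J. \<delta> T t)" by (simp add: sum.distrib)
    also have "(\<Sum>T\<in>J. \<delta> T t) = int (card {T\<in>J. T \<in> M t}) - int (card {T\<in>J. T \<in> ME \<and> und T = t})"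
      unfolding \<delta>_def by (simp only: sum_subtractf sum_indicator_eq_card[OF finJ])
    also have "{T\<in>J. T \<in> M t} = M t" using t by (auto simp: J_def ME_def)
    also have "{T\<in>J. T \<in> ME \<and> und T = t} = {T\<in>ME. und T = t}" by (auto simp: J_def)
    finally show ?thesis using M[OF t] und_card[OF t] by (simp add: Int_commute)
  qed
  define n where "n = 3 * h - card J"
  have Jh: "card J \<le> 3 * h" using cJ num(3) by linarith
  have WY: "W \<subseteq> Y"
  proof
    fix w assume "w \<in> W"
    hence "{w} \<in> J" by (simp add: J_def)
    thus "w \<in> Y" using F[of "{w}"] unfolding Y_def by blast
  qed
  define D where "D t = C t - Y" for t
  have cD: "card (D t) = n" if "t \<in> I3" for t
  proof -
    have "card (D t) = card (C t) - card (Y \<inter> C t)"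
      unfolding D_def using card_Diff_subset_Int[of "C t" Y] finC[OF that] by (simp add: Int_commute)
    moreover have "card (Y \<inter> C t) \<le> card (C t)" using finC[OF that] by (intro card_mono) auto
    ultimately show ?thesis using YC[OF that] Jh unfolding n_def by linarith
  qed
  have Dac: "acomp e (D s) (D t)" if "s \<in> I3" "t \<in> I3" "s \<noteq> t" for s t
    by (rule acomp_mono[OF ac[OF that]]) (use WY in \<open>auto simp: D_def\<close>)
  have Dup: "real (card (D t \<inter> V i)) \<le> real h + d" if "t \<in> I3" "i \<in> I3" for t i
  proof -
    have "card (D t \<inter> V i) \<le> card (C t \<inter> V i)" using that by (intro card_mono) (auto simp: D_def)
    thus ?thesis using up[OF that] by linarith
  qed
  have Dlo: "real h - d - real K \<le> real (card (D t \<inter> V i))" if "t \<in> I3" "i \<in> I3" for t i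
  proof -
    have "card ((C t - W) \<inter> V i - D t \<inter> V i) \<le> card (Y \<inter> V i)" using that by (intro card_mono) (auto simp: D_def)
    hence "card ((C t - W) \<inter> V i - D t \<inter> V i) \<le> K" using YV[OF that(2)] cJ by linarith
    thus ?thesis using card_le_plus_Diff[of "(C t - W) \<inter> V i" "D t \<inter> V i"] lo[OF that] that(2) by simp
  qed
  have I: "(1::nat) \<in> I3" "(2::nat) \<in> I3" "(3::nat) \<in> I3" by (auto simp: I3_def)
  have dD: "D 1 \<inter> D 2 = {}" "D 1 \<inter> D 3 = {}" "D 2 \<inter> D 3 = {}"
    using dC[OF I(1,2)] dC[OF I(1,3)] dC[OF I(2,3)] by (auto simp: D_def)
  have Dv: "D t \<subseteq> vtx" if "t \<in> I3" for t using Cv[OF that] by (auto simp: D_def)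
  have Dun: "D 1 \<union> (D 2 \<union> D 3) = vtx - Y" using cover unfolding D_def I3_def by auto
  have nr: "real n \<ge> 3 * real h - real K" using cJ Jh unfolding n_def by simp
  \<comment> \<open>Types 2 and 3 are matched with each other, and the matching edges are then
    distributed over the vertices of type 1. The error doubles there, because nonneighbours in both
    types add up.\<close>
  have pm: "perfect_matching (D 2 \<union> D 3) E"
  proof (rule perfect_matching_acomp[OF Dv[OF I(2)] Dv[OF I(3)] dD(3) _ Dac[OF I(2,3)]])
    show "card (D 2) = card (D 3)" using cD I by simp
    show "2 * real (card (D 3 \<inter> V i)) + 4 * e \<le> real (card (D 3))" if "i \<in> I3" for i
      using Dup[OF I(3) that] cD[OF I(3)] nr num by linarith
    show "2 * real (card (D 2 \<inter> V i)) + 4 * e \<le> real (card (D 2))" if "i \<in> I3" for i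
      using Dup[OF I(2) that] cD[OF I(2)] nr num by linarith
  qed simp
  have "triangle_packing (D 1 \<union> (D 2 \<union> D 3)) n"
  proof (rule packing_of_perfect_matching[OF Dv[OF I(1)] _ _ _ cD[OF I(1)] _ _ pm])
    show "D 2 \<union> D 3 \<subseteq> vtx" using Dv I by blast
    show "D 1 \<inter> (D 2 \<union> D 3) = {}" using dD by blast
    show "card ((D 1 \<union> (D 2 \<union> D 3)) \<inter> V i) = n" if i: "i \<in> I3" for i
    proof -
      have "(D 1 \<union> (D 2 \<union> D 3)) \<inter> V i = V i - Y" unfolding Dun using i unfolding vtx_def by blast
      moreover have "card (V i - Y) = card (V i) - card (Y \<inter> V i)"
        using card_Diff_subset_Int[of "V i" Y] fin_Int[OF i] by (simp add: Int_commute)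
      ultimately show ?thesis using YV[OF i] card_V[OF i] by (simp add: n_def)
    qed
    have half: "nn v ((P \<union> Q) \<inter> V j) \<le> nn v (P \<inter> V j) + nn v (Q \<inter> V j)" if "j \<in> I3" "P \<inter> Q = {}" for v j P Q
    proof -
      have "(P \<union> Q) \<inter> V j = P \<inter> V j \<union> Q \<inter> V j" by blast
      moreover have "nn v (P \<inter> V j \<union> Q \<inter> V j) = nn v (P \<inter> V j) + nn v (Q \<inter> V j)"
        using that by (intro nonnbrs_Un) auto
      ultimately show ?thesis by simp
    qed
    have e0: "0 \<le> e"
    proof -
      have "D 1 \<inter> V 1 \<noteq> {}" using Dlo[OF I(1,1)] num by auto
      then obtain u where "u \<in> D 1" "u \<in> V 1" by blast
      from order_trans[OF nonnbrs_nonneg acompD[OF Dac[OF I(1,2)] I(1,2) _ this]] show ?thesis by simp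
    qed
    show "acomp (2 * e) (D 1) (D 2 \<union> D 3)" unfolding acomp_def
    proof (intro ballI impI conjI)
      fix i j v assume ij: "i \<in> I3" "j \<in> I3" "i \<noteq> j" and v: "v \<in> D 1 \<inter> V i"
      show "nn v ((D 2 \<union> D 3) \<inter> V j) \<le> 2 * e"
        using half[OF ij(2) dD(3), of v] acompD[OF Dac[OF I(1,2)] ij, of v] acompD[OF Dac[OF I(1,3)] ij, of v] v by auto
    next
      fix i j v assume ij: "i \<in> I3" "j \<in> I3" "i \<noteq> j" and v: "v \<in> (D 2 \<union> D 3) \<inter> V i"
      show "nn v (D 1 \<inter> V j) \<le> 2 * e"
        using acompD[OF Dac[OF I(2,1)] ij, of v] acompD[OF Dac[OF I(3,1)] ij, of v] v e0 by auto
    qed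
    show "4 * (2 * e) \<le> real (card (D 1 \<inter> V i))" if "i \<in> I3" for i
      using Dlo[OF I(1) that] num by linarith
  qed
  hence "triangle_packing (vtx - Y) n" by (simp only: Dun)
  from triangle_packing_Un[OF packY this] have "triangle_packing (Y \<union> (vtx - Y)) (card J + n)" by blast
  thus ?thesis using Yv Jh unfolding n_def by (simp add: Un_absorb1)
qed

section \<open>From sparse triples to three types\<close>

lemma sparse_triple_mono: "sparse_triple d A \<Longrightarrow> d \<le> d' \<Longrightarrow> sparse_triple d' A"
  unfolding sparse_triple_def by (meson order_trans)

lemma sparse_tripleD:
  assumes "sparse_triple d A"
  shows "i \<in> I3 \<Longrightarrow> A i \<subseteq> V i" "i \<in> I3 \<Longrightarrow> card (A i) = h" "i \<in> I3 \<Longrightarrow> finite (A i)"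
    "i \<in> I3 \<Longrightarrow> j \<in> I3 \<Longrightarrow> i \<noteq> j \<Longrightarrow> (\<Sum>v\<in>A i. nb v (A j)) \<le> d"
  using assms fin finite_subset unfolding sparse_triple_def by metis+

text \<open>A common vertex would miss at least \<open>h - a\<close> vertices of \<open>A j\<close>
  and as many of \<open>B j\<close>. These sets overlap in at most \<open>h / 2\<close> vertices, so
  it would miss nearly \<open>3 * h / 2\<close> vertices of one class.\<close>

lemma likes_disjoint:
  assumes A: "sparse_triple d A" and B: "sparse_triple d' B" and a: "8 * a \<le> real h" and h: "0 < h"
    and AB: "\<And>i. i \<in> I3 \<Longrightarrow> 2 * card (A i \<inter> B i) \<le> h"
  shows "likes A a \<inter> likes B a = {}"
proof (rule ccontr)
  assume "\<not> ?thesis"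
  then obtain v where v: "v \<in> likes A a" "v \<in> likes B a" by blast
  then obtain i where i: "i \<in> I3" "v \<in> V i" unfolding likes_def by blast
  obtain j where j: "j \<in> I3" "j \<noteq> i" by (rule I3_other)
  have finj: "finite (A j)" "finite (B j)" using sparse_tripleD(3) A B j by blast+
  have "nb v (A j) \<le> a" "nb v (B j) \<le> a" using v likes_iff[OF i] j by auto
  hence nn: "nn v (A j) \<ge> h - a" "nn v (B j) \<ge> h - a"
    using nbrs_plus_nonnbrs[OF finj(1), of E v] nbrs_plus_nonnbrs[OF finj(2), of E v]
      sparse_tripleD(2)[OF A j(1)] sparse_tripleD(2)[OF B j(1)] by auto
  have "nn v (B j) \<le> nn v (B j - A j) + real (card (B j - (B j - A j)))"
    using finj by (intro nonnbrs_le_plus_card) auto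
  moreover have "B j - (B j - A j) = A j \<inter> B j" by blast
  ultimately have 1: "nn v (B j) \<le> nn v (B j - A j) + real h / 2" using AB[OF j(1)] by simp
  have "nn v (A j) + nn v (B j - A j) = nn v (A j \<union> (B j - A j))"
    using finj by (intro nonnbrs_Un[symmetric]) auto
  also have "\<dots> \<le> h" using sparse_tripleD(1)[OF A j(1)] sparse_tripleD(1)[OF B j(1)]
    by (intro nn_le[OF i(1) j(1) j(2)[symmetric] i(2)]) auto
  finally show False using 1 nn a h by linarith
qed

text \<open>Vertices are dropped, or at most \<open>x\<close> are added, to reach size exactly
  \<open>h\<close>. The new vertices of \<open>I' i\<close> contribute at most \<open>x * h\<close>
  pairs, and those of \<open>I' j\<close> at most \<open>x\<close> for each of the \<open>h\<close>
  vertices of \<open>I' i\<close>.\<close>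

lemma sparse_triple_adjust:
  assumes I: "\<And>i. i \<in> I3 \<Longrightarrow> I i \<subseteq> V i" "\<And>i. i \<in> I3 \<Longrightarrow> real h - x \<le> real (card (I i))"
    and sp: "\<And>i j. i \<in> I3 \<Longrightarrow> j \<in> I3 \<Longrightarrow> i \<noteq> j \<Longrightarrow> (\<Sum>v\<in>I i. nb v (I j)) \<le> c" and x: "0 \<le> x"
  shows "\<exists>I'. sparse_triple (c + 2 * x * real h) I' \<and> (\<forall>i\<in>I3. real (card (I' i - I i)) \<le> x)"
proof -
  have finI: "finite (I i)" if "i \<in> I3" for i using I(1)[OF that] fin[OF that] finite_subset by blast
  have "\<exists>R. R \<subseteq> V i \<and> card R = h \<and> real (card (R - I i)) \<le> x" if i: "i \<in> I3" for i
  proof (cases "h \<le> card (I i)")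
    case True
    then obtain R where R: "R \<subseteq> I i" "card R = h" using obtain_subset_with_card_n by metis
    have "real (card (R - I i)) = 0" using R(1) by (simp only: Diff_eq_empty_iff[THEN iffD2]) simp
    thus ?thesis using I(1)[OF i] x R by (intro exI[of _ R]) auto
  next
    case False
    have "card (V i - I i) = 3 * h - card (I i)" using card_Diff_subset[OF finI[OF i] I(1)[OF i]] card_V[OF i] by simp
    hence "h - card (I i) \<le> card (V i - I i)" by simp
    then obtain R where R: "R \<subseteq> V i - I i" "card R = h - card (I i)"
      by (metis obtain_subset_with_card_n)
    have finR: "finite R" using R(1) fin_Diff[OF i] finite_subset by blast
    have "card (I i \<union> R) = h"
      using R finR finI[OF i] False card_Un_disjoint[of "I i" R] by auto
    moreover have "I i \<union> R - I i = R" using R(1) by blast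
    moreover have "real (card R) \<le> x" using R(2) False I(2)[OF i] by simp
    ultimately show ?thesis using R(1) I(1)[OF i] by (intro exI[of _ "I i \<union> R"]) auto
  qed
  then obtain I' where I': "\<And>i. i \<in> I3 \<Longrightarrow> I' i \<subseteq> V i" "\<And>i. i \<in> I3 \<Longrightarrow> card (I' i) = h"
    "\<And>i. i \<in> I3 \<Longrightarrow> real (card (I' i - I i)) \<le> x" by metis
  have finI': "finite (I' i)" if "i \<in> I3" for i using I'(1)[OF that] fin[OF that] finite_subset by blast
  have "(\<Sum>v\<in>I' i. nb v (I' j)) \<le> c + 2 * x * real h" if ij: "i \<in> I3" "j \<in> I3" "i \<noteq> j" for i j
  proof -
    have le: "nb v (I' j) \<le> real h" for v using nbrs_le_card[OF finI'[OF ij(2)], of E v] I'(2)[OF ij(2)] by simp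
    have "(\<Sum>v\<in>I' i. nb v (I' j)) = (\<Sum>v\<in>I' i \<inter> I i. nb v (I' j)) + (\<Sum>v\<in>I' i - I i. nb v (I' j))"
      by (rule sum.Int_Diff[OF finI'[OF ij(1)]])
    also have "(\<Sum>v\<in>I' i - I i. nb v (I' j)) \<le> (\<Sum>v\<in>I' i - I i. real h)" using le by (rule sum_mono)
    also have "\<dots> \<le> x * real h" using I'(3)[OF ij(1)] by (simp add: mult_right_mono)
    also have "(\<Sum>v\<in>I' i \<inter> I i. nb v (I' j)) \<le> (\<Sum>v\<in>I' i \<inter> I i. nb v (I j) + x)"
    proof (rule sum_mono)
      fix v
      show "nb v (I' j) \<le> nb v (I j) + x"
        using nbrs_le_plus_card[OF finI'[OF ij(2)] finI[OF ij(2)], of E v] I'(3)[OF ij(2)] by linarith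
    qed
    also have "\<dots> = (\<Sum>v\<in>I' i \<inter> I i. nb v (I j)) + real (card (I' i \<inter> I i)) * x" by (simp add: sum.distrib)
    also have "(\<Sum>v\<in>I' i \<inter> I i. nb v (I j)) \<le> (\<Sum>v\<in>I i. nb v (I j))"
      using finI[OF ij(1)] by (intro sum_mono2) auto
    also have "\<dots> \<le> c" by (rule sp[OF ij])
    also have "real (card (I' i \<inter> I i)) * x \<le> real h * x"
    proof -
      have "card (I' i \<inter> I i) \<le> card (I' i)" using finI'[OF ij(1)] by (intro card_mono) auto
      thus ?thesis using I'(2)[OF ij(1)] x by (intro mult_right_mono) auto
    qed
    finally show ?thesis by (simp add: algebra_simps)
  qed
  thus ?thesis using I' unfolding sparse_triple_def by blast
qed

lemma like_set_matching:
  assumes "like_set a w L P" "100 * a \<le> real h" "100 * w \<le> real h" "0 < h"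
  shows "\<exists>M. finite M \<and> card M = card L - 3 * h \<and> disjoint M \<and> (\<forall>T\<in>M. \<exists>u\<in>L. \<exists>v\<in>L. T = {u, v} \<and> E u v)"
proof (cases "3 * h < card L")
  case True
  show ?thesis by (rule disjoint_edges, rule edge_in_like_set[OF assms True]) auto
next
  case False
  then show ?thesis by (intro exI[of _ "{}"]) auto
qed

lemma like_set_card:
  assumes "like_set a w L P"
  shows "3 * real h - 3 * w \<le> real (card L)" "real (card L) \<le> 3 * real h + 3 * w"
proof -
  have I: "(1::nat) \<in> I3" "(2::nat) \<in> I3" "(3::nat) \<in> I3" by (auto simp: I3_def)
  have "real (card L) = real (card (L \<inter> V 1)) + real (card (L \<inter> V 2)) + real (card (L \<inter> V 3))"
    using card_vtx_split[of 1 2 3 L] like_setD(1)[OF assms] by (simp add: I3_def)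
  thus "3 * real h - 3 * w \<le> real (card L)" "real (card L) \<le> 3 * real h + 3 * w"
    using like_setD(3,4)[OF assms I(1)] like_setD(3,4)[OF assms I(2)] like_setD(3,4)[OF assms I(3)] by linarith+
qed

lemma like_sets_acomp:
  assumes L: "like_set a w L P" and L': "like_set a w L' P'" and dis: "L \<inter> L' = {}"
  shows "acomp (2 * a) L L'"
proof -
  have *: "nn v (Q \<inter> V j) \<le> 2 * a"
    if "like_set a w L P" "L \<inter> Q = {}" "i \<in> I3" "j \<in> I3" "i \<noteq> j" "v \<in> L \<inter> V i" for L P Q i j v
    by (rule order_trans[OF nonnbrs_mono like_setD(5)[OF that(1,3,4,5)]]) (use that in auto)
  have dis': "L' \<inter> L = {}" using dis by blast
  show ?thesis unfolding acomp_def using *[OF L dis] *[OF L' dis'] by blast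
qed

lemma one_of_each_type:
  assumes "I3 = {r, s, t}" "C r \<inter> C s = {}" "C r \<inter> C t = {}" "C s \<inter> C t = {}" "x \<in> C r" "y \<in> C s" "z \<in> C t"
  shows "\<forall>q\<in>I3. card ({x, y, z} \<inter> C q) = 1"
proof
  fix q assume "q \<in> I3"
  hence "q = r \<or> q = s \<or> q = t" using assms(1) by blast
  moreover have "{x, y, z} \<inter> C r = {x}" "{x, y, z} \<inter> C s = {y}" "{x, y, z} \<inter> C t = {z}" using assms by auto
  ultimately show "card ({x, y, z} \<inter> C q) = 1" by (elim disjE) simp_all
qed

text \<open>The vertices in no like set are exceptional. They are assigned to types that are too
  small; as such a vertex lies outside the like sets of the other two types,
  \<open>two_like_sets_triangle\<close> covers it by a triangle with one vertex of each
  type.\<close>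

lemma packing_of_three_like_sets:
  assumes L: "\<And>t. t \<in> I3 \<Longrightarrow> like_set a w (L t) (P t)"
    and dis: "\<And>s t. s \<in> I3 \<Longrightarrow> t \<in> I3 \<Longrightarrow> s \<noteq> t \<Longrightarrow> L s \<inter> L t = {}"
    and aw: "1000 * w \<le> a" "0 < w" "1000 * a \<le> real h"
  shows "triangle_packing vtx (3 * h)"
proof -
  have "0 < real h" using aw by linarith
  hence h: "0 < h" by simp
  have finL: "finite (L t)" if "t \<in> I3" for t
    using like_setD(1)[OF L[OF that]] fin_vtx finite_subset by blast
  define R where "R = vtx - (\<Union>t\<in>I3. L t)"
  have finR: "finite R" using fin_vtx by (simp add: R_def)
  have sumL: "card (\<Union>t\<in>I3. L t) = (\<Sum>t\<in>I3. card (L t))"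
    by (rule card_UN_disjoint) (use finL dis in auto)
  have LU: "(\<Union>t\<in>I3. L t) \<subseteq> vtx" using like_setD(1)[OF L] by blast
  have cR: "card R + (\<Sum>t\<in>I3. card (L t)) = 9 * h"
  proof -
    have "card R = card vtx - card (\<Union>t\<in>I3. L t)"
      unfolding R_def using LU fin_vtx finite_subset by (intro card_Diff_subset) blast+
    moreover have "card (\<Union>t\<in>I3. L t) \<le> card vtx" using LU fin_vtx by (intro card_mono) auto
    ultimately show ?thesis using sumL card_vtx by simp
  qed
  \<comment> \<open>The deficits have room for all of \<open>R\<close>. Filling types only up to
    capacity leaves the excess of each type that of its like set, where disjoint edges are
    available.\<close>
  have "card R \<le> (\<Sum>t\<in>I3. 3 * h - card (L t))" using cR unfolding I3_def by simp
  from prescribed_fibres[OF finite_I3 finR this] obtain f where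
    f: "\<And>v. v \<in> R \<Longrightarrow> f v \<in> I3" "\<And>t. t \<in> I3 \<Longrightarrow> card {v\<in>R. f v = t} \<le> 3 * h - card (L t)" by blast
  have cRw: "real (card R) \<le> 9 * w"
  proof -
    have "real (card R) + (\<Sum>t\<in>I3. real (card (L t))) = 9 * real h"
      using cR by (metis of_nat_add of_nat_mult of_nat_numeral of_nat_sum)
    moreover have "(\<Sum>t\<in>I3. 3 * real h - 3 * w) \<le> (\<Sum>t\<in>I3. real (card (L t)))"
      by (rule sum_mono) (rule like_set_card(1)[OF L])
    ultimately show ?thesis by simp
  qed
  define C where "C t = L t \<union> {v\<in>R. f v = t}" for t
  have RL: "R \<inter> L t = {}" if "t \<in> I3" for t using that unfolding R_def by blast
  have CR: "C t - R = L t" if "t \<in> I3" for t using RL[OF that] by (auto simp: C_def)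
  have cC: "card (C t) = card (L t) + card {v\<in>R. f v = t}" if "t \<in> I3" for t
    unfolding C_def using RL[OF that] finR finL[OF that] by (intro card_Un_disjoint) auto
  have excess: "card (C t) - 3 * h = card (L t) - 3 * h" if "t \<in> I3" for t using cC[OF that] f(2)[OF that] by simp
  have "\<exists>M. \<forall>t\<in>I3. finite (M t) \<and> card (M t) = card (C t) - 3 * h \<and> disjoint (M t) \<and> (\<forall>T\<in>M t. \<exists>u\<in>L t. \<exists>v\<in>L t. T = {u, v} \<and> E u v)"
  proof (rule bchoice, rule ballI)
    fix t assume t: "t \<in> I3"
    have "100 * a \<le> h" "100 * w \<le> h" using aw by linarith+
    from like_set_matching[OF L[OF t] this h]
    show "\<exists>M. finite M \<and> card M = card (C t) - 3 * h \<and> disjoint M \<and> (\<forall>T\<in>M. \<exists>u\<in>L t. \<exists>v\<in>L t. T = {u, v} \<and> E u v)"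
      unfolding excess[OF t] .
  qed
  then obtain M where M0: "\<forall>t\<in>I3. finite (M t) \<and> card (M t) = card (C t) - 3 * h \<and> disjoint (M t) \<and> (\<forall>T\<in>M t. \<exists>u\<in>L t. \<exists>v\<in>L t. T = {u, v} \<and> E u v)"
    by (elim exE)
  have M: "finite (M t) \<and> card (M t) = card (C t) - 3 * h \<and> disjoint (M t)"
    and M': "\<forall>T\<in>M t. \<exists>u\<in>L t. \<exists>v\<in>L t. T = {u, v} \<and> E u v" if "t \<in> I3" for t
    using bspec[OF M0 that] by simp_all
  define K where "K = card R + (\<Sum>t\<in>I3. card (M t))"
  have K: "real K \<le> 18 * w"
  proof -
    have "real (card (M t)) \<le> 3 * w" if "t \<in> I3" for t
    proof -
      have "card (M t) \<le> card (L t) - 3 * h" using M[OF that] excess[OF that] by simp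
      moreover have "real (card (L t) - 3 * h) \<le> 3 * w"
        using like_set_card(2)[OF L[OF that]] aw by (cases "3 * h \<le> card (L t)") (auto simp: of_nat_diff)
      ultimately show ?thesis by linarith
    qed
    hence "(\<Sum>t\<in>I3. real (card (M t))) \<le> (\<Sum>t\<in>I3. 3 * w)" by (rule sum_mono)
    thus ?thesis using cRw unfolding K_def by simp
  qed
  have dC: "C s \<inter> C t = {}" if "s \<in> I3" "t \<in> I3" "s \<noteq> t" for s t
    using dis[OF that] RL[OF that(1)] RL[OF that(2)] that(3) unfolding C_def by blast
  show ?thesis
  proof (rule three_types[of C R "2 * a" "10 * w" K M])
    show "(\<Union>t\<in>I3. C t) = vtx"
    proof
      show "(\<Union>t\<in>I3. C t) \<subseteq> vtx" using LU unfolding C_def R_def by blast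
      show "vtx \<subseteq> (\<Union>t\<in>I3. C t)"
      proof
        fix v assume v: "v \<in> vtx"
        show "v \<in> (\<Union>t\<in>I3. C t)"
        proof (cases "v \<in> R")
          case True
          thus ?thesis using f(1)[OF True] unfolding C_def by blast
        next
          case False
          thus ?thesis using v unfolding C_def R_def by blast
        qed
      qed
    qed
    show "C s \<inter> C t = {}" if "s \<in> I3" "t \<in> I3" "s \<noteq> t" for s t by (rule dC[OF that])
    show "R \<subseteq> vtx" by (auto simp: R_def)
    show "acomp (2 * a) (C s - R) (C t - R)" if "s \<in> I3" "t \<in> I3" "s \<noteq> t" for s t
      unfolding CR[OF that(1)] CR[OF that(2)] by (rule like_sets_acomp[OF L[OF that(1)] L[OF that(2)] dis[OF that]])
    show "real h - 10 * w \<le> real (card ((C t - R) \<inter> V i))" if "t \<in> I3" "i \<in> I3" for t i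
      unfolding CR[OF that(1)] using like_setD(3)[OF L[OF that(1)] that(2)] aw by linarith
    show "real (card (C t \<inter> V i)) \<le> real h + 10 * w" if "t \<in> I3" "i \<in> I3" for t i
    proof -
      have "card (C t \<inter> V i) \<le> card (L t \<inter> V i \<union> R)" using finL[OF that(1)] finR by (intro card_mono) (auto simp: C_def)
      also have "\<dots> \<le> card (L t \<inter> V i) + card R" by (rule card_Un_le)
      finally show ?thesis using like_setD(4)[OF L[OF that(1)] that(2)] cRw by linarith
    qed
    show "\<exists>T. is_triangle E T \<and> v \<in> T \<and> T \<inter> Z = {} \<and> (\<forall>t\<in>I3. card (T \<inter> C t) = 1)"
      if v: "v \<in> R" and Z: "finite Z" "card Z \<le> 3 * K" "v \<notin> Z" for v Z
    proof -
      have r: "f v \<in> I3" by (rule f(1)[OF v])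
      obtain s t where st: "s \<in> I3" "t \<in> I3" "s \<noteq> f v" "t \<noteq> f v" "s \<noteq> t" "I3 = {f v, s, t}"
        by (rule I3_others[OF r])
      have vL: "v \<in> vtx" "v \<notin> L s" "v \<notin> L t" using v RL[OF st(1)] RL[OF st(2)] unfolding R_def by blast+
      have "real (card Z) \<le> a / 4" using Z(2) K aw by linarith
      then obtain x y where xy: "x \<in> L s - Z" "y \<in> L t - Z" "E v x" "E v y" "E x y"
        using two_like_sets_triangle[OF L[OF st(1)] L[OF st(2)] dis[OF st(1,2,5)] vL Z(1)] aw by auto
      have "\<forall>q\<in>I3. card ({v, x, y} \<inter> C q) = 1"
        by (rule one_of_each_type[OF st(6) dC[OF r st(1) st(3)[symmetric]] dC[OF r st(2) st(4)[symmetric]] dC[OF st(1,2,5)]])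
          (use v xy in \<open>auto simp: C_def\<close>)
      thus ?thesis using triangleI[OF xy(3,5,4)] xy Z(3) by (intro exI[of _ "{v, x, y}"]) auto
    qed
    show "finite (M t) \<and> card (M t) = card (C t) - 3 * h \<and> disjoint (M t)" if "t \<in> I3" for t by (rule M[OF that])
    show "\<exists>u\<in>C t - R. \<exists>v\<in>C t - R. T = {u, v} \<and> E u v" if "t \<in> I3" "T \<in> M t" for t T
      unfolding CR[OF that(1)] by (rule bspec[OF M'[OF that(1)] that(2)])
    show "card R + (\<Sum>t\<in>I3. card (M t)) \<le> K" by (simp add: K_def)
    show "100 * (2 * a) \<le> real h" "100 * (10 * w) \<le> real h" "100 * real K \<le> real h" using aw K by linarith+
  qed (rule h)
qed

lemma I3_mem: "(1::nat) \<in> I3" "(2::nat) \<in> I3" "(3::nat) \<in> I3" by (auto simp: I3_def)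

lemma I3_cases: "t \<in> I3 \<Longrightarrow> (t = 1 \<Longrightarrow> Q) \<Longrightarrow> (t = 2 \<Longrightarrow> Q) \<Longrightarrow> (t = 3 \<Longrightarrow> Q) \<Longrightarrow> Q"
  unfolding I3_def by blast

text \<open>The third type \<open>S\<close> is a mere complement without structure of its own. Its
  surplus edges come from the density hypothesis, and its vertices that are badly joined to
  \<open>L\<close> or \<open>L'\<close> form the exceptional set \<open>W\<close>.\<close>

lemma packing_of_two_like_sets:
  assumes L: "like_set a w L P" and L': "like_set a w L' P'" and dis: "L \<inter> L' = {}"
    and aw: "1000 * w \<le> a" "0 < w" "1000 * a \<le> real h"
    and S: "S = vtx - L - L'" and ij: "i \<in> I3" "j \<in> I3"
    and dense: "(\<Sum>v\<in>S \<inter> V i. nb v (S \<inter> V j)) > 200 * real h * w"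
  shows "triangle_packing vtx (3 * h)"
proof -
  have "0 < real h" using aw by linarith
  hence h: "0 < h" by simp
  have Lv: "L \<subseteq> vtx" "L' \<subseteq> vtx" "S \<subseteq> vtx" using like_setD(1)[OF L] like_setD(1)[OF L'] S by auto
  have finL: "finite L" "finite L'" "finite S" using Lv fin_vtx finite_subset by blast+
  have dS: "L \<inter> S = {}" "L' \<inter> S = {}" using S by auto
  define W where "W = {v\<in>S. \<exists>i\<in>I3. v \<in> V i \<and> (\<exists>j\<in>I3. j \<noteq> i \<and> (nn v (L \<inter> V j) > 2 * a \<or> nn v (L' \<inter> V j) > 2 * a))}"
  have WS: "W \<subseteq> S" by (auto simp: W_def)
  have finW: "finite W" using WS finL(3) finite_subset by blast
  have Wi: "real (card (W \<inter> V i)) \<le> 4 * w" if i: "i \<in> I3" for i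
  proof -
    let ?T = "{v\<in>V i - L. \<exists>j\<in>I3. j \<noteq> i \<and> nn v (L \<inter> V j) > 2 * a}"
    let ?T' = "{v\<in>V i - L'. \<exists>j\<in>I3. j \<noteq> i \<and> nn v (L' \<inter> V j) > 2 * a}"
    have "W \<inter> V i \<subseteq> ?T \<union> ?T'"
    proof
      fix v assume v: "v \<in> W \<inter> V i"
      then obtain i' j where ij: "i' \<in> I3" "v \<in> V i'" "j \<in> I3" "j \<noteq> i'" "nn v (L \<inter> V j) > 2 * a \<or> nn v (L' \<inter> V j) > 2 * a"
        unfolding W_def by blast
      have "i' = i" using class_unique[OF ij(1) i ij(2)] v by blast
      moreover have "v \<notin> L" "v \<notin> L'" using v WS S by auto
      ultimately show "v \<in> ?T \<union> ?T'" using ij v by blast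
    qed
    hence "card (W \<inter> V i) \<le> card (?T \<union> ?T')" using fin[OF i] by (intro card_mono) auto
    also have "\<dots> \<le> card ?T + card ?T'" by (rule card_Un_le)
    finally show ?thesis using like_setD(10)[OF L i] like_setD(10)[OF L' i] by linarith
  qed
  have cW: "real (card W) \<le> 12 * w"
    using card_vtx_split[of 1 2 3 W] WS Lv(3) Wi[OF I3_mem(1)] Wi[OF I3_mem(2)] Wi[OF I3_mem(3)] by (simp add: I3_def)
  have Si: "real (card (S \<inter> V i)) = 3 * real h - real (card (L \<inter> V i)) - real (card (L' \<inter> V i))" if i: "i \<in> I3" for i
  proof -
    have "S \<inter> V i = V i - (L \<inter> V i \<union> L' \<inter> V i)" using vtx_Int_class[OF i] S by blast
    moreover have "card (V i - (L \<inter> V i \<union> L' \<inter> V i)) = card (V i) - card (L \<inter> V i \<union> L' \<inter> V i)"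
      using i by (intro card_Diff_subset) auto
    moreover have "card (L \<inter> V i \<union> L' \<inter> V i) = card (L \<inter> V i) + card (L' \<inter> V i)"
      using i dis by (intro card_Un_disjoint) auto
    moreover have "card (L \<inter> V i \<union> L' \<inter> V i) \<le> card (V i)" using fin[OF i] by (intro card_mono) auto
    ultimately have "card (S \<inter> V i) + (card (L \<inter> V i) + card (L' \<inter> V i)) = 3 * h"
      using card_V[OF i] by simp
    thus ?thesis by linarith
  qed
  have cS: "real (card S) \<le> 3 * real h + 6 * w"
  proof -
    have "real (card S) = real (card (S \<inter> V 1)) + real (card (S \<inter> V 2)) + real (card (S \<inter> V 3))"
      using card_vtx_split[of 1 2 3 S] Lv(3) by (simp add: I3_def)
    thus ?thesis
    using Si[OF I3_mem(1)] Si[OF I3_mem(2)] Si[OF I3_mem(3)]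
      like_setD(3)[OF L I3_mem(1)] like_setD(3)[OF L I3_mem(2)] like_setD(3)[OF L I3_mem(3)]
      like_setD(3)[OF L' I3_mem(1)] like_setD(3)[OF L' I3_mem(2)] like_setD(3)[OF L' I3_mem(3)] by linarith
  qed
  have num: "100 * a \<le> h" "100 * w \<le> h" using aw by linarith+
  obtain M1 where M1: "finite M1" "card M1 = card L - 3 * h" "disjoint M1" "\<forall>T\<in>M1. \<exists>u\<in>L. \<exists>v\<in>L. T = {u, v} \<and> E u v"
    using like_set_matching[OF L num h] by (elim exE conjE)
  obtain M2 where M2: "finite M2" "card M2 = card L' - 3 * h" "disjoint M2" "\<forall>T\<in>M2. \<exists>u\<in>L'. \<exists>v\<in>L'. T = {u, v} \<and> E u v"
    using like_set_matching[OF L' num h] by (elim exE conjE)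
  have excess: "real (x - 3 * h) \<le> b" if "real x \<le> 3 * real h + b" "0 \<le> b" for x b
    using that by (cases "3 * h \<le> x") (auto simp: of_nat_diff)
  have cM: "real (card L - 3 * h) \<le> 3 * w" "real (card L' - 3 * h) \<le> 3 * w" "real (card S - 3 * h) \<le> 6 * w"
    using excess like_set_card(2)[OF L] like_set_card(2)[OF L'] cS aw by auto
  have "\<exists>M. finite M \<and> card M = card S - 3 * h \<and> disjoint M \<and> (\<forall>T\<in>M. \<exists>u\<in>S - W. \<exists>v\<in>S - W. T = {u, v} \<and> E u v)"
  proof (rule disjoint_edges)
    fix Z :: "'a set" assume Z: "finite Z" "card Z \<le> 3 * (card S - 3 * h)"
    have "card (Z \<union> W) \<le> card Z + card W" by (rule card_Un_le)
    \<comment> \<open>At most \<open>18 * w\<close> come from \<open>Z\<close>, since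
      \<open>S\<close> has excess at most \<open>6 * w\<close>, and \<open>12 * w\<close> from
      \<open>W\<close>. Thus at most \<open>180 * h * w\<close> pairs are lost, out of more than
      \<open>200 * h * w\<close>.\<close>
    hence "real (card (Z \<union> W)) \<le> 30 * w" using Z(2) cM(3) cW by linarith
    hence "6 * real h * real (card (Z \<union> W)) \<le> 6 * real h * (30 * w)" by (intro mult_left_mono) auto
    also have "\<dots> < 200 * real h * w" using h aw by simp
    finally have "6 * real h * real (card (Z \<union> W)) < (\<Sum>v\<in>S \<inter> V i. nb v (S \<inter> V j))" using dense by linarith
    from edge_in_dense_pair[OF ij _ this] show "\<exists>u\<in>S - W - Z. \<exists>v\<in>S - W - Z. E u v"
      using Z(1) finW by blast
  qed
  then obtain M3 where M3: "finite M3" "card M3 = card S - 3 * h" "disjoint M3" "\<forall>T\<in>M3. \<exists>u\<in>S - W. \<exists>v\<in>S - W. T = {u, v} \<and> E u v"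
    by (elim exE conjE)
  define C where "C t = (if t = 1 then L else if t = 2 then L' else S)" for t :: nat
  define M where "M t = (if t = 1 then M1 else if t = 2 then M2 else M3)" for t :: nat
  have C [simp]: "C 1 = L" "C (Suc 0) = L" "C 2 = L'" "C 3 = S" by (simp_all add: C_def)
  have Msimp [simp]: "M 1 = M1" "M (Suc 0) = M1" "M 2 = M2" "M 3 = M3" by (simp_all add: M_def)
  have LW: "L - W = L" "L' - W = L'" using WS dS by auto
  define K where "K = card W + (\<Sum>t\<in>I3. card (M t))"
  have K: "real K \<le> 24 * w" using cW cM M1(2) M2(2) M3(2) unfolding K_def I3_def by simp
  have dC: "C s \<inter> C t = {}" if "s \<in> I3" "t \<in> I3" "s \<noteq> t" for s t
    using that dis dS by (elim I3_cases) (auto simp del: One_nat_def)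
  have S_ac: "acomp (2 * a) Q (S - W)" if "like_set a w Q P" "Q \<inter> S = {}" "\<And>v j i. v \<in> S - W \<Longrightarrow> v \<in> V i \<Longrightarrow> i \<in> I3 \<Longrightarrow> j \<in> I3 \<Longrightarrow> i \<noteq> j \<Longrightarrow> nn v (Q \<inter> V j) \<le> 2 * a"
    for Q P
    unfolding acomp_def
  proof (intro ballI impI conjI)
    fix i j v assume ij: "i \<in> I3" "j \<in> I3" "i \<noteq> j" and v: "v \<in> Q \<inter> V i"
    show "nn v ((S - W) \<inter> V j) \<le> 2 * a"
      by (rule order_trans[OF nonnbrs_mono like_setD(5)[OF that(1) ij, of v]]) (use that(2) ij v in auto)
  next
    fix i j v assume ij: "i \<in> I3" "j \<in> I3" "i \<noteq> j" and v: "v \<in> (S - W) \<inter> V i"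
    show "nn v (Q \<inter> V j) \<le> 2 * a" using that(3)[of v i j] ij v by blast
  qed
  have notW: "nn v (L \<inter> V j) \<le> 2 * a" "nn v (L' \<inter> V j) \<le> 2 * a"
    if "v \<in> S - W" "v \<in> V i" "i \<in> I3" "j \<in> I3" "i \<noteq> j" for v i j
    using that unfolding W_def by (auto simp: not_less)
  have ac1: "acomp (2 * a) L (S - W)" by (rule S_ac[OF L dS(1)]) (rule notW(1))
  have ac2: "acomp (2 * a) L' (S - W)" by (rule S_ac[OF L' dS(2)]) (rule notW(2))
  have ac3: "acomp (2 * a) L L'" by (rule like_sets_acomp[OF L L' dis])
  show ?thesis
  proof (rule three_types[of C W "2 * a" "20 * w" K M])
    show "(\<Union>t\<in>I3. C t) = vtx" using Lv S unfolding I3_def by auto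
    show "C s \<inter> C t = {}" if "s \<in> I3" "t \<in> I3" "s \<noteq> t" for s t by (rule dC[OF that])
    show "W \<subseteq> vtx" using WS Lv by blast
    show "acomp (2 * a) (C s - W) (C t - W)" if "s \<in> I3" "t \<in> I3" "s \<noteq> t" for s t
      using that ac1 ac2 ac3 acomp_sym by (elim I3_cases) (auto simp: LW simp del: One_nat_def)
    show "real h - 20 * w \<le> real (card ((C t - W) \<inter> V i))" if ti: "t \<in> I3" "i \<in> I3" for t i
    proof -
      have "real (card (S \<inter> V i)) \<le> real (card ((S - W) \<inter> V i)) + real (card (S \<inter> V i - (S - W) \<inter> V i))"
        by (rule card_le_plus_Diff) (use ti in auto)
      moreover have "card (S \<inter> V i - (S - W) \<inter> V i) \<le> card (W \<inter> V i)" using ti by (intro card_mono) auto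
      ultimately have "real h - 20 * w \<le> real (card ((S - W) \<inter> V i))"
        using Si[OF ti(2)] Wi[OF ti(2)] like_setD(4)[OF L ti(2)] like_setD(4)[OF L' ti(2)] aw by linarith
      thus ?thesis using ti(1) like_setD(3)[OF L ti(2)] like_setD(3)[OF L' ti(2)] aw(2)
        by (elim I3_cases) (auto simp: LW simp del: One_nat_def)
    qed
    show "real (card (C t \<inter> V i)) \<le> real h + 20 * w" if ti: "t \<in> I3" "i \<in> I3" for t i
      using ti(1) Si[OF ti(2)] like_setD(3,4)[OF L ti(2)] like_setD(3,4)[OF L' ti(2)] aw(2)
      by (elim I3_cases) (auto simp del: One_nat_def)
    show "\<exists>T. is_triangle E T \<and> v \<in> T \<and> T \<inter> Z = {} \<and> (\<forall>t\<in>I3. card (T \<inter> C t) = 1)"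
      if v: "v \<in> W" and Z: "finite Z" "card Z \<le> 3 * K" "v \<notin> Z" for v Z
    proof -
      have vL: "v \<in> vtx" "v \<notin> L" "v \<notin> L'" "v \<in> S" using v WS S by auto
      have "real (card Z) \<le> a / 4" using Z(2) K aw by linarith
      then obtain x y where xy: "x \<in> L - Z" "y \<in> L' - Z" "E v x" "E v y" "E x y"
        using two_like_sets_triangle[OF L L' dis vL(1-3) Z(1)] aw by auto
      have "\<forall>q\<in>I3. card ({v, x, y} \<inter> C q) = 1"
        by (rule one_of_each_type[of 3 1 2]) (use vL xy dis dS in \<open>auto simp: I3_def\<close>)
      thus ?thesis using triangleI[OF xy(3,5,4)] xy Z(3) by (intro exI[of _ "{v, x, y}"]) auto
    qed
    show "finite (M t) \<and> card (M t) = card (C t) - 3 * h \<and> disjoint (M t)" if "t \<in> I3" for t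
      using that M1 M2 M3 by (elim I3_cases) (simp_all del: One_nat_def)
    show "\<exists>u\<in>C t - W. \<exists>v\<in>C t - W. T = {u, v} \<and> E u v" if "t \<in> I3" "T \<in> M t" for t T
      using that M1(4) M2(4) M3(4) by (elim I3_cases) (simp_all add: LW del: One_nat_def)
    show "card W + (\<Sum>t\<in>I3. card (M t)) \<le> K" by (simp add: K_def)
    show "100 * (2 * a) \<le> real h" "100 * (20 * w) \<le> real h" "100 * real K \<le> real h" using aw K by linarith+
  qed (rule h)
qed

text \<open>The complement \<open>S\<close> of the two like sets either has a pair of classes with
  enough edges for its surplus, or is itself close to a sparse triple. In the second case the new
  triple is sparse only at the coarser level \<open>w'\<close>, at which all three like sets are
  then built.\<close>

lemma packing_of_second_triple:
  assumes A: "sparse_triple (a * w / 8) A" and B: "sparse_triple (a * w / 8) B"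
    and AB: "\<And>i. i \<in> I3 \<Longrightarrow> 2 * card (A i \<inter> B i) \<le> h"
    and aw: "1000 * w' \<le> a" "0 < w" "w \<le> w'" "1000 * a \<le> real h" and ww: "210 * real h * w \<le> a * w' / 8"
  shows "triangle_packing vtx (3 * h)"
proof -
  have "0 < real h" using aw by linarith
  hence h: "0 < h" by simp
  define L where "L = likes A a"
  define L' where "L' = likes B a"
  have num: "8 * w \<le> a" "8 * a \<le> real h" "8 * w' \<le> a" "0 < w'" "1000 * w \<le> a" using aw by linarith+
  obtain P where P: "like_set a w L P" and AL: "\<And>i. i \<in> I3 \<Longrightarrow> real (card (A i - L)) \<le> w"
    unfolding L_def using sparse_triple_like_set[OF A aw(2) num(1,2)] by metis
  obtain P' where P': "like_set a w L' P'" and BL: "\<And>i. i \<in> I3 \<Longrightarrow> real (card (B i - L')) \<le> w"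
    unfolding L'_def using sparse_triple_like_set[OF B aw(2) num(1,2)] by metis
  have dis: "L \<inter> L' = {}" unfolding L_def L'_def by (rule likes_disjoint[OF A B num(2) h AB])
  define S where "S = vtx - L - L'"
  show ?thesis
  proof (cases "\<exists>i\<in>I3. \<exists>j\<in>I3. (\<Sum>v\<in>S \<inter> V i. nb v (S \<inter> V j)) > 200 * real h * w")
    case True
    then show ?thesis using packing_of_two_like_sets[OF P P' dis num(5) aw(2,4) S_def] by blast
  next
    case False
    have Si: "real h - 2 * w \<le> real (card (S \<inter> V i))" if i: "i \<in> I3" for i
    proof -
      have "real (card (V i)) \<le> real (card (S \<inter> V i)) + real (card (V i - S \<inter> V i))"
        using fin[OF i] by (intro card_le_plus_Diff) auto
      moreover have "card (V i - S \<inter> V i) \<le> card (L \<inter> V i \<union> L' \<inter> V i)"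
        using i vtx_Int_class[OF i] by (intro card_mono) (auto simp: S_def)
      moreover have "\<dots> \<le> card (L \<inter> V i) + card (L' \<inter> V i)" by (rule card_Un_le)
      ultimately show ?thesis
        using card_V[OF i] like_setD(4)[OF P i] like_setD(4)[OF P' i] by linarith
    qed
    \<comment> \<open>Each part of \<open>S\<close> has at least \<open>h - 2 * w\<close> vertices;
      the adjustment adds \<open>4 * h * w\<close> pairs to the \<open>200 * h * w\<close>, which
      the factor 210 in the hypothesis covers.\<close>
    have "\<exists>I'. sparse_triple (200 * real h * w + 2 * (2 * w) * real h) I' \<and> (\<forall>i\<in>I3. real (card (I' i - S \<inter> V i)) \<le> 2 * w)"
      by (rule sparse_triple_adjust) (use False Si aw in \<open>auto simp: not_less\<close>)
    then obtain D where D: "sparse_triple (200 * real h * w + 2 * (2 * w) * real h) D"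
      and DS: "\<And>i. i \<in> I3 \<Longrightarrow> real (card (D i - S \<inter> V i)) \<le> 2 * w" by blast
    have D': "sparse_triple (a * w' / 8) D"
    proof (rule sparse_triple_mono[OF D])
      have "200 * real h * w + 2 * (2 * w) * real h = 204 * (real h * w)" by simp
      also have "\<dots> \<le> 210 * (real h * w)" using aw by simp
      also have "\<dots> = 210 * real h * w" by simp
      also note ww
      finally show "200 * real h * w + 2 * (2 * w) * real h \<le> a * w' / 8" .
    qed
    have le: "a * w / 8 \<le> a * w' / 8" using num aw by (simp add: mult_left_mono)
    note A' = sparse_triple_mono[OF A le] and B' = sparse_triple_mono[OF B le]
    \<comment> \<open>\<open>Q\<close> lies in \<open>X\<close> up to \<open>w\<close> vertices and
      \<open>D\<close> lies in \<open>S\<close> up to \<open>2 * w\<close> vertices per class, while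
      \<open>S\<close> and \<open>X\<close> are disjoint.\<close>
    have small: "2 * card (Q i \<inter> D i) \<le> h"
      if Q: "sparse_triple (a * w / 8) Q" "real (card (Q i - X)) \<le> w" "S \<inter> X = {}" "i \<in> I3" for Q X i
    proof -
      note fQ = sparse_tripleD(3)[OF Q(1,4)] sparse_tripleD(3)[OF D Q(4)]
      have "card (Q i \<inter> D i) \<le> card ((Q i - X) \<union> (D i - S \<inter> V i))"
        using Q(3) fQ by (intro card_mono) auto
      also have "\<dots> \<le> card (Q i - X) + card (D i - S \<inter> V i)" by (rule card_Un_le)
      finally have "real (card (Q i \<inter> D i)) \<le> 3 * w" using Q(2) DS[OF Q(4)] by linarith
      thus ?thesis using num aw by linarith
    qed
    have AD: "2 * card (A i \<inter> D i) \<le> h" if "i \<in> I3" for i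
      by (rule small[OF A AL[OF that] _ that]) (auto simp: S_def)
    have BD: "2 * card (B i \<inter> D i) \<le> h" if "i \<in> I3" for i
      by (rule small[OF B BL[OF that] _ that]) (auto simp: S_def)
    define T where "T t = (if t = 1 then A else if t = 2 then B else D)" for t :: nat
    have T [simp]: "T 1 = A" "T (Suc 0) = A" "T 2 = B" "T 3 = D" by (simp_all add: T_def)
    have "\<exists>P. like_set a w' (likes (T t) a) P" if "t \<in> I3" for t
    proof -
      have "sparse_triple (a * w' / 8) (T t)" using that A' B' D' by (elim I3_cases) (simp_all del: One_nat_def)
      from sparse_triple_like_set[OF this num(4,3,2)] show ?thesis by metis
    qed
    then obtain P3 where P3: "\<And>t. t \<in> I3 \<Longrightarrow> like_set a w' (likes (T t) a) (P3 t)" by metis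
    have d: "likes A a \<inter> likes B a = {}" "likes A a \<inter> likes D a = {}" "likes B a \<inter> likes D a = {}"
      using likes_disjoint[OF A B num(2) h AB] likes_disjoint[OF A D num(2) h AD] likes_disjoint[OF B D num(2) h BD] by auto
    show ?thesis
    proof (rule packing_of_three_like_sets[where L = "\<lambda>t. likes (T t) a", OF P3 _ aw(1) num(4) aw(4)])
      show "likes (T s) a \<inter> likes (T t) a = {}" if "s \<in> I3" "t \<in> I3" "s \<noteq> t" for s t
        using that d by (elim I3_cases) (auto simp del: One_nat_def)
    qed
  qed
qed

end

section \<open>The graph outside a sparse triple\<close>

lemma card_disjoint_subsets_le:
  assumes "finite H" "A \<subseteq> H" "B \<subseteq> H" "A \<inter> B = {}"
  shows "real (card A) + real (card B) \<le> real (card H)"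
proof -
  have "card A + card B = card (A \<union> B)"
    using assms finite_subset by (intro card_Un_disjoint[symmetric]) blast+
  also have "\<dots> \<le> card H" using assms by (intro card_mono) auto
  finally show ?thesis by (simp flip: of_nat_add)
qed

lemma overlap_of_large_subsets:
  assumes "finite H" "A \<subseteq> H" "B \<subseteq> H" "real (card A) + real (card B) > real (card H)"
  shows "A \<inter> B \<noteq> {}"
  using card_disjoint_subsets_le[OF assms(1-3)] assms(4) by auto

lemma nbrs_Diff: "finite S \<Longrightarrow> R \<subseteq> S \<Longrightarrow> nbrs E v S = nbrs E v (S - R) + nbrs E v R"
  using nbrs_Un[of "S - R" R E v] finite_subset[of R S] by (auto simp: Un_absorb2)

lemma real_card_Diff: "finite S \<Longrightarrow> R \<subseteq> S \<Longrightarrow> real (card (S - R)) = real (card S) - real (card R)"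
  using card_Diff_subset[of R S] card_mono[of S R] finite_subset[of R S] by (auto simp: of_nat_diff)

context tripartite
begin

text \<open>Models what remains outside a completed triple: about \<open>2 * h\<close> vertices in
  each class, with every vertex adjacent to nearly half or more of each other class.\<close>

definition half_graph :: "real \<Rightarrow> 'a set \<Rightarrow> bool" where
  "half_graph d H \<longleftrightarrow> H \<subseteq> vtx \<and>
    (\<forall>i\<in>I3. 2 * real h - d \<le> real (card (H \<inter> V i)) \<and> real (card (H \<inter> V i)) \<le> 2 * real h + d) \<and>
    (\<forall>i\<in>I3. \<forall>j\<in>I3. i \<noteq> j \<longrightarrow> (\<forall>v\<in>H \<inter> V i. nb v (H \<inter> V j) \<ge> real h - d))"

lemma half_graphD:
  assumes "half_graph d H"
  shows "H \<subseteq> vtx"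
    and "i \<in> I3 \<Longrightarrow> 2 * real h - d \<le> real (card (H \<inter> V i))"
    and "i \<in> I3 \<Longrightarrow> real (card (H \<inter> V i)) \<le> 2 * real h + d"
    and "i \<in> I3 \<Longrightarrow> j \<in> I3 \<Longrightarrow> i \<noteq> j \<Longrightarrow> v \<in> H \<Longrightarrow> v \<in> V i \<Longrightarrow> nb v (H \<inter> V j) \<ge> real h - d"
  using assms unfolding half_graph_def by blast+

lemma nb_le_of_common_free:
  assumes "finite S" "\<And>u. u \<in> S \<Longrightarrow> \<not> (E v u \<and> E v' u)"
  shows "nb v S \<le> real (card S) - nb v' S"
  using card_disjoint_subsets_le[OF assms(1), of "{u\<in>S. E v u}" "{u\<in>S. E v' u}"] assms(2)
  unfolding nbrs_def by fastforce

text \<open>Adjacent vertices have disjoint neighbourhoods in the third class; each fills about half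
  of it, so they are nearly complementary. The triple consists of the neighbourhoods
  \<open>P\<close> and \<open>Q\<close> of a vertex \<open>x\<close>, which have no edges between
  them, and of the complement \<open>Rc\<close> of the neighbourhood of some \<open>p\<close> in
  \<open>P\<close>.\<close>

lemma sparse_triple_in_triangle_free:
  assumes H: "half_graph d H" and d: "100 * d \<le> real h" "0 < d"
    and free: "\<And>u v w. u \<in> H \<Longrightarrow> v \<in> H \<Longrightarrow> w \<in> H \<Longrightarrow> E u v \<Longrightarrow> E v w \<Longrightarrow> E u w \<Longrightarrow> False"
  shows "\<exists>I. \<forall>i\<in>I3. I i \<subseteq> H \<inter> V i \<and> real h - 3 * d \<le> real (card (I i)) \<and>
      (\<forall>j\<in>I3. i \<noteq> j \<longrightarrow> (\<Sum>v\<in>I i. nb v (I j)) \<le> 8 * d * real h)"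
proof -
  define H1 where "H1 = H \<inter> V 1"
  define H2 where "H2 = H \<inter> V 2"
  define H3 where "H3 = H \<inter> V 3"
  note HD = H1_def H2_def H3_def
  have finH: "finite H1" "finite H2" "finite H3" using I3_mem by (auto simp: HD)
  have up: "real (card H1) \<le> 2 * h + d" "real (card H2) \<le> 2 * h + d" "real (card H3) \<le> 2 * h + d"
    and lo: "real (card H1) \<ge> 2 * h - d"
    using half_graphD(2,3)[OF H] I3_mem by (auto simp: HD)
  have deg12: "nb v H2 \<ge> h - d" if "v \<in> H1" for v using half_graphD(4)[OF H I3_mem(1,2)] that by (auto simp: HD)
  have deg13: "nb v H3 \<ge> h - d" if "v \<in> H1" for v using half_graphD(4)[OF H I3_mem(1,3)] that by (auto simp: HD)
  have deg21: "nb v H1 \<ge> h - d" if "v \<in> H2" for v using half_graphD(4)[OF H I3_mem(2,1)] that by (auto simp: HD)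
  have deg23: "nb v H3 \<ge> h - d" if "v \<in> H2" for v using half_graphD(4)[OF H I3_mem(2,3)] that by (auto simp: HD)
  have deg31: "nb v H1 \<ge> h - d" if "v \<in> H3" for v using half_graphD(4)[OF H I3_mem(3,1)] that by (auto simp: HD)
  have deg32: "nb v H2 \<ge> h - d" if "v \<in> H3" for v using half_graphD(4)[OF H I3_mem(3,2)] that by (auto simp: HD)
  have HH: "v \<in> H" if "v \<in> H1 \<or> v \<in> H2 \<or> v \<in> H3" for v using that by (auto simp: HD)
  have avoid: "nb v S + real (card T) \<le> real (card S)" if "finite S" "T \<subseteq> S" "\<And>u. u \<in> T \<Longrightarrow> \<not> E v u" for v S T
    using card_disjoint_subsets_le[OF that(1), of "{u\<in>S. E v u}" T] that(2,3) by (auto simp: nbrs_def)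
  have meet: "\<exists>u\<in>T. E v u" if "finite S" "T \<subseteq> S" "nb v S + real (card T) > real (card S)" for v S T
    using avoid[OF that(1,2), of v] that(3) by force
  have "card H1 \<noteq> 0" using lo d by linarith
  then obtain x where x: "x \<in> H1" using finH(1) by fastforce
  define P where "P = {u\<in>H2. E x u}"
  define Q where "Q = {u\<in>H3. E x u}"
  have PQ: "\<not> E p q" if "p \<in> P" "q \<in> Q" for p q
    using free[of x p q] HH x that unfolding P_def Q_def by blast
  have cP: "real (card P) \<ge> h - d" and cQ: "real (card Q) \<ge> h - d"
    using deg12[OF x] deg13[OF x] by (simp_all add: P_def Q_def nbrs_def)
  have sub: "P \<subseteq> H2" "Q \<subseteq> H3" by (auto simp: P_def Q_def)
  have "card P \<noteq> 0" "card Q \<noteq> 0" using cP cQ d by linarith+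
  then obtain p q where p: "p \<in> P" and q: "q \<in> Q" using sub finH finite_subset by fastforce
  have cP2: "real (card P) \<le> h + 2 * d"
    using avoid[OF finH(2) sub(1), of q] deg32[of q] q sub up(2) PQ sym by fastforce
  have cQ2: "real (card Q) \<le> h + 2 * d"
    using avoid[OF finH(3) sub(2), of p] deg23[of p] p sub up(3) PQ by fastforce
  define R where "R = {u\<in>H1. E p u}"
  define Q' where "Q' = {u\<in>H3. E p u}"
  have sub': "R \<subseteq> H1" "Q' \<subseteq> H3" by (auto simp: R_def Q'_def)
  have RQ': "\<not> E r q'" if "r \<in> R" "q' \<in> Q'" for r q'
    using free[of p r q'] HH[of p] HH[of r] HH[of q'] p sub that unfolding R_def Q'_def by blast
  have cR: "real (card R) \<ge> h - d" and cQ': "real (card Q') \<ge> h - d"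
    using deg21[of p] deg23[of p] p sub by (auto simp: R_def Q'_def nbrs_def)
  have QQ': "Q' \<inter> Q = {}" using PQ[OF p] unfolding Q'_def by blast
  have "card Q' \<noteq> 0" using cQ' d by linarith
  then obtain q' where q': "q' \<in> Q'" using sub' finH finite_subset by fastforce
  have cR2: "real (card R) \<le> h + 2 * d"
    using avoid[OF finH(1) sub'(1), of q'] deg31[of q'] q' sub' up(1) RQ' sym by fastforce
  define Rc where "Rc = H1 - R"
  define Pc where "Pc = H2 - P"
  have finc: "finite Rc" "finite Pc" "finite R" "finite P" "finite Q"
    using finH sub sub' finite_subset by (auto simp: Rc_def Pc_def)
  have cRc: "real (card Rc) = real (card H1) - real (card R)"
    unfolding Rc_def by (rule real_card_Diff[OF finH(1) sub'(1)])
  have cPc: "real (card Pc) = real (card H2) - real (card P)"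
    unfolding Pc_def by (rule real_card_Diff[OF finH(2) sub(1)])
  have nbRc: "nb v H1 \<le> nb v Rc + nb v R" for v
    using nbrs_Diff[OF finH(1) sub'(1), of E v] by (simp add: Rc_def)
  have nbPc: "nb v H2 \<le> nb v Pc + nb v P" for v
    using nbrs_Diff[OF finH(2) sub(1), of E v] by (simp add: Pc_def)
  have none: "nb v S = 0" if "\<And>u. u \<in> S \<Longrightarrow> \<not> E v u" for v S
  proof -
    have "{u\<in>S. E v u} = {}" using that by blast
    thus ?thesis by (simp only: nbrs_def card.empty of_nat_0)
  qed
  \<comment> \<open>As \<open>v\<close> has no neighbour in \<open>Q\<close>, it has a neighbour
    \<open>u\<close> in \<open>Q'\<close>, which nearly fills the rest of its class. In turn
    \<open>u\<close> avoids \<open>R\<close>, so its neighbours nearly fill \<open>Rc\<close>, and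
    \<open>v\<close> can share none of them.\<close>
  have P3: "nb v Rc \<le> 3 * d" if v: "v \<in> P" for v
  proof -
    have vH: "v \<in> H2" using v sub by blast
    have "nb v (H3 - Q) \<ge> h - d"
    proof -
      have "nb v H3 = nb v (H3 - Q) + nb v Q" by (rule nbrs_Diff[OF finH(3) sub(2)])
      moreover have "nb v Q = 0" by (rule none) (rule PQ[OF v])
      ultimately show ?thesis using deg23[OF vH] by linarith
    qed
    moreover have "real (card (H3 - Q)) = real (card H3) - real (card Q)"
      by (rule real_card_Diff[OF finH(3) sub(2)])
    ultimately have "\<exists>u\<in>Q'. E v u"
      using cQ cQ' up d sub' QQ' finH by (intro meet[of "H3 - Q"]) auto
    then obtain u where u: "u \<in> Q'" "E v u" by blast
    have uH: "u \<in> H3" using u sub' by blast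
    have "nb u R = 0" by (rule none) (use RQ' u sym in blast)
    hence "nb u Rc \<ge> h - d" using nbRc[of u] deg31[OF uH] by linarith
    moreover have "nb v Rc \<le> real (card Rc) - nb u Rc"
    proof (rule nb_le_of_common_free[OF finc(1)])
      fix y assume "y \<in> Rc"
      thus "\<not> (E v y \<and> E u y)" using free[of v u y] HH[of v] HH[of u] HH[of y] vH uH u(2) unfolding Rc_def by blast
    qed
    ultimately show ?thesis using cRc cR up by linarith
  qed
  have R3: "nb v Pc \<le> 3 * d" if v: "v \<in> R" for v
  proof -
    have vH: "v \<in> H1" using v sub' by blast
    have "nb v (H3 - Q') \<ge> h - d"
    proof -
      have "nb v H3 = nb v (H3 - Q') + nb v Q'" by (rule nbrs_Diff[OF finH(3) sub'(2)])
      moreover have "nb v Q' = 0" by (rule none) (rule RQ'[OF v])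
      ultimately show ?thesis using deg13[OF vH] by linarith
    qed
    moreover have "real (card (H3 - Q')) = real (card H3) - real (card Q')"
      by (rule real_card_Diff[OF finH(3) sub'(2)])
    ultimately have "\<exists>u\<in>Q. E v u"
      using cQ cQ' up d sub QQ' finH by (intro meet[of "H3 - Q'"]) auto
    then obtain u where u: "u \<in> Q" "E v u" by blast
    have uH: "u \<in> H3" using u sub by blast
    have "nb u P = 0" by (rule none) (use PQ u sym in blast)
    hence "nb u Pc \<ge> h - d" using nbPc[of u] deg32[OF uH] by linarith
    moreover have "nb v Pc \<le> real (card Pc) - nb u Pc"
    proof (rule nb_le_of_common_free[OF finc(2)])
      fix y assume "y \<in> Pc"
      thus "\<not> (E v y \<and> E u y)" using free[of v u y] HH[of v] HH[of u] HH[of y] vH uH u(2) unfolding Pc_def by blast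
    qed
    ultimately show ?thesis using cPc cP up by linarith
  qed
  \<comment> \<open>By \<open>R3\<close>, the vertices of \<open>Pc\<close> have few neighbours in
    \<open>R\<close> on average, so some neighbour \<open>y\<close> of \<open>v\<close> in
    \<open>Pc\<close> has at most \<open>4 * d\<close>. The neighbours of \<open>y\<close> then
    nearly fill \<open>Rc\<close>, and \<open>v\<close> can share none of them.\<close>
  have Q7: "nb v Rc \<le> 7 * d" if v: "v \<in> Q" for v
  proof -
    have vH: "v \<in> H3" using v sub by blast
    define Y where "Y = {u\<in>Pc. E v u}"
    have finY: "finite Y" using finc by (simp add: Y_def)
    have "nb v P = 0" by (rule none) (use PQ v sym in blast)
    hence cY: "real (card Y) \<ge> h - d" using nbPc[of v] deg32[OF vH] by (simp add: Y_def nbrs_def)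
    have "\<exists>y\<in>Y. nb y R \<le> 4 * d"
    proof (rule ccontr)
      assume "\<not> ?thesis"
      hence "(\<Sum>y\<in>Y. 4 * d) \<le> (\<Sum>y\<in>Y. nb y R)" by (intro sum_mono) (auto simp: not_le less_imp_le)
      also have "\<dots> \<le> (\<Sum>y\<in>Pc. nb y R)" using finc by (intro sum_mono2) (auto simp: Y_def)
      also have "\<dots> = (\<Sum>r\<in>R. nb r Pc)" by (rule sum_nbrs_swap[OF finc(2,3)]) (rule sym_iff)
      also have "\<dots> \<le> (\<Sum>r\<in>R. 3 * d)" by (rule sum_mono) (rule R3)
      finally have "real (card Y) * (4 * d) \<le> real (card R) * (3 * d)" by simp
      hence "4 * real (card Y) \<le> 3 * real (card R)" using d by simp
      thus False using cY cR2 d by linarith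
    qed
    then obtain y where y: "y \<in> Y" "nb y R \<le> 4 * d" by blast
    have yH: "y \<in> H2" "E v y" using y by (auto simp: Y_def Pc_def)
    have "nb y Rc \<ge> h - 5 * d" using nbRc[of y] deg21[OF yH(1)] y(2) by linarith
    moreover have "nb v Rc \<le> real (card Rc) - nb y Rc"
    proof (rule nb_le_of_common_free[OF finc(1)])
      fix u assume "u \<in> Rc"
      thus "\<not> (E v u \<and> E y u)" using free[of v y u] HH[of v] HH[of y] HH[of u] vH yH unfolding Rc_def by blast
    qed
    ultimately show ?thesis using cRc cR up by linarith
  qed
  \<comment> \<open>From \<open>100 * d \<le> h\<close> one gets
    \<open>7 * (h + 2 * d) \<le> 8 * h\<close>.\<close>
  have bound: "(\<Sum>v\<in>X. nb v Rc) \<le> 8 * d * real h" if "real (card X) \<le> h + 2 * d" "\<And>v. v \<in> X \<Longrightarrow> nb v Rc \<le> 7 * d" for X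
  proof -
    have "(\<Sum>v\<in>X. nb v Rc) \<le> (\<Sum>v\<in>X. 7 * d)" using that(2) by (rule sum_mono)
    also have "\<dots> = 7 * d * real (card X)" by simp
    also have "\<dots> \<le> 7 * d * (8 / 7 * real h)" using that(1) d by (intro mult_left_mono) auto
    finally show ?thesis by simp
  qed
  have PR: "(\<Sum>v\<in>P. nb v Rc) \<le> 8 * d * real h" by (rule bound[OF cP2]) (use P3 d in fastforce)
  have QR: "(\<Sum>v\<in>Q. nb v Rc) \<le> 8 * d * real h" by (rule bound[OF cQ2 Q7])
  have RP: "(\<Sum>v\<in>Rc. nb v P) \<le> 8 * d * real h" using PR sum_nbrs_swap[OF finc(1,4) sym_iff] by simp
  have RQ: "(\<Sum>v\<in>Rc. nb v Q) \<le> 8 * d * real h" using QR sum_nbrs_swap[OF finc(1,5) sym_iff] by simp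
  have "0 \<le> 8 * d * real h" using d by simp
  moreover have "(\<Sum>v\<in>P. nb v Q) = 0" using none PQ by (intro sum.neutral) blast
  moreover have "(\<Sum>v\<in>Q. nb v P) = 0" using none PQ sym by (intro sum.neutral) blast
  ultimately have PQs: "(\<Sum>v\<in>P. nb v Q) \<le> 8 * d * real h" "(\<Sum>v\<in>Q. nb v P) \<le> 8 * d * real h" by linarith+
  have sizes: "real h - 3 * d \<le> real (card Rc)" "real h - 3 * d \<le> real (card P)" "real h - 3 * d \<le> real (card Q)"
    using cRc lo cR2 cP cQ d by linarith+
  have incl: "Rc \<subseteq> H \<inter> V 1" "P \<subseteq> H \<inter> V 2" "Q \<subseteq> H \<inter> V 3" using sub by (auto simp: Rc_def HD)
  define I where "I t = (if t = 1 then Rc else if t = 2 then P else Q)" for t :: nat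
  have I [simp]: "I 1 = Rc" "I 2 = P" "I 3 = Q" by (simp_all add: I_def)
  have "\<forall>i\<in>I3. I i \<subseteq> H \<inter> V i \<and> real h - 3 * d \<le> real (card (I i)) \<and>
      (\<forall>j\<in>I3. i \<noteq> j \<longrightarrow> (\<Sum>v\<in>I i. nb v (I j)) \<le> 8 * d * real h)"
  proof (intro ballI conjI impI)
    fix i assume i: "i \<in> I3"
    show "I i \<subseteq> H \<inter> V i" using i by (rule I3_cases) (use incl in \<open>simp_all del: One_nat_def\<close>)
    show "real h - 3 * d \<le> real (card (I i))" using i by (rule I3_cases) (use sizes in \<open>simp_all del: One_nat_def\<close>)
    fix j assume j: "j \<in> I3" "i \<noteq> j"
    show "(\<Sum>v\<in>I i. nb v (I j)) \<le> 8 * d * real h"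
      using i j(1) j(2) PR QR RP RQ PQs by (elim I3_cases) (simp_all del: One_nat_def)
  qed
  thus ?thesis by blast
qed

section \<open>Perfect matchings in half graphs\<close>

lemma half_graph_Diff:
  assumes H: "half_graph d H" and Z: "\<And>i. i \<in> I3 \<Longrightarrow> real (card (Z \<inter> V i)) \<le> z" and z: "0 \<le> z"
  shows "half_graph (d + z) (H - Z)"
  unfolding half_graph_def
proof (intro conjI ballI impI)
  show "H - Z \<subseteq> vtx" using half_graphD(1)[OF H] by blast
  have sub: "(H - Z) \<inter> V i \<subseteq> H \<inter> V i" for i by blast
  have rest: "real (card (H \<inter> V i - (H - Z) \<inter> V i)) \<le> z" if i: "i \<in> I3" for i
  proof -
    have "card (H \<inter> V i - (H - Z) \<inter> V i) \<le> card (Z \<inter> V i)" using i by (intro card_mono) auto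
    thus ?thesis using Z[OF i] by linarith
  qed
  fix i assume i: "i \<in> I3"
  show "2 * real h - (d + z) \<le> real (card ((H - Z) \<inter> V i))"
    using half_graphD(2)[OF H i] rest[OF i] real_card_Diff[OF fin_Int[OF i] sub] by linarith
  have "card ((H - Z) \<inter> V i) \<le> card (H \<inter> V i)" using i by (intro card_mono) auto
  thus "real (card ((H - Z) \<inter> V i)) \<le> 2 * real h + (d + z)" using half_graphD(3)[OF H i] z by linarith
  fix j v assume j: "j \<in> I3" "i \<noteq> j" and v: "v \<in> (H - Z) \<inter> V i"
  have "nb v (H \<inter> V j) \<le> nb v ((H - Z) \<inter> V j) + real (card (H \<inter> V j - (H - Z) \<inter> V j))"
    using j by (intro nbrs_le_plus_card) auto
  thus "real h - (d + z) \<le> nb v ((H - Z) \<inter> V j)"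
    using half_graphD(4)[OF H i j, of v] v rest[OF j(1)] by auto
qed

lemma half_graph_side:
  assumes H: "half_graph d H" and CD: "C \<union> D = H" and no: "\<And>u v. u \<in> C \<Longrightarrow> v \<in> D \<Longrightarrow> \<not> E u v"
    and v: "v \<in> C" "v \<in> V i" and ij: "i \<in> I3" "j \<in> I3" "i \<noteq> j"
  shows "real h - d \<le> nb v (C \<inter> V j)"
proof -
  have sub: "{u\<in>H \<inter> V j. E v u} \<subseteq> {u\<in>C \<inter> V j. E v u}" using no[OF v(1)] CD by blast
  have "finite {u\<in>C \<inter> V j. E v u}" by (rule finite_subset[OF _ fin_Int[OF ij(2), of C]]) auto
  hence "nb v (H \<inter> V j) \<le> nb v (C \<inter> V j)" unfolding nbrs_def using sub by (intro of_nat_mono card_mono)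
  thus ?thesis using half_graphD(4)[OF H ij, of v] v CD by auto
qed

text \<open>A vertex of \<open>C\<close> forces the bound in the two classes other than its own; a
  vertex of \<open>C\<close> in one of these then forces it in the remaining class.\<close>

lemma half_graph_side_card:
  assumes H: "half_graph d H" and CD: "C \<union> D = H" and no: "\<And>u v. u \<in> C \<Longrightarrow> v \<in> D \<Longrightarrow> \<not> E u v"
    and ne: "C \<noteq> {}" and d: "d < real h" and i: "i \<in> I3"
  shows "real h - d \<le> real (card (C \<inter> V i))"
proof -
  have step: "real h - d \<le> real (card (C \<inter> V k))" if "v \<in> C" "v \<in> V j" "j \<in> I3" "k \<in> I3" "j \<noteq> k" for v j k
    using half_graph_side[OF H CD no that] nbrs_le_card[OF fin_Int[OF that(4)], of E v C] by linarith
  obtain v where v: "v \<in> C" using ne by blast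
  obtain j where j: "j \<in> I3" "v \<in> V j" using exists_class[of v] half_graphD(1)[OF H] CD v by blast
  show ?thesis
  proof (cases "j = i")
    case False
    then show ?thesis using step[OF v j(2,1) i] by simp
  next
    case True
    obtain k where k: "k \<in> I3" "k \<noteq> i" by (rule I3_other)
    have "real h - d \<le> real (card (C \<inter> V k))" using step[OF v j(2,1) k(1)] True k by simp
    hence "card (C \<inter> V k) \<noteq> 0" using d by linarith
    hence "C \<inter> V k \<noteq> {}" by (metis card.empty)
    then obtain u where u: "u \<in> C" "u \<in> V k" by blast
    show ?thesis by (rule step[OF u k(1) i k(2)])
  qed
qed

text \<open>If Tutte's set \<open>U\<close> is small, each member of \<open>K\<close> needs about
  \<open>h\<close> vertices in every class apart from those in \<open>U\<close>, so there is room
  for only two, which exhaust \<open>H\<close>. If \<open>U\<close> is large, nearly all members of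
  \<open>K\<close> are small, \<open>U\<close> absorbs their neighbourhoods, and representatives of
  them form an independent set.\<close>

lemma half_graph_no_perfect_matching:
  assumes H: "half_graph d H" and d: "100 * d \<le> real h" "0 < d" "7 * real h \<le> d * d"
    and ev: "even (card H)" and npm: "\<not> perfect_matching H E"
  shows "(\<exists>C D. C \<union> D = H \<and> C \<inter> D = {} \<and> odd (card C) \<and> odd (card D) \<and> (\<forall>u\<in>C. \<forall>v\<in>D. \<not> E u v)) \<or>
    (\<exists>I. \<forall>i\<in>I3. I i \<subseteq> H \<inter> V i \<and> real h - 13 * d \<le> real (card (I i)) \<and>
      (\<forall>j\<in>I3. i \<noteq> j \<longrightarrow> (\<forall>u\<in>I i. \<forall>v\<in>I j. \<not> E u v)))"
proof -
  have finH: "finite H" using half_graphD(1)[OF H] fin_vtx finite_subset by blast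
  obtain U K where U: "U \<subseteq> H" and dK: "disjoint K" and cK: "card U + 2 \<le> card K"
    and K: "\<And>X. X \<in> K \<Longrightarrow> X \<subseteq> H - U" "\<And>X. X \<in> K \<Longrightarrow> odd (card X)"
      "\<And>X u v. X \<in> K \<Longrightarrow> u \<in> X \<Longrightarrow> v \<in> H - U - X \<Longrightarrow> \<not> E u v"
    using not_perfect_matching_obstruction[OF finH ev sym irrefl npm] by metis
  have finK: "finite K" using finite_subset[of K "Pow H"] K(1) finH by blast
  have XH: "X \<subseteq> H" "finite X" "X \<noteq> {}" if "X \<in> K" for X
    using K(1,2)[OF that] finH finite_subset[of X H] by (auto intro: ccontr)
  have split: "real (card H) = real (card (H \<inter> V 1)) + real (card (H \<inter> V 2)) + real (card (H \<inter> V 3))"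
    using card_vtx_split[of 1 2 3 H] half_graphD(1)[OF H] by (simp add: I3_def)
  have splitU: "real (card U) = real (card (U \<inter> V 1)) + real (card (U \<inter> V 2)) + real (card (U \<inter> V 3))"
    using card_vtx_split[of 1 2 3 U] half_graphD(1)[OF H] U by (simp add: I3_def)
  \<comment> \<open>The neighbours in \<open>H\<close> of a vertex of \<open>X\<close> lie in
    \<open>X\<close> or in \<open>U\<close>.\<close>
  have local: "real h - d \<le> real (card (X \<inter> V j)) + real (card (U \<inter> V j))"
    if X: "X \<in> K" "v \<in> X" "v \<in> V i" and ij: "i \<in> I3" "j \<in> I3" "i \<noteq> j" for X v i j
  proof -
    have "{u\<in>H \<inter> V j. E v u} \<subseteq> X \<inter> V j \<union> U \<inter> V j" using K(3)[OF X(1,2)] by blast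
    hence "card {u\<in>H \<inter> V j. E v u} \<le> card (X \<inter> V j \<union> U \<inter> V j)" using ij by (intro card_mono) auto
    also have "\<dots> \<le> card (X \<inter> V j) + card (U \<inter> V j)" by (rule card_Un_le)
    finally have "nb v (H \<inter> V j) \<le> real (card (X \<inter> V j)) + real (card (U \<inter> V j))" unfolding nbrs_def by linarith
    thus ?thesis using half_graphD(4)[OF H ij, of v] X XH(1)[OF X(1)] by auto
  qed
  have UV: "card (U \<inter> V i) \<le> card U" for i using U finH finite_subset by (intro card_mono) blast+
  have disjoint_members: "X \<inter> Y = {}" if "X \<in> K" "Y \<in> K" "X \<noteq> Y" for X Y
    using dK that unfolding disjoint_def by blast
  show ?thesis
  proof (cases "4 * real (card U) \<le> real h")
    case True
    have big: "real h - d \<le> real (card (X \<inter> V i)) + real (card (U \<inter> V i))" if X: "X \<in> K" and i: "i \<in> I3" for X i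
    proof -
      obtain v where v: "v \<in> X" using XH(3)[OF X] by blast
      obtain j where j: "j \<in> I3" "v \<in> V j" using exists_class[of v] half_graphD(1)[OF H] XH(1)[OF X] v by blast
      show ?thesis
      proof (cases "j = i")
        case False
        then show ?thesis by (rule local[OF X v j(2,1) i])
      next
        case same: True
        obtain k where k: "k \<in> I3" "k \<noteq> i" by (rule I3_other)
        have "real h - d \<le> real (card (X \<inter> V k)) + real (card (U \<inter> V k))"
          using local[OF X v j(2,1) k(1)] same k(2) by simp
        hence "card (X \<inter> V k) \<noteq> 0" using True UV[of k] d by linarith
        hence "X \<inter> V k \<noteq> {}" by (metis card.empty)
        then obtain u where u: "u \<in> X" "u \<in> V k" by blast
        show ?thesis by (rule local[OF X u k(1) i k(2)])
      qed
    qed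
    \<comment> \<open>Three members together with \<open>U\<close> would have to fit into the
      \<open>2 * h + d\<close> vertices of each class. This forces about \<open>h / 2\<close>
      vertices of \<open>U\<close> into each class, contrary to
      \<open>4 * card U \<le> h\<close>.\<close>
    have "card K \<le> 2"
    proof (rule ccontr)
      assume "\<not> card K \<le> 2"
      hence "3 \<le> card K" by simp
      then obtain K3 where "K3 \<subseteq> K" "card K3 = 3" using obtain_subset_with_card_n by metis
      then obtain X1 X2 X3 where X: "X1 \<in> K" "X2 \<in> K" "X3 \<in> K" and ne: "X1 \<noteq> X2" "X2 \<noteq> X3" "X1 \<noteq> X3"
        by (auto simp: card_3_iff)
      have "real h - 4 * d \<le> 2 * real (card (U \<inter> V i))" if i: "i \<in> I3" for i
      proof -
        have "real (card (X1 \<inter> V i)) + real (card (X2 \<inter> V i)) = real (card (X1 \<inter> V i \<union> X2 \<inter> V i))"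
          using disjoint_members[OF X(1,2) ne(1)] i by (subst card_Un_disjoint) auto
        moreover have "\<dots> + real (card (X3 \<inter> V i)) = real (card (X1 \<inter> V i \<union> X2 \<inter> V i \<union> X3 \<inter> V i))"
          using disjoint_members[OF X(1,3) ne(3)] disjoint_members[OF X(2,3) ne(2)] i by (subst card_Un_disjoint) auto
        moreover have "\<dots> + real (card (U \<inter> V i)) \<le> real (card (H \<inter> V i))"
          by (rule card_disjoint_subsets_le) (use i U K(1)[OF X(1)] K(1)[OF X(2)] K(1)[OF X(3)] in auto)
        ultimately show ?thesis using big[OF X(1) i] big[OF X(2) i] big[OF X(3) i] half_graphD(3)[OF H i] by linarith
      qed
      from this[OF I3_mem(1)] this[OF I3_mem(2)] this[OF I3_mem(3)]
      show False using splitU True d by linarith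
    qed
    hence "card K = 2" "card U = 0" using cK by linarith+
    hence U0: "U = {}" using U finH finite_subset by fastforce
    obtain C D where CD: "K = {C, D}" "C \<noteq> D" using \<open>card K = 2\<close> by (auto simp: card_2_iff)
    have CK: "C \<in> K" "D \<in> K" using CD by auto
    note dis = disjoint_members[OF CK CD(2)]
    \<comment> \<open>A vertex in neither part would miss at least \<open>2 * h - 2 * d\<close> of
      the at most \<open>2 * h + d\<close> vertices of another class, which leaves too few
      neighbours.\<close>
    have "z \<in> C \<union> D" if z: "z \<in> H" for z
    proof (rule ccontr)
      assume n: "z \<notin> C \<union> D"
      obtain i where i: "i \<in> I3" "z \<in> V i" using exists_class[of z] half_graphD(1)[OF H] z by blast
      obtain j where j: "j \<in> I3" "j \<noteq> i" by (rule I3_other)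
      have "\<not> E z u" if "u \<in> C \<union> D" for u
        using K(3)[OF CK(1), of u z] K(3)[OF CK(2), of u z] that z n U0 sym by blast
      hence "{u\<in>H \<inter> V j. E z u} \<inter> (C \<inter> V j \<union> D \<inter> V j) = {}" by blast
      hence "nb z (H \<inter> V j) + real (card (C \<inter> V j \<union> D \<inter> V j)) \<le> real (card (H \<inter> V j))"
        unfolding nbrs_def by (intro card_disjoint_subsets_le) (use j XH(1)[OF CK(1)] XH(1)[OF CK(2)] in auto)
      moreover have "real (card (C \<inter> V j \<union> D \<inter> V j)) = real (card (C \<inter> V j)) + real (card (D \<inter> V j))"
        using dis j by (subst card_Un_disjoint) auto
      ultimately show False
        using big[OF CK(1) j(1)] big[OF CK(2) j(1)] half_graphD(3)[OF H j(1)] half_graphD(4)[OF H i(1) j(1) j(2)[symmetric] z i(2)]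
          U0 d by simp
    qed
    hence "C \<union> D = H" using XH(1)[OF CK(1)] XH(1)[OF CK(2)] by blast
    moreover have "\<forall>u\<in>C. \<forall>v\<in>D. \<not> E u v" using K(3)[OF CK(1)] K(1)[OF CK(2)] dis U0 by blast
    ultimately show ?thesis using dis K(2)[OF CK(1)] K(2)[OF CK(2)] by (intro disjI1 exI[of _ C] exI[of _ D]) simp
  next
    case False
    \<comment> \<open>The size threshold \<open>d\<close> works because the members are disjoint and
      \<open>card H \<le> 7 * h \<le> d * d\<close>: at most \<open>d\<close> of them have more than
      \<open>d\<close> vertices.\<close>
    define Ks where "Ks = {X\<in>K. real (card X) \<le> d}"
    define Kl where "Kl = {X\<in>K. real (card X) > d}"
    have finKs: "finite Ks" "finite Kl" using finK by (auto simp: Ks_def Kl_def)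
    have cKl: "real (card Kl) \<le> d"
    proof -
      have "real (card Kl) * d = (\<Sum>X\<in>Kl. d)" by simp
      also have "\<dots> \<le> (\<Sum>X\<in>Kl. real (card X))" by (rule sum_mono) (auto simp: Kl_def)
      also have "\<dots> = real (card (\<Union>Kl))"
      proof -
        have "pairwise disjnt Kl" using dK unfolding Kl_def disjoint_def pairwise_def disjnt_def by blast
        moreover have "finite X" if "X \<in> Kl" for X using that XH(2) by (auto simp: Kl_def)
        ultimately show ?thesis by (simp add: card_Union_disjoint)
      qed
      also have "\<dots> \<le> real (card H)"
        using finH XH(1) by (intro of_nat_mono card_mono) (auto simp: Kl_def)
      also have "\<dots> \<le> 7 * real h"
        using split half_graphD(3)[OF H I3_mem(1)] half_graphD(3)[OF H I3_mem(2)] half_graphD(3)[OF H I3_mem(3)] d by linarith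
      also note d(3)
      finally show ?thesis using d(2) by simp
    qed
    have "card K = card Ks + card Kl"
    proof -
      have "K = Ks \<union> Kl" by (auto simp: Ks_def Kl_def)
      moreover have "Ks \<inter> Kl = {}" by (auto simp: Ks_def Kl_def)
      ultimately show ?thesis using card_Un_disjoint[OF finKs] by simp
    qed
    hence cKs: "real (card Ks) \<ge> real (card U) + 2 - d" using cK cKl by linarith
    have KsK: "X \<in> K" "real (card X) \<le> d" if "X \<in> Ks" for X using that by (auto simp: Ks_def)
    have Ubig: "real h - 2 * d \<le> real (card (U \<inter> V j))"
      if X: "X \<in> Ks" "v \<in> X" "v \<in> V i" and ij: "i \<in> I3" "j \<in> I3" "i \<noteq> j" for X v i j
    proof -
      have "card (X \<inter> V j) \<le> card X" using XH(2)[OF KsK(1)[OF X(1)]] by (intro card_mono) auto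
      thus ?thesis using local[OF KsK(1)[OF X(1)] X(2,3) ij] KsK(2)[OF X(1)] by linarith
    qed
    have "\<forall>X\<in>Ks. \<exists>v. v \<in> X" using XH(3) KsK(1) by blast
    then obtain g where g: "\<And>X. X \<in> Ks \<Longrightarrow> g X \<in> X" by metis
    have injg: "inj_on g Ks"
      by (rule inj_onI) (metis KsK(1) IntI disjoint_members empty_iff g)
    define I where "I = g ` Ks"
    have cI: "card I = card Ks" unfolding I_def by (rule card_image[OF injg])
    have IH: "I \<subseteq> H - U" using g K(1) KsK(1) unfolding I_def by blast
    have finI: "finite I" using IH finH finite_subset by blast
    have indep: "\<not> E u v" if uv: "u \<in> I" "v \<in> I" for u v
    proof -
      obtain X Y where XY: "X \<in> Ks" "Y \<in> Ks" "u = g X" "v = g Y" using uv unfolding I_def by blast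
      show ?thesis
      proof (cases "X = Y")
        case True
        then show ?thesis using XY irrefl by simp
      next
        case False
        have "v \<notin> X" using disjoint_members[OF KsK(1)[OF XY(1)] KsK(1)[OF XY(2)] False] g[OF XY(2)] XY(4) by blast
        then show ?thesis using K(3)[OF KsK(1)[OF XY(1)], of u v] g[OF XY(1)] XY IH uv(2) by blast
      qed
    qed
    have IU: "real (card (I \<inter> V i)) + real (card (U \<inter> V i)) \<le> real (card (H \<inter> V i))" if "i \<in> I3" for i
      by (rule card_disjoint_subsets_le) (use IH U that in auto)
    have "I \<subseteq> vtx" using half_graphD(1)[OF H] IH by blast
    hence splitI: "real (card I) = real (card (I \<inter> V 1)) + real (card (I \<inter> V 2)) + real (card (I \<inter> V 3))"
      using card_vtx_split[of 1 2 3 I] by (simp add: I3_def)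
    have "Ks \<noteq> {}" using cKs False d by auto
    then obtain X0 where X0: "X0 \<in> Ks" by blast
    have v0: "g X0 \<in> vtx" using g[OF X0] XH(1)[OF KsK(1)[OF X0]] half_graphD(1)[OF H] by blast
    then obtain i where i: "i \<in> I3" "g X0 \<in> V i" using exists_class by blast
    show ?thesis
    proof (cases "\<forall>X\<in>Ks. X \<subseteq> V i")
      case False
      then obtain X v where Xv: "X \<in> Ks" "v \<in> X" "v \<notin> V i" by blast
      obtain i' where i': "i' \<in> I3" "v \<in> V i'"
        using exists_class[of v] XH(1)[OF KsK(1)[OF Xv(1)]] half_graphD(1)[OF H] Xv(2) by blast
      have Uall: "real h - 2 * d \<le> real (card (U \<inter> V j))" if j: "j \<in> I3" for j
      proof (cases "j = i")
        case True
        hence "i' \<noteq> j" using i' Xv by blast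
        then show ?thesis by (rule Ubig[OF Xv(1,2) i'(2,1) j])
      next
        case False
        then show ?thesis using Ubig[OF X0 g[OF X0] i(2,1) j] by simp
      qed
      have cU: "real (card U) \<ge> 3 * real h - 6 * d"
        using splitU Uall[OF I3_mem(1)] Uall[OF I3_mem(2)] Uall[OF I3_mem(3)] by linarith
      have Iup: "real (card (I \<inter> V j)) \<le> real h + 3 * d" if "j \<in> I3" for j
        using IU[OF that] Uall[OF that] half_graphD(3)[OF H that] by linarith
      \<comment> \<open>\<open>I\<close> has at least \<open>3 * h - 7 * d\<close> vertices, and the
        other two classes hold at most \<open>h + 3 * d\<close> of them each.\<close>
      have "real h - 13 * d \<le> real (card (I \<inter> V j))" if j: "j \<in> I3" for j
        using j Iup[OF I3_mem(1)] Iup[OF I3_mem(2)] Iup[OF I3_mem(3)] splitI cI cKs cU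
        by (elim I3_cases) (simp_all del: One_nat_def)
      thus ?thesis using indep IH by (intro disjI2 exI[of _ "\<lambda>j. I \<inter> V j"]) blast
    next
      case True
      have IV: "I \<subseteq> V i" using True g unfolding I_def by blast
      obtain j k where jk: "j \<in> I3" "k \<in> I3" "j \<noteq> i" "k \<noteq> i" "j \<noteq> k" "I3 = {i, j, k}"
        by (rule I3_others[OF i(1)])
      have two: "real (card (U \<inter> V j)) + real (card (U \<inter> V k)) \<le> real (card U)"
        by (rule card_disjoint_subsets_le) (use U finH finite_subset disj[OF jk(1,2,5)] in blast)+
      have cI2: "real (card I) \<ge> 2 * real h - 5 * d"
        using two cI cKs Ubig[OF X0 g[OF X0] i(2,1) jk(1) jk(3)[symmetric]]
          Ubig[OF X0 g[OF X0] i(2,1) jk(2) jk(4)[symmetric]] by linarith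
      \<comment> \<open>\<open>I\<close> nearly fills \<open>H \<inter> V i\<close>, so
        \<open>z\<close> is adjacent to a representative. The small members lie inside
        \<open>V i\<close>, hence \<open>z\<close> belongs to \<open>U\<close>. Then
        \<open>U\<close> contains two whole classes of \<open>H\<close>, and \<open>I\<close> would
        be larger than the third.\<close>
      have sub: "H \<inter> V m \<subseteq> U" if m: "m \<in> I3" "m \<noteq> i" for m
      proof (rule ccontr)
        assume "\<not> ?thesis"
        then obtain z where z: "z \<in> H" "z \<in> V m" "z \<notin> U" by blast
        have "{u\<in>H \<inter> V i. E z u} \<inter> I \<noteq> {}"
        proof (rule overlap_of_large_subsets)
          show "real (card (H \<inter> V i)) < real (card {u\<in>H \<inter> V i. E z u}) + real (card I)"
            using half_graphD(4)[OF H m(1) i(1) m(2) z(1,2)] cI2 half_graphD(3)[OF H i(1)] d unfolding nbrs_def by linarith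
        qed (use IH IV i in auto)
        then obtain u where u: "u \<in> I" "E z u" by blast
        then obtain X where X: "X \<in> Ks" "u = g X" unfolding I_def by blast
        have "z \<in> X" using K(3)[OF KsK(1)[OF X(1)], of u z] g[OF X(1)] X(2) z u(2) sym by blast
        hence "z \<in> V i" using True X(1) by blast
        thus False using class_unique[OF m(1) i(1) z(2)] m(2) by blast
      qed
      have HU: "real (card (H \<inter> V m)) \<le> real (card (U \<inter> V m))" if m: "m \<in> I3" "m \<noteq> i" for m
        using sub[OF m] m by (intro of_nat_mono card_mono) auto
      have "2 * real h - d \<le> real (card (U \<inter> V j))" "2 * real h - d \<le> real (card (U \<inter> V k))"
        using order_trans[OF half_graphD(2)[OF H jk(1)] HU[OF jk(1,3)]]
          order_trans[OF half_graphD(2)[OF H jk(2)] HU[OF jk(2,4)]] by blast+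
      hence "4 * real h - 2 * d \<le> real (card U)" using two by argo
      moreover have "real (card I) \<le> real (card (H \<inter> V i))"
        using IV IH i by (intro of_nat_mono card_mono) auto
      ultimately show ?thesis using cI cKs half_graphD(3)[OF H i(1)] d by linarith
    qed
  qed
qed

text \<open>If \<open>H - t\<close> has no perfect matching, then it splits into two odd parts without edges between
  them. The triangle \<open>t\<close> is attached to one of the parts; removing a triangle of the other part
  instead of \<open>t\<close> makes both parts even.\<close>

lemma perfect_matching_after_triangle:
  assumes H: "half_graph d H" and d: "100 * e \<le> real h" "1 \<le> e" "7 * real h \<le> e * e" "d + 1 \<le> e"
    and t: "is_triangle E t" "t \<subseteq> H" and ev: "even (card (H - t))"
    and noI: "\<And>I. (\<And>i. i \<in> I3 \<Longrightarrow> I i \<subseteq> H \<inter> V i) \<Longrightarrow> (\<And>i. i \<in> I3 \<Longrightarrow> real h - 13 * e \<le> real (card (I i))) \<Longrightarrow>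
      (\<And>i j u v. i \<in> I3 \<Longrightarrow> j \<in> I3 \<Longrightarrow> i \<noteq> j \<Longrightarrow> u \<in> I i \<Longrightarrow> v \<in> I j \<Longrightarrow> \<not> E u v) \<Longrightarrow> False"
  shows "\<exists>t'. is_triangle E t' \<and> t' \<subseteq> H \<and> perfect_matching (H - t') E"
proof (rule ccontr)
  assume none: "\<not> ?thesis"
  have finH: "finite H" using half_graphD(1)[OF H] fin_vtx finite_subset by blast
  have HT: "half_graph e (H - T)" if "is_triangle E T" for T
  proof -
    have "half_graph (d + (e - d)) (H - T)"
      by (rule half_graph_Diff[OF H]) (use triangle_props(5)[OF that] d(4) in auto)
    thus ?thesis by simp
  qed
  have cT: "card (H - T) = card H - 3" if "is_triangle E T" "T \<subseteq> H" for T
    using card_Diff_subset[OF triangle_props(1)[OF that(1)] that(2)] triangle_props(2)[OF that(1)] by simp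
  have split: "\<exists>C D. C \<union> D = H - T \<and> C \<inter> D = {} \<and> odd (card C) \<and> odd (card D) \<and> (\<forall>u\<in>C. \<forall>v\<in>D. \<not> E u v)"
    if T: "is_triangle E T" "T \<subseteq> H" for T
  proof -
    have "even (card (H - T))" using ev cT[OF T] cT[OF t] by simp
    from half_graph_no_perfect_matching[OF HT[OF T(1)] d(1) _ d(3) this] none T d(2)
    have "(\<exists>C D. C \<union> D = H - T \<and> C \<inter> D = {} \<and> odd (card C) \<and> odd (card D) \<and> (\<forall>u\<in>C. \<forall>v\<in>D. \<not> E u v)) \<or>
      (\<exists>I. \<forall>i\<in>I3. I i \<subseteq> (H - T) \<inter> V i \<and> real h - 13 * e \<le> real (card (I i)) \<and>
      (\<forall>j\<in>I3. i \<noteq> j \<longrightarrow> (\<forall>u\<in>I i. \<forall>v\<in>I j. \<not> E u v)))" by fastforce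
    thus ?thesis
    proof
      assume "\<exists>I. \<forall>i\<in>I3. I i \<subseteq> (H - T) \<inter> V i \<and> real h - 13 * e \<le> real (card (I i)) \<and>
        (\<forall>j\<in>I3. i \<noteq> j \<longrightarrow> (\<forall>u\<in>I i. \<forall>v\<in>I j. \<not> E u v))"
      then obtain I where I: "\<forall>i\<in>I3. I i \<subseteq> (H - T) \<inter> V i \<and> real h - 13 * e \<le> real (card (I i)) \<and>
        (\<forall>j\<in>I3. i \<noteq> j \<longrightarrow> (\<forall>u\<in>I i. \<forall>v\<in>I j. \<not> E u v))" by blast
      have False by (rule noI[of I]) (use I in blast)+
      thus ?thesis by blast
    qed
  qed
  \<comment> \<open>Two vertices on different sides would have a common neighbour in a class
    different from both of theirs, because each sees more than half of \<open>K\<close>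
    there.\<close>
  have one_side: "K \<subseteq> C \<or> K \<subseteq> D"
    if K: "K \<subseteq> C \<union> D" "K \<subseteq> vtx" and no: "\<forall>u\<in>C. \<forall>v\<in>D. \<not> E u v"
      and deg: "\<And>v i j. v \<in> K \<Longrightarrow> v \<in> V i \<Longrightarrow> i \<in> I3 \<Longrightarrow> j \<in> I3 \<Longrightarrow> i \<noteq> j \<Longrightarrow> 2 * nb v (K \<inter> V j) > real (card (K \<inter> V j))"
    for K C D
  proof (rule ccontr)
    assume "\<not> ?thesis"
    then obtain x y where xy: "x \<in> K" "x \<in> D" "y \<in> K" "y \<in> C" using K(1) by blast
    obtain i where i: "i \<in> I3" "x \<in> V i" using exists_class K(2) xy(1) by blast
    obtain j where j: "j \<in> I3" "y \<in> V j" using exists_class K(2) xy(3) by blast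
    have "\<exists>k\<in>I3. k \<noteq> i \<and> k \<noteq> j"
    proof (cases "i = j")
      case True
      obtain k where "k \<in> I3" "k \<noteq> i" by (rule I3_other)
      thus ?thesis using True by blast
    next
      case False
      obtain k where "k \<in> I3" "k \<noteq> i" "k \<noteq> j" by (rule I3_third[OF i(1) j(1) False])
      thus ?thesis by blast
    qed
    then obtain k where k: "k \<in> I3" "i \<noteq> k" "j \<noteq> k" by blast
    have "{u\<in>K \<inter> V k. E x u} \<inter> {u\<in>K \<inter> V k. E y u} \<noteq> {}"
      by (rule overlap_of_large_subsets[OF fin_Int[OF k(1)]])
        (use deg[OF xy(1) i(2,1) k(1,2)] deg[OF xy(3) j(2,1) k(1,3)] in \<open>auto simp: nbrs_def\<close>)
    then obtain z where z: "z \<in> K" "E x z" "E y z" by blast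
    show False using z no xy K(1) sym by blast
  qed
  \<comment> \<open>The splitting of \<open>H - t'\<close> is a priori unrelated to \<open>C\<close>
    and \<open>D\<close>. By \<open>one_side\<close>, however, \<open>D\<close> and
    \<open>C - t'\<close> each stay on one side, and \<open>t\<close> follows \<open>y\<close>; so
    one part equals \<open>D \<union> t\<close>, whose size \<open>card D + 3\<close> is
    even.\<close>
  have flip: False
    if CD: "C \<union> D = H - t" "C \<inter> D = {}" "odd (card C)" "odd (card D)" and no: "\<forall>u\<in>C. \<forall>v\<in>D. \<not> E u v"
      and uy: "u \<in> t" "y \<in> D" "E u y" for C D u y
  proof -
    have CD': "D \<union> C = H - t" using CD(1) by blast
    have nC: "\<not> E u v" if "u \<in> C" "v \<in> D" for u v using no that by blast
    have nD: "\<not> E u v" if "u \<in> D" "v \<in> C" for u v using no that sym by blast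
    have ne: "C \<noteq> {}" "D \<noteq> {}" using CD by auto
    note Ht = HT[OF t(1)]
    have dh: "e < real h" using d by linarith
    have CDv: "C \<subseteq> vtx" "D \<subseteq> vtx" using CD(1) half_graphD(1)[OF H] by blast+
    have lo: "real h - e \<le> real (card (C \<inter> V i))" "real h - e \<le> real (card (D \<inter> V i))" if "i \<in> I3" for i
      using half_graph_side_card[OF Ht CD(1) nC ne(1) dh that] half_graph_side_card[OF Ht CD' nD ne(2) dh that] by auto
    have sum: "real (card (C \<inter> V i)) + real (card (D \<inter> V i)) \<le> 2 * real h + e" if i: "i \<in> I3" for i
    proof -
      have "real (card (C \<inter> V i)) + real (card (D \<inter> V i)) \<le> real (card ((H - t) \<inter> V i))"
        by (rule card_disjoint_subsets_le) (use i CD in auto)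
      thus ?thesis using half_graphD(3)[OF Ht i] by linarith
    qed
    have up: "real (card (C \<inter> V i)) \<le> real h + 2 * e" "real (card (D \<inter> V i)) \<le> real h + 2 * e" if "i \<in> I3" for i
      using sum[OF that] lo[OF that] by linarith+
    have degC: "real h - e \<le> nb v (C \<inter> V j)" if "v \<in> C" "v \<in> V i" "i \<in> I3" "j \<in> I3" "i \<noteq> j" for v i j
      by (rule half_graph_side[OF Ht CD(1) nC that])
    have degD: "real h - e \<le> nb v (D \<inter> V j)" if "v \<in> D" "v \<in> V i" "i \<in> I3" "j \<in> I3" "i \<noteq> j" for v i j
      by (rule half_graph_side[OF Ht CD' nD that])
    \<comment> \<open>Inside \<open>C\<close> a vertex misses at most \<open>3 * e\<close> vertices
      of another class, so a triangle can be chosen vertex by vertex.\<close>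
    have "card (C \<inter> V 1) \<noteq> 0" using lo(1)[OF I3_mem(1)] dh by linarith
    hence "C \<inter> V 1 \<noteq> {}" by (metis card.empty)
    then obtain c1 where c1: "c1 \<in> C" "c1 \<in> V 1" by blast
    have "nb c1 (C \<inter> V 2) > real (card ({} :: 'a set))" using degC[OF c1 I3_mem(1,2)] dh by simp
    then obtain c2 where c2: "c2 \<in> C \<inter> V 2" "E c1 c2" by (rule obtain_nbr[OF fin_Int[OF I3_mem(2)] finite.emptyI])
    have "nn c2 (C \<inter> V 3) \<le> 3 * e"
      using degC[of c2 2 3] c2 I3_mem nbrs_plus_nonnbrs_Int[OF I3_mem(3), of c2 C] up(1)[OF I3_mem(3)] by auto
    hence "nb c1 (C \<inter> V 3) > nn c2 (C \<inter> V 3) + real (card ({} :: 'a set))"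
      using degC[OF c1 I3_mem(1,3)] d by simp
    then obtain c3 where c3: "c3 \<in> C \<inter> V 3" "E c1 c3" "E c2 c3"
      by (rule obtain_common_nbr[OF fin_Int[OF I3_mem(3)] finite.emptyI])
    define t' where "t' = {c1, c2, c3}"
    have t': "is_triangle E t'" unfolding t'_def by (rule triangleI[OF c2(2) c3(3,2)])
    have t'C: "t' \<subseteq> C" using c1 c2 c3 by (auto simp: t'_def)
    have t'H: "t' \<subseteq> H" "t \<inter> t' = {}" using t'C CD(1) by blast+
    obtain C2 D2 where CD2: "C2 \<union> D2 = H - t'" "C2 \<inter> D2 = {}" "odd (card C2)" "odd (card D2)"
      and no2: "\<forall>u\<in>C2. \<forall>v\<in>D2. \<not> E u v" using split[OF t' t'H(1)] by blast
    have "D \<subseteq> C2 \<or> D \<subseteq> D2"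
    proof (rule one_side[OF _ CDv(2) no2])
      show "D \<subseteq> C2 \<union> D2" using CD CD2(1) t'C by blast
      show "real (card (D \<inter> V j)) < 2 * nb v (D \<inter> V j)" if "v \<in> D" "v \<in> V i" "i \<in> I3" "j \<in> I3" "i \<noteq> j" for v i j
        using degD[OF that] up(2)[OF that(4)] d by linarith
    qed
    moreover have "C - t' \<subseteq> C2 \<or> C - t' \<subseteq> D2"
    proof (rule one_side[OF _ _ no2])
      show "C - t' \<subseteq> C2 \<union> D2" using CD CD2(1) by blast
      show "C - t' \<subseteq> vtx" using CDv by blast
      show "real (card ((C - t') \<inter> V j)) < 2 * nb v ((C - t') \<inter> V j)"
        if v: "v \<in> C - t'" "v \<in> V i" and ij: "i \<in> I3" "j \<in> I3" "i \<noteq> j" for v i j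
      proof -
        have "nb v (C \<inter> V j) \<le> nb v ((C - t') \<inter> V j) + real (card (C \<inter> V j - (C - t') \<inter> V j))"
          using ij by (intro nbrs_le_plus_card) auto
        moreover have "card (C \<inter> V j - (C - t') \<inter> V j) \<le> card (t' \<inter> V j)" using ij by (intro card_mono) auto
        moreover have "card ((C - t') \<inter> V j) \<le> card (C \<inter> V j)" using ij by (intro card_mono) auto
        moreover have "real h - e \<le> nb v (C \<inter> V j)" using degC[OF _ v(2) ij] v(1) by blast
        ultimately show ?thesis
          using up(1)[OF ij(2)] triangle_props(5)[OF t' ij(2)] d by linarith
      qed
    qed
    moreover have same: "(p \<in> C2 \<longleftrightarrow> q \<in> C2)" if "E p q" "p \<in> H - t'" "q \<in> H - t'" for p q
      using that no2 CD2 sym by blast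
    have tin: "t \<subseteq> H - t'" using t(2) t'H(2) by blast
    have "(p \<in> C2 \<longleftrightarrow> y \<in> C2)" if p: "p \<in> t" for p
    proof -
      have "y \<in> H - t'" using uy(2) CD t'C by blast
      hence 1: "u \<in> C2 \<longleftrightarrow> y \<in> C2" using same[OF uy(3)] tin uy(1) by blast
      have "p = u \<or> E p u" using t(1) p uy(1) sym unfolding is_triangle_def by auto
      thus ?thesis using 1 same[of p u] tin p uy(1) by blast
    qed
    hence tD: "t \<subseteq> C2 \<or> t \<inter> C2 = {}" "y \<in> C2 \<longleftrightarrow> t \<subseteq> C2"
      using uy(1) by blast+
    have cDt: "even (card (D \<union> t))"
    proof -
      have "D \<inter> t = {}" using CD(1) by blast
      moreover have "finite D" using CDv(2) fin_vtx finite_subset by blast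
      ultimately have "card (D \<union> t) = card D + 3" using triangle_props(1,2)[OF t(1)] by (simp add: card_Un_disjoint)
      thus ?thesis using CD(4) by simp
    qed
    have cover: "H - t' = (C - t') \<union> (D \<union> t)" using CD(1,2) t(2) t'C t'H(2) by blast
    have "C2 \<noteq> {}" "D2 \<noteq> {}" using CD2(3,4) by auto
    ultimately have "C2 = D \<union> t \<or> D2 = D \<union> t"
    proof (elim disjE)
      assume a: "D \<subseteq> C2" "C - t' \<subseteq> C2"
      hence "t \<subseteq> C2" using tD uy(2) by blast
      hence "D2 = {}" using a cover CD2(1,2) by blast
      thus ?thesis using \<open>D2 \<noteq> {}\<close> by blast
    next
      assume a: "D \<subseteq> C2" "C - t' \<subseteq> D2"
      hence "t \<subseteq> C2" using tD uy(2) by blast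
      hence "C2 = D \<union> t" using a cover CD2(1,2) by blast
      thus ?thesis by blast
    next
      assume a: "D \<subseteq> D2" "C - t' \<subseteq> C2"
      hence "t \<inter> C2 = {}" using tD uy(2) CD2(2) by blast
      hence "D2 = D \<union> t" using a cover CD2(1,2) by blast
      thus ?thesis by blast
    next
      assume a: "D \<subseteq> D2" "C - t' \<subseteq> D2"
      hence "t \<inter> C2 = {}" using tD uy(2) CD2(2) by blast
      hence "C2 = {}" using a cover CD2(1,2) by blast
      thus ?thesis using \<open>C2 \<noteq> {}\<close> by blast
    qed
    thus False using cDt CD2(3,4) by auto
  qed
  obtain C D where CD: "C \<union> D = H - t" "C \<inter> D = {}" "odd (card C)" "odd (card D)"
    and no: "\<forall>u\<in>C. \<forall>v\<in>D. \<not> E u v" using split[OF t] by blast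
  \<comment> \<open>Some vertex of \<open>t\<close> has a neighbour outside \<open>t\<close>, in
    \<open>C\<close> or in \<open>D\<close>; the roles of the two parts in \<open>flip\<close> are
    chosen accordingly.\<close>
  obtain u where u: "u \<in> t" using triangle_props(4)[OF t(1)] by blast
  obtain i where i: "i \<in> I3" "u \<in> V i" using exists_class[of u] triangle_props(3)[OF t(1)] u by blast
  obtain j where j: "j \<in> I3" "j \<noteq> i" by (rule I3_other)
  have "real (card (t \<inter> V j)) < nb u (H \<inter> V j)"
    using half_graphD(4)[OF H i(1) j(1) j(2)[symmetric] _ i(2)] u t(2) triangle_props(5)[OF t(1) j(1)] d by fastforce
  then obtain y where y: "y \<in> H \<inter> V j" "E u y" "y \<notin> t \<inter> V j"
    by (rule obtain_nbr[OF fin_Int[OF j(1)] fin_Int[OF j(1)]])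
  hence "y \<in> C \<union> D" using CD(1) by blast
  thus False
  proof
    assume "y \<in> D"
    from flip[OF CD no u this y(2)] show False .
  next
    assume yC: "y \<in> C"
    have "\<forall>u\<in>D. \<forall>v\<in>C. \<not> E u v" using no sym by blast
    from flip[OF _ _ CD(4,3) this u yC y(2)] CD(1,2) show False by blast
  qed
qed

end

section \<open>A unique sparse triple\<close>

context tripartite
begin

text \<open>This is \<Gamma>_3(h) without names for the vertices: \<open>L\<close>, \<open>C\<close>
  and \<open>D\<close> collect the clusters with second index 1, 2 and 3. Vertices of different
  classes are nonadjacent exactly inside \<open>L\<close> and between \<open>C\<close> and
  \<open>D\<close>.\<close>

definition gamma_split :: "'a set \<Rightarrow> 'a set \<Rightarrow> 'a set \<Rightarrow> bool" where
  "gamma_split L C D \<longleftrightarrow> L \<union> C \<union> D = vtx \<and> L \<inter> C = {} \<and> L \<inter> D = {} \<and> C \<inter> D = {} \<and>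
     (\<forall>i\<in>I3. card (L \<inter> V i) = h \<and> card (C \<inter> V i) = h \<and> card (D \<inter> V i) = h) \<and>
     (\<forall>i\<in>I3. \<forall>j\<in>I3. i \<noteq> j \<longrightarrow> (\<forall>u\<in>V i. \<forall>v\<in>V j.
        E u v \<longleftrightarrow> (u \<in> L \<longrightarrow> v \<notin> L) \<and> (u \<in> C \<longrightarrow> v \<notin> D) \<and> (u \<in> D \<longrightarrow> v \<notin> C)))"

text \<open>Once \<open>h\<close> nonneighbours are known in a class, the degree condition leaves no
  room for another one.\<close>

lemma adjacent_iff_of_full_nonnbrs:
  assumes ij: "i \<in> I3" "j \<in> I3" "i \<noteq> j" and v: "v \<in> V i" and S: "card (S \<inter> V j) = h" "\<And>u. u \<in> S \<inter> V j \<Longrightarrow> \<not> E v u"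
    and u: "u \<in> V j"
  shows "E v u \<longleftrightarrow> u \<notin> S"
proof -
  have "S \<inter> V j = {u\<in>V j. \<not> E v u}"
  proof (rule card_seteq)
    show "finite {u\<in>V j. \<not> E v u}" using fin[OF ij(2)] by simp
    show "S \<inter> V j \<subseteq> {u\<in>V j. \<not> E v u}" using S(2) by blast
    show "card {u\<in>V j. \<not> E v u} \<le> card (S \<inter> V j)" using nonadj[OF ij v] S(1) by (simp add: nonnbrs_def)
  qed
  thus ?thesis using u by blast
qed

text \<open>A vertex has at least \<open>2 * h\<close> neighbours in another class, and all but
  \<open>h + 3 * w\<close> vertices of that class lie in \<open>T\<close>.\<close>

lemma half_graph_outside:
  assumes L: "like_set a w L P" and T: "T \<subseteq> vtx - L" and W: "\<And>i. i \<in> I3 \<Longrightarrow> real (card (V i - L - T)) \<le> 2 * w"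
    and w: "0 \<le> w"
  shows "half_graph (3 * w) T"
  unfolding half_graph_def
proof (intro conjI ballI impI)
  show "T \<subseteq> vtx" using T by blast
  have rest: "real (card (V i - T \<inter> V i)) \<le> real h + 3 * w" if i: "i \<in> I3" for i
  proof -
    have "card (V i - T \<inter> V i) \<le> card (L \<inter> V i \<union> (V i - L - T))" using fin[OF i] by (intro card_mono) auto
    also have "\<dots> \<le> card (L \<inter> V i) + card (V i - L - T)" by (rule card_Un_le)
    finally show ?thesis using W[OF i] like_setD(4)[OF L i] by linarith
  qed
  fix i assume i: "i \<in> I3"
  have eq: "real (card (V i - T \<inter> V i)) = 3 * real h - real (card (T \<inter> V i))"
    using real_card_Diff[OF fin[OF i], of "T \<inter> V i"] card_V[OF i] by simp
  show "2 * real h - 3 * w \<le> real (card (T \<inter> V i))" using eq rest[OF i] by linarith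
  have "real (card (L \<inter> V i)) + real (card (T \<inter> V i)) \<le> real (card (V i))"
    by (rule card_disjoint_subsets_le[OF fin[OF i]]) (use T in auto)
  thus "real (card (T \<inter> V i)) \<le> 2 * real h + 3 * w" using like_setD(3)[OF L i] card_V[OF i] w by simp
  fix j v assume j: "j \<in> I3" "i \<noteq> j" and v: "v \<in> T \<inter> V i"
  have "nb v (V j) \<le> nb v (T \<inter> V j) + real (card (V j - T \<inter> V j))"
    using fin[OF j(1)] by (intro nbrs_le_plus_card) auto
  moreover have "nb v (V j) \<ge> 2 * real h"
    using nbrs_plus_nonnbrs[OF fin[OF j(1)], of E v] nonadj[OF i j, of v] v card_V[OF j(1)] by simp
  ultimately show "real h - 3 * w \<le> nb v (T \<inter> V j)" using rest[OF j(1)] by linarith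
qed

text \<open>A vertex of \<open>L\<close> misses all of \<open>L\<close> in another class, so each
  part of \<open>L\<close> has at most \<open>h\<close> vertices. With \<open>3 * h\<close> in
  total, each part has exactly \<open>h\<close>, and these use up all permitted
  nonneighbours.\<close>

lemma independent_like_set:
  assumes L: "like_set a w L P" and cL: "card L = 3 * h" and w: "w < real h"
    and indep: "\<And>u v. u \<in> L \<Longrightarrow> v \<in> L \<Longrightarrow> \<not> E u v"
  shows "i \<in> I3 \<Longrightarrow> card (L \<inter> V i) = h"
    and "i \<in> I3 \<Longrightarrow> j \<in> I3 \<Longrightarrow> i \<noteq> j \<Longrightarrow> u \<in> V i \<Longrightarrow> v \<in> V j \<Longrightarrow> u \<in> L \<Longrightarrow> E u v \<longleftrightarrow> v \<notin> L"
proof -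
  have le: "card (L \<inter> V i) \<le> h" if i: "i \<in> I3" for i
  proof -
    obtain j where j: "j \<in> I3" "j \<noteq> i" by (rule I3_other)
    have "real (card (L \<inter> V j)) > 0" using like_setD(3)[OF L j(1)] w by linarith
    hence "L \<inter> V j \<noteq> {}" by auto
    then obtain v where v: "v \<in> L" "v \<in> V j" by blast
    have "{u\<in>L \<inter> V i. \<not> E v u} = L \<inter> V i" using indep[OF v(1)] by blast
    hence "real (card (L \<inter> V i)) = nn v (L \<inter> V i)" by (simp only: nonnbrs_def)
    also have "\<dots> \<le> real h" by (rule nn_le[OF j(1) i j(2) v(2)]) blast
    finally show ?thesis by simp
  qed
  have "card L = card (L \<inter> V 1) + card (L \<inter> V 2) + card (L \<inter> V 3)"
    using card_vtx_split[of 1 2 3 L] like_setD(1)[OF L] by (simp add: I3_def)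
  hence eq: "card (L \<inter> V i) = h" if "i \<in> I3" for i
    using that cL le[OF I3_mem(1)] le[OF I3_mem(2)] le[OF I3_mem(3)] by (elim I3_cases) (simp_all del: One_nat_def)
  show "i \<in> I3 \<Longrightarrow> card (L \<inter> V i) = h" by (rule eq)
  show "E u v \<longleftrightarrow> v \<notin> L" if "i \<in> I3" "j \<in> I3" "i \<noteq> j" "u \<in> V i" "v \<in> V j" "u \<in> L"
    by (rule adjacent_iff_of_full_nonnbrs[OF that(1-4) eq[OF that(2)] _ that(5)]) (use indep that(6) in blast)
qed

text \<open>The hypothesis \<open>unique\<close> excludes sparse triples outside \<open>L\<close>,
  as these would hardly meet \<open>A\<close>. The bound \<open>1 \<le> w\<close> absorbs single
  vertices in error terms, and \<open>7 * real h \<le> w * w\<close> is what the size threshold in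
  Tutte's obstruction requires.\<close>

lemma packing_or_gamma_split:
  assumes A: "sparse_triple (a * w / 8) A"
    and aw: "5000 * w \<le> a" "1 \<le> w" "1000 * a \<le> real h" "7 * real h \<le> w * w"
    and unique: "\<And>B. sparse_triple (4000 * w * real h) B \<Longrightarrow> \<exists>i\<in>I3. h < 2 * card (A i \<inter> B i)"
  shows "triangle_packing vtx (3 * h) \<or> (\<exists>L C D. gamma_split L C D)"
proof -
  define L where "L = likes A a"
  have num: "8 * w \<le> a" "8 * a \<le> real h" "0 < w" "100 * a \<le> h" "100 * w \<le> h" using aw by linarith+
  have "real h > 0" using num by linarith
  hence h: "0 < h" by simp
  obtain P where P: "like_set a w L P" and AL: "\<And>i. i \<in> I3 \<Longrightarrow> real (card (A i - L)) \<le> w"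
    unfolding L_def using sparse_triple_like_set[OF A num(3) num(1,2)] by metis
  note LD = like_setD[OF P]
  \<comment> \<open>\<open>T\<close> is the well-joined part of the complement of \<open>L\<close>;
    it is almost completely joined to \<open>L\<close> in both directions. The few remaining
    vertices form \<open>W\<close>.\<close>
  define T where "T = {v\<in>vtx - L. \<forall>i\<in>I3. v \<in> V i \<longrightarrow> (\<forall>j\<in>I3. j \<noteq> i \<longrightarrow> nn v (L \<inter> V j) \<le> 2 * a)}"
  define W where "W = vtx - L - T"
  have Tv: "T \<subseteq> vtx - L" by (auto simp: T_def)
  have part: "L \<inter> T = {}" "L \<inter> W = {}" "T \<inter> W = {}" "L \<union> T \<union> W = vtx" "W \<subseteq> vtx"
    using LD(1) Tv by (auto simp: W_def)
  have finLTW: "finite L" "finite T" "finite W" using LD(1) part(5) Tv fin_vtx finite_subset by blast+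
  have Tdeg: "nn v (L \<inter> V j) \<le> 2 * a" if "v \<in> T" "v \<in> V i" "i \<in> I3" "j \<in> I3" "j \<noteq> i" for v i j
    using that unfolding T_def by blast
  have VLT: "real (card (V i - L - T)) \<le> 2 * w" if i: "i \<in> I3" for i
  proof -
    have "V i - L - T \<subseteq> {v\<in>V i - L. \<exists>j\<in>I3. j \<noteq> i \<and> nn v (L \<inter> V j) > 2 * a}"
    proof
      fix v assume v: "v \<in> V i - L - T"
      hence "v \<in> vtx - L" using i unfolding vtx_def by blast
      then obtain i' j where ij: "i' \<in> I3" "v \<in> V i'" "j \<in> I3" "j \<noteq> i'" "\<not> nn v (L \<inter> V j) \<le> 2 * a"
        using v unfolding T_def by blast
      have "i' = i" using class_unique[OF ij(1) i ij(2)] v by blast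
      thus "v \<in> {v\<in>V i - L. \<exists>j\<in>I3. j \<noteq> i \<and> nn v (L \<inter> V j) > 2 * a}" using ij v by (auto simp: not_le)
    qed
    hence "card (V i - L - T) \<le> card {v\<in>V i - L. \<exists>j\<in>I3. j \<noteq> i \<and> nn v (L \<inter> V j) > 2 * a}"
      using fin[OF i] by (intro card_mono) auto
    thus ?thesis using LD(10)[OF i] by linarith
  qed
  have cW: "real (card W) \<le> 6 * w"
  proof -
    have "W \<inter> V i = V i - L - T" if "i \<in> I3" for i using vtx_Int_class[OF that] unfolding W_def by blast
    thus ?thesis using card_vtx_split[of 1 2 3 W] part(5) VLT[OF I3_mem(1)] VLT[OF I3_mem(2)] VLT[OF I3_mem(3)] I3_mem
      by (simp add: I3_def)
  qed
  have HT: "half_graph (3 * w) T" by (rule half_graph_outside[OF P Tv VLT]) (use num in auto)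
  have ac: "acomp (2 * a) L T" unfolding acomp_def
  proof (intro ballI impI conjI)
    fix i j v assume ij: "i \<in> I3" "j \<in> I3" "i \<noteq> j" and v: "v \<in> L \<inter> V i"
    show "nn v (T \<inter> V j) \<le> 2 * a"
      by (rule order_trans[OF nonnbrs_mono LD(5)[OF ij, of v]]) (use Tv ij v in auto)
  next
    fix i j v assume "i \<in> I3" "j \<in> I3" "i \<noteq> j" "v \<in> T \<inter> V i"
    thus "nn v (L \<inter> V j) \<le> 2 * a" using Tdeg[of v i j] by auto
  qed
  \<comment> \<open>After adjustment the triple has at most \<open>3000 * w * h\<close> pairs. It
    lies in \<open>T\<close> up to \<open>1000 * w\<close> vertices and \<open>A\<close> lies in
    \<open>L\<close> up to \<open>w\<close> vertices per class, so they meet in at most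
    \<open>1001 * w\<close>, far below \<open>h / 2\<close>.\<close>
  have no_triple: False
    if I: "\<And>i. i \<in> I3 \<Longrightarrow> I i \<subseteq> T \<inter> V i" "\<And>i. i \<in> I3 \<Longrightarrow> real h - 1000 * w \<le> real (card (I i))"
      and sp: "\<And>i j. i \<in> I3 \<Longrightarrow> j \<in> I3 \<Longrightarrow> i \<noteq> j \<Longrightarrow> (\<Sum>v\<in>I i. nb v (I j)) \<le> 1000 * w * real h" for I
  proof -
    have "\<exists>I'. sparse_triple (1000 * w * real h + 2 * (1000 * w) * real h) I' \<and> (\<forall>i\<in>I3. real (card (I' i - I i)) \<le> 1000 * w)"
      by (rule sparse_triple_adjust[OF _ I(2) sp]) (use I(1) num in auto)
    then obtain B where B: "sparse_triple (1000 * w * real h + 2 * (1000 * w) * real h) B"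
      and BI: "\<And>i. i \<in> I3 \<Longrightarrow> real (card (B i - I i)) \<le> 1000 * w" by blast
    have "sparse_triple (4000 * w * real h) B" by (rule sparse_triple_mono[OF B]) (use num in simp)
    then obtain i where i: "i \<in> I3" "h < 2 * card (A i \<inter> B i)" using unique by blast
    note fAB = sparse_tripleD(3)[OF A i(1)] sparse_tripleD(3)[OF B i(1)]
    have "card (A i \<inter> B i) \<le> card ((A i - L) \<union> (B i - I i))"
      using fAB I(1)[OF i(1)] part(1) by (intro card_mono) auto
    also have "\<dots> \<le> card (A i - L) + card (B i - I i)" by (rule card_Un_le)
    finally have "real (card (A i \<inter> B i)) \<le> 1001 * w" using AL[OF i(1)] BI[OF i(1)] by linarith
    moreover have "real h < 2 * real (card (A i \<inter> B i))" using i(2) by linarith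
    ultimately show False using aw by linarith
  qed
  have no_indep: False
    if I: "\<And>i. i \<in> I3 \<Longrightarrow> I i \<subseteq> T \<inter> V i" "\<And>i. i \<in> I3 \<Longrightarrow> real h - 1000 * w \<le> real (card (I i))"
      "\<And>i j u v. i \<in> I3 \<Longrightarrow> j \<in> I3 \<Longrightarrow> i \<noteq> j \<Longrightarrow> u \<in> I i \<Longrightarrow> v \<in> I j \<Longrightarrow> \<not> E u v" for I
  proof (rule no_triple[of I, OF I(1,2)])
    fix i j assume ij: "i \<in> I3" "j \<in> I3" "i \<noteq> j"
    have "nb v (I j) = 0" if v: "v \<in> I i" for v
    proof -
      have "{u\<in>I j. E v u} = {}" using I(3)[OF ij v] by blast
      thus ?thesis by (simp only: nbrs_def card.empty of_nat_0)
    qed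
    hence "(\<Sum>v\<in>I i. nb v (I j)) = 0" by simp
    thus "(\<Sum>v\<in>I i. nb v (I j)) \<le> 1000 * w * real h" using num by simp
  qed
  \<comment> \<open>Without a triangle there would be a sparse triple with errors
    \<open>3 * d\<close> and \<open>8 * d * h\<close>; for \<open>d \<le> 100 * w\<close> both stay
    within the limits of \<open>no_triple\<close>.\<close>
  have triangle: "\<exists>F. is_triangle E F \<and> F \<subseteq> H" if H: "half_graph d H" "H \<subseteq> T" "0 < d" "d \<le> 100 * w" for H d
  proof (rule ccontr)
    assume none: "\<not> ?thesis"
    have "100 * d \<le> real h" using H(4) aw by linarith
    moreover have False if "u \<in> H" "v \<in> H" "x \<in> H" "E u v" "E v x" "E u x" for u v x
    proof -
      have "is_triangle E {u, v, x}" using that(4-6) by (rule triangleI)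
      moreover have "{u, v, x} \<subseteq> H" using that(1-3) by simp
      ultimately show False using none by blast
    qed
    ultimately obtain I where I0: "\<forall>i\<in>I3. I i \<subseteq> H \<inter> V i \<and> real h - 3 * d \<le> real (card (I i)) \<and>
      (\<forall>j\<in>I3. i \<noteq> j \<longrightarrow> (\<Sum>v\<in>I i. nb v (I j)) \<le> 8 * d * real h)"
      using sparse_triple_in_triangle_free[OF H(1) _ H(3)] by blast
    have I: "I i \<subseteq> H \<inter> V i" "real h - 3 * d \<le> real (card (I i))" if "i \<in> I3" for i
      using bspec[OF I0 that] by simp_all
    have I': "(\<Sum>v\<in>I i. nb v (I j)) \<le> 8 * d * real h" if "i \<in> I3" "j \<in> I3" "i \<noteq> j" for i j
      using bspec[OF I0 that(1)] that by simp
    show False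
    proof (rule no_triple[of I])
      show "I i \<subseteq> T \<inter> V i" if "i \<in> I3" for i using I(1)[OF that] H(2) by blast
      show "real h - 1000 * w \<le> real (card (I i))" if "i \<in> I3" for i using I(2)[OF that] H(4) num by linarith
      show "(\<Sum>v\<in>I i. nb v (I j)) \<le> 1000 * w * real h" if "i \<in> I3" "j \<in> I3" "i \<noteq> j" for i j
      proof -
        have "8 * d * real h \<le> 1000 * w * real h" using H(4) num by (intro mult_right_mono) linarith+
        thus ?thesis using I'[OF that] by linarith
      qed
    qed
  qed
  show ?thesis
  proof (cases "card L = 3 * h \<and> (\<forall>u\<in>L. \<forall>v\<in>L. \<not> E u v)")
    case True
    have wh: "w < real h" using num by linarith
    have indep: "\<not> E u v" if "u \<in> L" "v \<in> L" for u v using True that by blast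
    have cL: "card L = 3 * h" using True by blast
    have Lh: "card (L \<inter> V i) = h" if "i \<in> I3" for i
      by (rule independent_like_set(1)[OF P cL wh _ that]) (rule indep)
    have LE: "E u v \<longleftrightarrow> v \<notin> L" if "i \<in> I3" "j \<in> I3" "i \<noteq> j" "u \<in> V i" "v \<in> V j" "u \<in> L" for i j u v
      by (rule independent_like_set(2)[OF P cL wh _ that]) (rule indep)
    \<comment> \<open>An independent \<open>L\<close> of the exact size is completely joined to its
      complement, so no vertex is exceptional.\<close>
    have W0: "W = {}"
    proof (rule ccontr)
      assume "W \<noteq> {}"
      then obtain v where v: "v \<in> vtx - L" "v \<notin> T" unfolding W_def by blast
      then obtain i j where ij: "i \<in> I3" "v \<in> V i" "j \<in> I3" "j \<noteq> i" "\<not> nn v (L \<inter> V j) \<le> 2 * a"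
        unfolding T_def by blast
      have "{u\<in>L \<inter> V j. \<not> E v u} = {}" using LE[OF ij(3,1,4) _ ij(2)] v sym by blast
      hence "nn v (L \<inter> V j) = 0" by (simp only: nonnbrs_def card.empty of_nat_0)
      thus False using ij(5) num by linarith
    qed
    have LT: "L \<union> T = vtx" using part(4) W0 by blast
    have evT: "even (card T)"
    proof -
      have "card L + card T = card vtx" using LT part(1) finLTW by (metis card_Un_disjoint)
      hence "card T = 2 * (3 * h)" using cL card_vtx by simp
      thus ?thesis by simp
    qed
    have d3: "100 * (3 * w) \<le> real h" "0 < 3 * w" using aw by linarith+
    have "7 * real h \<le> 3 * w * (3 * w)"
    proof -
      have "w * w \<le> 3 * w * (3 * w)" using num by simp
      thus ?thesis using aw(4) by linarith
    qed
    note d3' = d3 this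
    show ?thesis
    proof (cases "perfect_matching T E")
      case pm: True
      have "triangle_packing (L \<union> T) (3 * h)"
      proof (rule packing_of_perfect_matching[OF LD(1) _ part(1) _ cL ac _ pm])
        show "T \<subseteq> vtx" using Tv by blast
        show "card ((L \<union> T) \<inter> V i) = 3 * h" if "i \<in> I3" for i using vtx_Int_class[OF that] card_V[OF that] LT by simp
        show "4 * (2 * a) \<le> real (card (L \<inter> V i))" if "i \<in> I3" for i using Lh[OF that] num by linarith
      qed
      thus ?thesis using LT by simp
    next
      case npm: False
      from half_graph_no_perfect_matching[OF HT d3' evT npm]
      show ?thesis
      proof
        assume "\<exists>I. \<forall>i\<in>I3. I i \<subseteq> T \<inter> V i \<and> real h - 13 * (3 * w) \<le> real (card (I i)) \<and>
          (\<forall>j\<in>I3. i \<noteq> j \<longrightarrow> (\<forall>u\<in>I i. \<forall>v\<in>I j. \<not> E u v))"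
        then obtain I where I0: "\<forall>i\<in>I3. I i \<subseteq> T \<inter> V i \<and> real h - 13 * (3 * w) \<le> real (card (I i)) \<and>
          (\<forall>j\<in>I3. i \<noteq> j \<longrightarrow> (\<forall>u\<in>I i. \<forall>v\<in>I j. \<not> E u v))" by (elim exE)
        have I: "I i \<subseteq> T \<inter> V i" "real h - 13 * (3 * w) \<le> real (card (I i))" if "i \<in> I3" for i
          using bspec[OF I0 that] by simp_all
        have I': "\<not> E u v" if "i \<in> I3" "j \<in> I3" "i \<noteq> j" "u \<in> I i" "v \<in> I j" for i j u v
          using bspec[OF I0 that(1)] that by simp
        have False
        proof (rule no_indep[of I, OF I(1) _ I'])
          show "real h - 1000 * w \<le> real (card (I i))" if "i \<in> I3" for i using I(2)[OF that] num by linarith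
        qed
        thus ?thesis by blast
      next
        assume "\<exists>C D. C \<union> D = T \<and> C \<inter> D = {} \<and> odd (card C) \<and> odd (card D) \<and> (\<forall>u\<in>C. \<forall>v\<in>D. \<not> E u v)"
        then obtain C D where CD: "C \<union> D = T" "C \<inter> D = {}" "odd (card C)" "odd (card D)"
          and no: "\<And>u v. u \<in> C \<Longrightarrow> v \<in> D \<Longrightarrow> \<not> E u v" by blast
        have no': "\<And>u v. u \<in> D \<Longrightarrow> v \<in> C \<Longrightarrow> \<not> E u v" using no sym by blast
        have CD': "D \<union> C = T" using CD(1) by blast
        have ne: "C \<noteq> {}" "D \<noteq> {}" using CD by auto
        have dh: "3 * w < real h" using num by linarith
        \<comment> \<open>The exact degree is decisive here: a vertex of \<open>X\<close> has at
          least \<open>2 * h\<close> neighbours in another class, at most \<open>h\<close> of them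
          in \<open>L\<close> and none in \<open>Y\<close>. Applied to both parts, the bounds add up
          to equality.\<close>
        have low: "h \<le> card (X \<inter> V i)"
          if X: "X \<union> Y = T" "X \<noteq> {}" "\<And>u v. u \<in> X \<Longrightarrow> v \<in> Y \<Longrightarrow> \<not> E u v" and i: "i \<in> I3" for X Y i
        proof -
          obtain j where j: "j \<in> I3" "j \<noteq> i" by (rule I3_other)
          have "real (card (X \<inter> V j)) > 0"
            using half_graph_side_card[OF HT X(1) X(3) X(2) dh j(1)] dh by linarith
          hence "X \<inter> V j \<noteq> {}" by auto
          then obtain v where v: "v \<in> X" "v \<in> V j" by blast
          have "{u\<in>V i. E v u} \<subseteq> L \<inter> V i \<union> X \<inter> V i"
            using X(1) X(3)[OF v(1)] LT i unfolding vtx_def by blast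
          hence "card {u\<in>V i. E v u} \<le> card (L \<inter> V i \<union> X \<inter> V i)" using i by (intro card_mono) auto
          also have "\<dots> \<le> card (L \<inter> V i) + card (X \<inter> V i)" by (rule card_Un_le)
          finally have "nb v (V i) \<le> real h + real (card (X \<inter> V i))" using Lh[OF i] unfolding nbrs_def by linarith
          moreover have "nb v (V i) \<ge> 2 * real h"
            using nbrs_plus_nonnbrs[OF fin[OF i], of E v] nonadj[OF j(1) i j(2) v(2)] card_V[OF i] by simp
          ultimately show ?thesis by linarith
        qed
        have sizes: "card (C \<inter> V i) = h" "card (D \<inter> V i) = h" if i: "i \<in> I3" for i
        proof -
          have "V i = L \<inter> V i \<union> (C \<inter> V i \<union> D \<inter> V i)" using LT CD(1) vtx_Int_class[OF i] by blast
          hence "card (V i) = card (L \<inter> V i \<union> (C \<inter> V i \<union> D \<inter> V i))" by simp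
          also have "\<dots> = card (L \<inter> V i) + card (C \<inter> V i \<union> D \<inter> V i)"
            using part(1) CD(1) i by (intro card_Un_disjoint) auto
          also have "card (C \<inter> V i \<union> D \<inter> V i) = card (C \<inter> V i) + card (D \<inter> V i)"
            using CD(2) i by (intro card_Un_disjoint) auto
          finally have "3 * h = h + (card (C \<inter> V i) + card (D \<inter> V i))" using Lh[OF i] card_V[OF i] by simp
          thus "card (C \<inter> V i) = h" "card (D \<inter> V i) = h" using low[OF CD(1) ne(1) no i] low[OF CD' ne(2) no' i] by linarith+
        qed
        have "gamma_split L C D" unfolding gamma_split_def
        proof (intro conjI ballI impI)
          show "L \<union> C \<union> D = vtx" using LT CD(1) by blast
          show "L \<inter> C = {}" "L \<inter> D = {}" using part(1) CD(1) by blast+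
          fix i j u v assume ij: "i \<in> I3" "j \<in> I3" "i \<noteq> j" and uv: "u \<in> V i" "v \<in> V j"
          have "u \<in> L \<or> u \<in> C \<or> u \<in> D" using LT CD(1) uv(1) ij(1) unfolding vtx_def by blast
          then consider "u \<in> L" "u \<notin> C" "u \<notin> D" | "u \<in> C" "u \<notin> L" "u \<notin> D" | "u \<in> D" "u \<notin> L" "u \<notin> C"
            using part(1) CD(1,2) by blast
          then show "E u v \<longleftrightarrow> (u \<in> L \<longrightarrow> v \<notin> L) \<and> (u \<in> C \<longrightarrow> v \<notin> D) \<and> (u \<in> D \<longrightarrow> v \<notin> C)"
          proof cases
            case 1
            then show ?thesis using LE[OF ij uv 1(1)] by blast
          next
            case 2
            have "E u v \<longleftrightarrow> v \<notin> D"
              by (rule adjacent_iff_of_full_nonnbrs[OF ij uv(1) sizes(2)[OF ij(2)] _ uv(2)]) (use no 2 in blast)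
            then show ?thesis using 2 by blast
          next
            case 3
            have "E u v \<longleftrightarrow> v \<notin> C"
              by (rule adjacent_iff_of_full_nonnbrs[OF ij uv(1) sizes(1)[OF ij(2)] _ uv(2)]) (use no' 3 in blast)
            then show ?thesis using 3 by blast
          qed
        qed (use Lh sizes CD(2) in auto)
        thus ?thesis by blast
      qed
    qed
  next
    case False
    have cLw: "real (card L) \<le> 3 * real h + 3 * w" "3 * real h - 3 * w \<le> real (card L)" using like_set_card[OF P] by auto
    \<comment> \<open>The off-by-one \<open>Suc q\<close> is deliberate: the edges of
      \<open>M\<close> and \<open>q\<close> triangles inside \<open>T\<close> leave \<open>L\<close>
      one vertex below balance, and one more triangle outside \<open>L\<close> is reserved for the
      parity exchange.\<close>
    have "\<exists>M q. finite M \<and> disjoint M \<and> (\<forall>T\<in>M. \<exists>u\<in>L. \<exists>v\<in>L. T = {u, v} \<and> E u v) \<and>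
      card L + Suc q = 3 * h + card M \<and> real (card M) \<le> 4 * w \<and> real q \<le> 4 * w"
    proof -
      consider "3 * h < card L" | u v where "card L = 3 * h" "u \<in> L" "v \<in> L" "E u v" | "card L < 3 * h"
        using False by force
      then show ?thesis
      proof cases
        case 1
        \<comment> \<open>One edge beyond the excess; this is at most twice the excess, because the
          excess is positive.\<close>
        define k where "k = Suc (card L - 3 * h)"
        have k: "k \<le> 2 * (card L - 3 * h)" using 1 by (simp add: k_def)
        obtain M where M: "finite M" "card M = k" "disjoint M" "\<forall>T\<in>M. \<exists>u\<in>L. \<exists>v\<in>L. T = {u, v} \<and> E u v"
          using disjoint_edges[of k L] edge_in_like_set[OF P num(4,5) h 1 k] by blast
        have "real k \<le> 4 * w" using 1 cLw(1) aw(2) by (simp add: k_def of_nat_diff)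
        thus ?thesis using M 1 num by (intro exI[of _ M] exI[of _ 0]) (simp add: k_def)
      next
        case (2 u v)
        thus ?thesis using aw(2) by (intro exI[of _ "{{u, v}}"] exI[of _ 0]) auto
      next
        case 3
        define q where "q = 3 * h - card L - 1"
        have "card L + Suc q = 3 * h" using 3 by (simp add: q_def)
        moreover have "real q \<le> 4 * w" using calculation cLw(2) num by linarith
        ultimately show ?thesis using num by (intro exI[of _ "{}"] exI[of _ q] conjI) simp_all
      qed
    qed
    then obtain M q where M: "finite M" "disjoint M" and M0: "\<forall>T\<in>M. \<exists>u\<in>L. \<exists>v\<in>L. T = {u, v} \<and> E u v"
      and count: "card L + Suc q = 3 * h + card M" and Mq: "real (card M) \<le> 4 * w" "real q \<le> 4 * w" by (elim exE conjE)
    have M3: "\<exists>u\<in>L. \<exists>v\<in>L. F = {u, v} \<and> E u v" if "F \<in> M" for F by (rule bspec[OF M0 that])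
    have "\<exists>B. finite B \<and> card B = q \<and> disjoint B \<and> (\<forall>F\<in>B. (is_triangle E F \<and> F \<subseteq> T) \<and> finite F \<and> card F \<le> 3)"
    proof (rule greedy_disjoint_sets)
      fix Z :: "'a set" assume Z: "finite Z" "card Z \<le> 3 * q"
      have "real (card (Z \<inter> V i)) \<le> 12 * w" for i
      proof -
        have "card (Z \<inter> V i) \<le> card Z" using Z(1) by (intro card_mono) auto
        thus ?thesis using Z(2) Mq(2) by linarith
      qed
      hence "half_graph (3 * w + 12 * w) (T - Z)" using num by (intro half_graph_Diff[OF HT]) auto
      then obtain F where F: "is_triangle E F" "F \<subseteq> T - Z" using triangle[of "3 * w + 12 * w" "T - Z"] num by auto
      thus "\<exists>F. (is_triangle E F \<and> F \<subseteq> T) \<and> finite F \<and> F \<noteq> {} \<and> card F \<le> 3 \<and> F \<inter> Z = {}"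
        using triangle_props(1,2,4)[OF F(1)] by (intro exI[of _ F]) auto
    qed
    then obtain B where B: "finite B" "card B = q" "disjoint B" "\<And>F. F \<in> B \<Longrightarrow> is_triangle E F" "\<And>F. F \<in> B \<Longrightarrow> F \<subseteq> T" by blast
    define S where "S = (\<lambda>v. {v}) ` W"
    define J where "J = S \<union> M \<union> B"
    have MS: "F \<subseteq> L" "F \<noteq> {}" "finite F" "card F \<le> 3" if F: "F \<in> M" for F
    proof -
      obtain u v where "u \<in> L" "v \<in> L" "F = {u, v}" using M3[OF F] by blast
      thus "F \<subseteq> L" "F \<noteq> {}" "finite F" "card F \<le> 3" by (auto simp: card_insert_if)
    qed
    have SS: "F \<subseteq> W" "F \<noteq> {}" if "F \<in> S" for F using that by (auto simp: S_def)
    have BS: "F \<noteq> {}" if "F \<in> B" for F by (rule triangle_props(4)[OF B(4)[OF that]])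
    have sepI: "X \<inter> X' = {}"
      if "\<And>F. F \<in> X \<Longrightarrow> F \<subseteq> R" "\<And>F. F \<in> X \<Longrightarrow> F \<noteq> {}" "\<And>F. F \<in> X' \<Longrightarrow> F \<subseteq> R'" "R \<inter> R' = {}"
      for X X' :: "'a set set" and R R'
    proof (rule equals0I)
      fix F assume "F \<in> X \<inter> X'"
      hence "F \<in> X" "F \<in> X'" by auto
      thus False using that(1,2)[of F] that(3)[of F] that(4) by blast
    qed
    have WL: "W \<inter> L = {}" "W \<inter> T = {}" using part(2,3) by auto
    have sep: "S \<inter> M = {}" "S \<inter> B = {}" "M \<inter> B = {}"
      using sepI[OF SS MS(1) WL(1)] sepI[OF SS B(5) WL(2)] sepI[OF MS(1,2) B(5) part(1)] by simp_all
    have finS: "finite S" "card S = card W" using finLTW(3) by (auto simp: S_def card_image)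
    have finJ: "finite J" using finS M(1) B(1) by (simp add: J_def)
    have cJ: "card J = card W + card M + q"
    proof -
      have "card J = card (S \<union> M) + card B" unfolding J_def using finS M(1) B(1) sep by (intro card_Un_disjoint) auto
      also have "card (S \<union> M) = card S + card M" using finS M(1) sep by (intro card_Un_disjoint) auto
      finally show ?thesis using finS B(2) by simp
    qed
    have cJw: "real (card J) \<le> 14 * w" using cJ cW Mq by linarith
    have disJ: "disjoint J" unfolding disjoint_def
    proof (intro ballI impI)
      fix F G assume FG: "F \<in> J" "G \<in> J" "F \<noteq> G"
      have in_L: "F \<subseteq> L" if "F \<in> M" for F using MS(1)[OF that] .
      have in_W: "F \<subseteq> W" if "F \<in> S" for F using SS(1)[OF that] .
      have in_T: "F \<subseteq> T" if "F \<in> B" for F using B(5)[OF that] .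
      consider "F \<in> S" "G \<in> S" | "F \<in> M" "G \<in> M" | "F \<in> B" "G \<in> B"
        | "F \<in> S \<and> G \<in> M \<or> F \<in> M \<and> G \<in> S" | "F \<in> S \<and> G \<in> B \<or> F \<in> B \<and> G \<in> S" | "F \<in> M \<and> G \<in> B \<or> F \<in> B \<and> G \<in> M"
        using FG(1,2) unfolding J_def by blast
      then show "F \<inter> G = {}"
      proof cases
        case 1 then show ?thesis using FG(3) by (auto simp: S_def)
      next
        case 2 then show ?thesis using FG(3) M(2) unfolding disjoint_def by blast
      next
        case 3 then show ?thesis using FG(3) B(3) unfolding disjoint_def by blast
      next
        case 4 then show ?thesis using in_L in_W part(2) by blast
      next
        case 5 then show ?thesis using in_T in_W part(3) by blast
      next
        case 6 then show ?thesis using in_L in_T part(1) by blast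
      qed
    qed
    \<comment> \<open>A triangle over an edge of \<open>M\<close> takes two vertices of
      \<open>L\<close>, one over a vertex of \<open>W\<close> takes one, and the triangles of
      \<open>B\<close>, already complete, take none.\<close>
    define Q where "Q t F \<longleftrightarrow> is_triangle E F \<and> card (F \<inter> L) = (if t \<in> M then 2 else if t \<in> B then 0 else 1)" for t F
    have Tup: "real (card (V k - T)) \<le> real h + 3 * w" if k: "k \<in> I3" for k
    proof -
      have "V k - T = V k - T \<inter> V k" by blast
      thus ?thesis using real_card_Diff[OF fin[OF k], of "T \<inter> V k"] half_graphD(2)[OF HT k] card_V[OF k] by simp
    qed
    have "\<exists>F. (\<forall>t\<in>J. Q t (F t) \<and> t \<subseteq> F t \<and> finite (F t) \<and> card (F t) \<le> 3) \<and> disjoint_family_on F J"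
    proof (rule greedy_disjoint_extension[OF finJ disJ])
      show "finite t \<and> card t \<le> 3" if "t \<in> J" for t
        using that MS(3,4)[of t] triangle_props(1,2)[OF B(4), of t] unfolding J_def S_def by auto
      fix t Z assume t: "t \<in> J" and Z: "finite Z" "card Z \<le> 3 * card J" "Z \<inter> t = {}"
      have Z42: "real (card Z) \<le> 42 * w" using Z(2) cJw by linarith
      consider v where "v \<in> W" "t = {v}" "t \<notin> M" "t \<notin> B" | "t \<in> M" | "t \<in> B" "t \<notin> M"
        using t sep unfolding J_def S_def by blast
      then show "\<exists>F. Q t F \<and> t \<subseteq> F \<and> finite F \<and> card F \<le> 3 \<and> F \<inter> Z = {}"
      proof cases
        case (1 v)
        have vv: "v \<in> vtx" "v \<notin> L" "v \<notin> T" using 1(1) by (auto simp: W_def)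
        obtain i where i: "i \<in> I3" "v \<in> V i" using exists_class[OF vv(1)] by blast
        obtain j where j: "j \<in> I3" "j \<noteq> i" "nb v (P \<inter> V j) \<ge> a - w" using LD(9)[OF i vv(2)] by blast
        obtain k where k: "k \<in> I3" "k \<noteq> i" "k \<noteq> j" by (rule I3_third[OF i(1) j(1) j(2)[symmetric]])
        have "nb v (P \<inter> V j) > real (card Z)" using j(3) Z42 aw by linarith
        then obtain x where x: "x \<in> P \<inter> V j" "E v x" "x \<notin> Z" by (rule obtain_nbr[OF fin_Int[OF j(1)] Z(1)])
        have xL: "x \<in> L" using x LD(2) by blast
        have "nb v (V k) \<le> nb v (T \<inter> V k) + real (card (V k - T \<inter> V k))"
          using fin[OF k(1)] by (intro nbrs_le_plus_card) auto
        moreover have "V k - T \<inter> V k = V k - T" by blast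
        moreover have "nb v (V k) \<ge> 2 * real h"
          using nbrs_plus_nonnbrs[OF fin[OF k(1)], of E v] nonadj[OF i(1) k(1) k(2)[symmetric] i(2)] card_V[OF k(1)] by simp
        ultimately have deg: "nb v (T \<inter> V k) \<ge> real h - 3 * w" using Tup[OF k(1)] by simp
        have "nn x (T \<inter> V k) \<le> nn x (V k - L)" using Tv fin[OF k(1)] by (intro nonnbrs_mono) auto
        hence "nn x (T \<inter> V k) \<le> a / 2" using LD(7)[OF j(1) k(1) k(3)[symmetric], of x] x by auto
        hence "nb v (T \<inter> V k) > nn x (T \<inter> V k) + real (card Z)" using deg Z42 aw by linarith
        then obtain y where y: "y \<in> T \<inter> V k" "E v y" "E x y" "y \<notin> Z"
          by (rule obtain_common_nbr[OF fin_Int[OF k(1)] Z(1)])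
        have tri: "is_triangle E {v, x, y}" by (rule triangleI[OF x(2) y(3,2)])
        have "{v, x, y} \<inter> L = {x}" using vv xL y part(1) by auto
        hence "Q t {v, x, y}" using tri 1 by (simp add: Q_def)
        thus ?thesis using 1 x y Z(3) triangle_props(1,2)[OF tri] by (intro exI[of _ "{v, x, y}"]) auto
      next
        case 2
        obtain u v where uv: "u \<in> L" "v \<in> L" "t = {u, v}" "E u v" using M3[OF 2] by blast
        obtain i j where ij: "i \<in> I3" "j \<in> I3" "i \<noteq> j" "u \<in> V i" "v \<in> V j" using cross[OF uv(4)] by blast
        obtain k where k: "k \<in> I3" "k \<noteq> i" "k \<noteq> j" by (rule I3_third[OF ij(1-3)])
        have "nn u (T \<inter> V k) \<le> 2 * a" by (rule acompD[OF ac ij(1) k(1) k(2)[symmetric] uv(1) ij(4)])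
        moreover have "nn v (T \<inter> V k) \<le> 2 * a" by (rule acompD[OF ac ij(2) k(1) k(3)[symmetric] uv(2) ij(5)])
        ultimately have "nb u (T \<inter> V k) > nn v (T \<inter> V k) + real (card Z)"
          using nbrs_plus_nonnbrs_Int[OF k(1), of u T] half_graphD(2)[OF HT k(1)] Z42 aw by linarith
        then obtain y where y: "y \<in> T \<inter> V k" "E u y" "E v y" "y \<notin> Z"
          by (rule obtain_common_nbr[OF fin_Int[OF k(1)] Z(1)])
        have tri: "is_triangle E {u, v, y}" by (rule triangleI[OF uv(4) y(3,2)])
        have "{u, v, y} \<inter> L = {u, v}" using uv y part(1) by auto
        moreover have "u \<noteq> v" using uv(4) irrefl by blast
        ultimately have "Q t {u, v, y}" using tri 2 by (simp add: Q_def)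
        thus ?thesis using uv y Z(3) triangle_props(1,2)[OF tri] by (intro exI[of _ "{u, v, y}"]) auto
      next
        case 3
        have "t \<inter> L = {}" using B(5)[OF 3(1)] part(1) by blast
        hence "Q t t" using 3 B(4) by (simp add: Q_def)
        thus ?thesis using Z(3) triangle_props(1,2)[OF B(4)[OF 3(1)]] by (intro exI[of _ t]) auto
      qed
    qed
    then obtain F where F: "\<And>t. t \<in> J \<Longrightarrow> Q t (F t) \<and> t \<subseteq> F t \<and> finite (F t)" and dF: "disjoint_family_on F J"
      by blast
    have triF: "is_triangle E (F t)" if "t \<in> J" for t using F[OF that] by (simp add: Q_def)
    define Y where "Y = (\<Union>t\<in>J. F t)"
    have Yv: "Y \<subseteq> vtx" unfolding Y_def using triF triangle_props(3) by blast
    have packY: "triangle_packing Y (card J)"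
      by (rule triangle_packing_family[OF finJ dF triF]) (auto simp: Y_def)
    have finF: "\<And>t. t \<in> J \<Longrightarrow> finite (F t)" using F by blast
    have YV: "card (Y \<inter> V i) = card J" if "i \<in> I3" for i
    proof -
      have "card (V i \<inter> Y) = (\<Sum>t\<in>J. card (V i \<inter> F t))"
        unfolding Y_def by (rule card_Int_UN_disjoint_family[OF finJ dF finF])
      also have "\<dots> = (\<Sum>t\<in>J. 1)"
        by (rule sum.cong[OF refl]) (metis triF triangle_props(5) that Int_commute)
      finally show ?thesis by (simp add: Int_commute)
    qed
    have YL: "card (L \<inter> Y) = card W + 2 * card M"
    proof -
      have "card (L \<inter> Y) = (\<Sum>t\<in>J. card (L \<inter> F t))"
        unfolding Y_def by (rule card_Int_UN_disjoint_family[OF finJ dF finF])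
      also have "\<dots> = (\<Sum>t\<in>J. if t \<in> M then 2 else if t \<in> B then 0 else 1)"
        by (rule sum.cong[OF refl]) (use F in \<open>auto simp: Q_def Int_commute\<close>)
      also have "\<dots> = (\<Sum>t\<in>S \<union> M. if t \<in> M then 2 else if t \<in> B then 0 else 1) + (\<Sum>t\<in>B. if t \<in> M then 2 else if t \<in> B then 0 else 1)"
        unfolding J_def using finS M(1) B(1) sep by (intro sum.union_disjoint) auto
      also have "(\<Sum>t\<in>S \<union> M. if t \<in> M then 2 else if t \<in> B then 0 else 1) =
          (\<Sum>t\<in>S. if t \<in> M then 2 else if t \<in> B then 0 else 1) + (\<Sum>t\<in>M. if t \<in> M then 2 else if t \<in> B then 0 else (1::nat))"
        using finS M(1) sep by (intro sum.union_disjoint) auto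
      also have "(\<Sum>t\<in>S. if t \<in> M then 2 else if t \<in> B then 0 else 1) = (\<Sum>t\<in>S. 1::nat)"
        by (rule sum.cong[OF refl]) (use sep in auto)
      also have "(\<Sum>t\<in>M. if t \<in> M then 2 else if t \<in> B then 0 else 1) = (\<Sum>t\<in>M. 2::nat)"
        by (rule sum.cong[OF refl]) auto
      also have "(\<Sum>t\<in>B. if t \<in> M then 2 else if t \<in> B then 0 else 1) = (\<Sum>t\<in>B. 0::nat)"
        by (rule sum.cong[OF refl]) (use sep in auto)
      finally show ?thesis using finS(2) by simp
    qed
    have WY: "W \<subseteq> Y"
    proof
      fix v assume "v \<in> W"
      hence "{v} \<in> J" by (simp add: J_def S_def)
      thus "v \<in> Y" using F[of "{v}"] unfolding Y_def by blast
    qed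
    define H where "H = T - Y"
    define L' where "L' = L - Y"
    have L'H: "L' \<union> H = vtx - Y" using part(4) WY by (auto simp: L'_def H_def)
    have L'H0: "L' \<inter> H = {}" using part(1) by (auto simp: L'_def H_def)
    define m where "m = 3 * h - card J"
    have Jh: "card J < 3 * h" using cJw num h by linarith
    \<comment> \<open>The triangles use \<open>card W + 2 * card M\<close> vertices of
      \<open>L\<close>, and \<open>card J\<close> is \<open>card W + card M + q\<close>. By
      \<open>count\<close>, one vertex fewer than \<open>m\<close> remains.\<close>
    have cL': "card L' + 1 = m"
    proof -
      have "card L' = card L - card (L \<inter> Y)" unfolding L'_def by (rule card_Diff_subset_Int) (use finLTW in auto)
      moreover have "card (L \<inter> Y) \<le> card L" using finLTW by (intro card_mono) auto
      ultimately show ?thesis using YL cJ count Jh unfolding m_def by linarith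
    qed
    have cXV: "card ((vtx - Y) \<inter> V i) = m" if i: "i \<in> I3" for i
    proof -
      have "(vtx - Y) \<inter> V i = V i - Y \<inter> V i" using vtx_Int_class[OF i] by blast
      moreover have "card (V i - Y \<inter> V i) = card (V i) - card (Y \<inter> V i)" by (rule card_Diff_subset) (use i in auto)
      ultimately show ?thesis using YV[OF i] card_V[OF i] by (simp add: m_def)
    qed
    have hgH: "half_graph (17 * w) H"
    proof -
      have "half_graph (3 * w + 14 * w) (T - Y)" by (rule half_graph_Diff[OF HT]) (use YV cJw num in auto)
      thus ?thesis by (simp add: H_def)
    qed
    have HT': "H \<subseteq> T" by (auto simp: H_def)
    \<comment> \<open>The reserved triangle: without it, \<open>H\<close> has
      \<open>2 * (m - 1)\<close> vertices against \<open>m - 1\<close> in \<open>L'\<close>. It will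
      be exchanged for \<open>t'\<close>.\<close>
    obtain t where t: "is_triangle E t" "t \<subseteq> H" using triangle[OF hgH HT'] num by auto
    have cH: "card H = 2 * m + 1"
    proof -
      have X: "vtx - Y \<subseteq> vtx" by blast
      have "card (vtx - Y) = 3 * m"
        using card_vtx_split[OF _ _ _ _ X, of 1 2 3] cXV[OF I3_mem(1)] cXV[OF I3_mem(2)] cXV[OF I3_mem(3)] by (simp add: I3_def)
      moreover have "card (L' \<union> H) = card L' + card H"
        by (rule card_Un_disjoint) (use finLTW L'H0 in \<open>auto simp: L'_def H_def\<close>)
      ultimately show ?thesis using L'H cL' by simp
    qed
    have finH: "finite H" using finLTW by (simp add: H_def)
    have cHt: "card (H - t) = card H - 3" if "is_triangle E t" "t \<subseteq> H" for t
      using card_Diff_subset[OF triangle_props(1)[OF that(1)] that(2)] triangle_props(2)[OF that(1)] by simp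
    have "even (card (H - t))"
    proof -
      have "card t \<le> card H" using t finH by (intro card_mono) auto
      hence "card (H - t) = 2 * (m - 1)" using cHt[OF t] cH triangle_props(2)[OF t(1)] by simp
      thus ?thesis by simp
    qed
    \<comment> \<open>\<open>H\<close> satisfies the degree bounds with error \<open>17 * w\<close>;
      removing a triangle costs one more vertex per class, which \<open>1 \<le> w\<close>
      absorbs.\<close>
    have e: "100 * (18 * w) \<le> real h" "1 \<le> 18 * w" "17 * w + 1 \<le> 18 * w" using aw by linarith+
    have e2: "7 * real h \<le> 18 * w * (18 * w)"
    proof -
      have "w * w \<le> 18 * w * (18 * w)" using num by simp
      thus ?thesis using aw(4) by linarith
    qed
    have "\<exists>t'. is_triangle E t' \<and> t' \<subseteq> H \<and> perfect_matching (H - t') E"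
    proof (rule perfect_matching_after_triangle[OF hgH e(1,2) e2 e(3) t \<open>even (card (H - t))\<close>])
      fix I assume I: "\<And>i. i \<in> I3 \<Longrightarrow> I i \<subseteq> H \<inter> V i" "\<And>i. i \<in> I3 \<Longrightarrow> real h - 13 * (18 * w) \<le> real (card (I i))"
        "\<And>i j u v. i \<in> I3 \<Longrightarrow> j \<in> I3 \<Longrightarrow> i \<noteq> j \<Longrightarrow> u \<in> I i \<Longrightarrow> v \<in> I j \<Longrightarrow> \<not> E u v"
      show False
      proof (rule no_indep[of I, OF _ _ I(3)])
        show "I i \<subseteq> T \<inter> V i" if "i \<in> I3" for i using I(1)[OF that] HT' by blast
        show "real h - 1000 * w \<le> real (card (I i))" if "i \<in> I3" for i using I(2)[OF that] num by linarith
      qed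
    qed
    then obtain t' where t': "is_triangle E t'" "t' \<subseteq> H" and pm: "perfect_matching (H - t') E" by blast
    have "triangle_packing (L' \<union> (H - t')) (m - 1)"
    proof (rule packing_of_perfect_matching[OF _ _ _ _ _ _ _ pm])
      show "L' \<subseteq> vtx" "H - t' \<subseteq> vtx" using LD(1) Tv by (auto simp: L'_def H_def)
      show "L' \<inter> (H - t') = {}" using L'H0 by blast
      show "card ((L' \<union> (H - t')) \<inter> V i) = m - 1" if i: "i \<in> I3" for i
      proof -
        have "(L' \<union> (H - t')) \<inter> V i = (vtx - Y) \<inter> V i - t' \<inter> V i" using L'H L'H0 t'(2) by blast
        moreover have "card ((vtx - Y) \<inter> V i - t' \<inter> V i) = card ((vtx - Y) \<inter> V i) - card (t' \<inter> V i)"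
          by (rule card_Diff_subset) (use i t'(2) L'H in auto)
        ultimately show ?thesis using cXV[OF i] triangle_props(5)[OF t'(1) i] by simp
      qed
      show "card L' = m - 1" using cL' by simp
      show "acomp (2 * a) L' (H - t')" by (rule acomp_mono[OF ac]) (auto simp: L'_def H_def)
      show "4 * (2 * a) \<le> real (card (L' \<inter> V i))" if i: "i \<in> I3" for i
      proof -
        have "real (card (L \<inter> V i)) \<le> real (card (L' \<inter> V i)) + real (card (L \<inter> V i - L' \<inter> V i))"
          by (rule card_le_plus_Diff) (use i in auto)
        moreover have "card (L \<inter> V i - L' \<inter> V i) \<le> card (Y \<inter> V i)" using i by (intro card_mono) (auto simp: L'_def)
        ultimately show ?thesis using YV[OF i] cJw LD(3)[OF i] aw by linarith
      qed
    qed
    moreover have "triangle_packing t' 1"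
      using triangle_packing_family[of "{t'}" "\<lambda>t. t" t'] t'(1) by (simp add: disjoint_family_on_def)
    moreover have "(L' \<union> (H - t')) \<inter> t' = {}" using L'H0 t'(2) by blast
    ultimately have "triangle_packing (L' \<union> (H - t') \<union> t') (m - 1 + 1)" by (rule triangle_packing_Un)
    moreover have "L' \<union> (H - t') \<union> t' = vtx - Y" using L'H t'(2) by blast
    moreover have "m - 1 + 1 = m" using cL' by simp
    ultimately have "triangle_packing (vtx - Y) m" by simp
    from triangle_packing_Un[OF packY this] have "triangle_packing (Y \<union> (vtx - Y)) (card J + m)" by blast
    moreover have "Y \<union> (vtx - Y) = vtx" "card J + m = 3 * h" using Yv Jh by (auto simp: m_def)
    ultimately show ?thesis by simp
  qed
qed

end

section \<open>The extremal graph\<close>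

context tripartite
begin

lemma packing_or_gamma_split_of_sparse_triple:
  assumes A: "sparse_triple (real h * real h / 10 ^ 25) A" and h: "7 * 10 ^ 42 \<le> real h"
  shows "triangle_packing vtx (3 * h) \<or> (\<exists>L C D. gamma_split L C D)"
proof -
  \<comment> \<open>The exponents satisfy the chain \<open>h^2 / 10^25 \<le> a * w1 / 8\<close>,
    \<open>4000 * w1 * h \<le> a * w2 / 8\<close>, \<open>210 * h * w2 \<le> a * w3 / 8\<close> and
    \<open>1000 * w3 \<le> a\<close>: \<open>w1\<close> serves a unique triple, \<open>w2\<close> a
    second one, and \<open>w3\<close> a third one obtained from these two.\<close>
  define a where "a = real h / 10 ^ 3"
  define w1 where "w1 = real h / 10 ^ 21"
  define w2 where "w2 = real h / 10 ^ 13"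
  define w3 where "w3 = real h / 10 ^ 6"
  note defs = a_def w1_def w2_def w3_def
  have h0: "0 < real h" using h by simp
  show ?thesis
  proof (cases "\<exists>B. sparse_triple (4000 * w1 * real h) B \<and> (\<forall>i\<in>I3. 2 * card (A i \<inter> B i) \<le> h)")
    case True
    then obtain B where B: "sparse_triple (4000 * w1 * real h) B" "\<And>i. i \<in> I3 \<Longrightarrow> 2 * card (A i \<inter> B i) \<le> h"
      by blast
    have "triangle_packing vtx (3 * h)"
    proof (rule packing_of_second_triple[of a w2 A B w3])
      show "sparse_triple (a * w2 / 8) A" by (rule sparse_triple_mono[OF A]) (use h0 in \<open>simp add: defs field_simps\<close>)
      show "sparse_triple (a * w2 / 8) B" by (rule sparse_triple_mono[OF B(1)]) (use h0 in \<open>simp add: defs field_simps\<close>)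
      show "1000 * w3 \<le> a" "0 < w2" "w2 \<le> w3" "1000 * a \<le> real h" "210 * real h * w2 \<le> a * w3 / 8"
        using h0 by (simp_all add: defs field_simps)
    qed (rule B(2))
    thus ?thesis ..
  next
    case False
    show ?thesis
    proof (rule packing_or_gamma_split[of a w1 A])
      show "sparse_triple (a * w1 / 8) A" by (rule sparse_triple_mono[OF A]) (use h0 in \<open>simp add: defs field_simps\<close>)
      show "5000 * w1 \<le> a" "1000 * a \<le> real h" using h0 by (simp_all add: defs field_simps)
      show "1 \<le> w1" using h by (simp add: w1_def)
      \<comment> \<open>As \<open>w1 * w1\<close> is \<open>h * h / 10 ^ 42\<close>, the lower bound
        on \<open>h\<close> amounts to \<open>7 * h \<le> w1 * w1\<close>.\<close>
      have "7 * 10 ^ 42 * real h \<le> real h * real h" using h h0 by (intro mult_right_mono) auto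
      thus "7 * real h \<le> w1 * w1" by (simp add: w1_def field_simps)
      show "\<exists>i\<in>I3. h < 2 * card (A i \<inter> B i)" if "sparse_triple (4000 * w1 * real h) B" for B
        using False that by (auto simp: not_le)
    qed
  qed
qed

text \<open>Every type has exactly \<open>h\<close> vertices in each class. Adjacency depends only
  on class and type, so these cells may be numbered arbitrarily.\<close>

lemma tripartite_isomorphic_of_gamma_split:
  assumes g: "gamma_split L C D"
  shows "tripartite_isomorphic V E (blowup_class gamma3_class h) (blowup_adj gamma3_adj h)"
proof -
  define S where "S j = (if j = 1 then L else if j = 2 then C else D)" for j :: nat
  have S [simp]: "S 1 = L" "S (Suc 0) = L" "S 2 = C" "S 3 = D" by (simp_all add: S_def)
  define ty where "ty v = (if v \<in> L then 1 else if v \<in> C then 2 else 3 :: nat)" for v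
  have parts: "L \<union> C \<union> D = vtx" "L \<inter> C = {}" "L \<inter> D = {}" "C \<inter> D = {}"
    using g unfolding gamma_split_def by blast+
  have ty: "ty v \<in> I3" "v \<in> S (ty v)" if "v \<in> vtx" for v
    using that parts by (auto simp: ty_def I3_def)
  have ty_eq: "ty v = j" if "v \<in> S j" "j \<in> I3" for v j
    using that parts by (elim I3_cases) (auto simp: ty_def simp del: One_nat_def)
  have cS: "card (S j \<inter> V i) = h" if "i \<in> I3" "j \<in> I3" for i j
  proof -
    have "card (L \<inter> V i) = h" "card (C \<inter> V i) = h" "card (D \<inter> V i) = h"
      using g that(1) unfolding gamma_split_def by blast+
    thus ?thesis using that(2) by (elim I3_cases) (simp_all del: One_nat_def)
  qed
  have "\<exists>g. bij_betw g (S j \<inter> V i) {..<h}" if "i \<in> I3" "j \<in> I3" for i j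
    using that cS[OF that] by (intro finite_same_card_bij) auto
  then obtain G where G: "\<And>i j. i \<in> I3 \<Longrightarrow> j \<in> I3 \<Longrightarrow> bij_betw (G i j) (S j \<inter> V i) {..<h}" by metis
  define cl where "cl v = (SOME i. i \<in> I3 \<and> v \<in> V i)" for v
  have cl: "cl v = i" if "i \<in> I3" "v \<in> V i" for v i
    unfolding cl_def by (rule some_equality) (use that class_unique in blast)+
  define f where "f v = ((cl v, ty v), G (cl v) (ty v) v)" for v
  have fV: "f v = ((i, ty v), G i (ty v) v)" if "i \<in> I3" "v \<in> V i" for v i
    using cl[OF that] by (simp add: f_def)
  have Vv: "V i \<subseteq> vtx" if "i \<in> I3" for i using that unfolding vtx_def by blast
  have Glt: "G i (ty v) v < h" if "i \<in> I3" "v \<in> V i" for v i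
  proof -
    have "v \<in> vtx" using Vv that by blast
    thus ?thesis using G[OF that(1) ty(1)] ty(2) that unfolding bij_betw_def by blast
  qed
  have img: "f ` V i = blowup_class gamma3_class h i" if i: "i \<in> I3" for i
  proof
    show "f ` V i \<subseteq> blowup_class gamma3_class h i"
    proof (rule image_subsetI)
      fix v assume v: "v \<in> V i"
      have "ty v \<in> {1, 2, 3}" using ty(1)[of v] Vv[OF i] v unfolding I3_def by blast
      thus "f v \<in> blowup_class gamma3_class h i"
        using fV[OF i v] Glt[OF i v] unfolding blowup_class_def gamma3_class_def by simp
    qed
    show "blowup_class gamma3_class h i \<subseteq> f ` V i"
    proof
      fix x assume "x \<in> blowup_class gamma3_class h i"
      then obtain j k where x: "x = ((i, j), k)" "j \<in> I3" "k < h"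
        unfolding blowup_class_def gamma3_class_def I3_def by blast
      hence "k \<in> G i j ` (S j \<inter> V i)" using G[OF i x(2)] by (auto simp: bij_betw_def)
      then obtain v where v: "v \<in> S j" "v \<in> V i" "k = G i j v" by blast
      hence "f v = x" using fV[OF i v(2)] ty_eq[OF v(1) x(2)] x(1) by simp
      thus "x \<in> f ` V i" using v(2) by blast
    qed
  qed
  have inj: "inj_on f (\<Union>i\<in>I3. V i)"
  proof (rule inj_onI)
    fix u v assume u: "u \<in> (\<Union>i\<in>I3. V i)" and v: "v \<in> (\<Union>i\<in>I3. V i)" and eq: "f u = f v"
    obtain i where i: "i \<in> I3" "u \<in> V i" using u by blast
    obtain j where j: "j \<in> I3" "v \<in> V j" using v by blast
    have e: "i = j" "ty u = ty v" "G i (ty u) u = G i (ty u) v" using eq fV[OF i] fV[OF j] by auto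
    have uv: "u \<in> vtx" "v \<in> vtx" using u v by (auto simp: vtx_def)
    have "inj_on (G i (ty u)) (S (ty u) \<inter> V i)" using G[OF i(1) ty(1)[OF uv(1)]] by (simp add: bij_betw_def)
    thus "u = v" using e i j ty(2)[OF uv(1)] ty(2)[OF uv(2)] unfolding inj_on_def by auto
  qed
  have adj: "E u v \<longleftrightarrow> blowup_adj gamma3_adj h (f u) (f v)" if ij: "i \<in> I3" "j \<in> I3" "u \<in> V i" "v \<in> V j" for u v i j
  proof -
    have fu: "f u = ((i, ty u), G i (ty u) u)" "f v = ((j, ty v), G j (ty v) v)" using fV ij by blast+
    have b: "blowup_adj gamma3_adj h (f u) (f v) \<longleftrightarrow> gamma3_adj (i, ty u) (j, ty v)"
      unfolding fu blowup_adj_def using Glt ij by simp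
    have uv: "u \<in> vtx" "v \<in> vtx" using Vv ij by blast+
    have t: "ty u \<in> {1,2,3}" "ty v \<in> {1,2,3}" "i \<in> {1,2,3}" "j \<in> {1,2,3}" using ty(1)[OF uv(1)] ty(1)[OF uv(2)] ij(1,2) by (simp_all only: I3_def)
    show ?thesis
    proof (cases "i = j")
      case True
      then show ?thesis using not_adj_same[OF ij(2), of u v] ij b by (auto simp: gamma3_adj_def)
    next
      case False
      have E: "E u v \<longleftrightarrow> (u \<in> L \<longrightarrow> v \<notin> L) \<and> (u \<in> C \<longrightarrow> v \<notin> D) \<and> (u \<in> D \<longrightarrow> v \<notin> C)"
        using g ij False unfolding gamma_split_def by blast
      have "gamma3_adj (i, ty u) (j, ty v) \<longleftrightarrow>
        (ty u \<noteq> ty v \<and> 1 \<in> {ty u, ty v} \<or> ty u = 2 \<and> ty v = 2 \<or> ty u = 3 \<and> ty v = 3)"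
        unfolding gamma3_adj_def using t False by simp
      moreover have "\<dots> \<longleftrightarrow> (u \<in> L \<longrightarrow> v \<notin> L) \<and> (u \<in> C \<longrightarrow> v \<notin> D) \<and> (u \<in> D \<longrightarrow> v \<notin> C)"
        using uv parts unfolding ty_def by auto
      ultimately show ?thesis using E b by blast
    qed
  qed
  have "bij_betw f (\<Union>i\<in>I3. V i) (\<Union>i\<in>I3. blowup_class gamma3_class h i)"
    unfolding bij_betw_def using inj img by (simp add: image_UN)
  thus ?thesis unfolding tripartite_isomorphic_def using img adj unfolding I3_def[symmetric] by (intro exI[of _ f]) blast
qed

end

theorem theorem4:
  "\<exists>\<Delta>\<^sub>0>0::real. \<forall>\<Delta>::real. 0 < \<Delta> \<and> \<Delta> \<le> \<Delta>\<^sub>0 \<longrightarrow>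
     (\<exists>N\<^sub>0::nat. \<forall>N\<ge>N\<^sub>0. 3 dvd N \<longrightarrow>
       (\<forall>(V :: nat \<Rightarrow> 'a set) (E :: 'a \<Rightarrow> 'a \<Rightarrow> bool) (A :: nat \<Rightarrow> 'a set).
          balanced_tripartite_graph N V E \<longrightarrow>
          (\<forall>i\<in>{1,2,3}. \<forall>j\<in>{1,2,3}. i \<noteq> j \<longrightarrow>
             (\<forall>v\<in>V i. real (card {u \<in> V j. E v u}) \<ge> (2/3) * real N)) \<longrightarrow>
          (\<forall>i\<in>{1,2,3}. A i \<subseteq> V i \<and> card (A i) = N div 3) \<longrightarrow>
          (\<forall>i\<in>{1,2,3}. \<forall>j\<in>{1,2,3}. i \<noteq> j \<longrightarrow> density E (A i) (A j) \<le> \<Delta>) \<longrightarrow>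
          has_disjoint_triangles E N \<or>
          tripartite_isomorphic V E
            (blowup_class gamma3_class (N div 3)) (blowup_adj gamma3_adj (N div 3))))"
proof (intro exI[of _ "1 / 10 ^ 25 :: real"] conjI allI impI)
  \<comment> \<open>The value of \<open>\<Delta>\<^sub>0\<close> is the edge bound
    \<open>h^2 / 10^25\<close> of \<open>packing_or_gamma_split_of_sparse_triple\<close>, divided by
    \<open>h^2\<close>.\<close>
  show "0 < (1 / 10 ^ 25 :: real)" by simp
  fix \<Delta> :: real assume \<Delta>: "0 < \<Delta> \<and> \<Delta> \<le> 1 / 10 ^ 25"
  show "\<exists>N\<^sub>0::nat. \<forall>N\<ge>N\<^sub>0. 3 dvd N \<longrightarrow>
       (\<forall>(V :: nat \<Rightarrow> 'a set) (E :: 'a \<Rightarrow> 'a \<Rightarrow> bool) (A :: nat \<Rightarrow> 'a set).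
          balanced_tripartite_graph N V E \<longrightarrow>
          (\<forall>i\<in>{1,2,3}. \<forall>j\<in>{1,2,3}. i \<noteq> j \<longrightarrow>
             (\<forall>v\<in>V i. real (card {u \<in> V j. E v u}) \<ge> (2/3) * real N)) \<longrightarrow>
          (\<forall>i\<in>{1,2,3}. A i \<subseteq> V i \<and> card (A i) = N div 3) \<longrightarrow>
          (\<forall>i\<in>{1,2,3}. \<forall>j\<in>{1,2,3}. i \<noteq> j \<longrightarrow> density E (A i) (A j) \<le> \<Delta>) \<longrightarrow>
          has_disjoint_triangles E N \<or>
          tripartite_isomorphic V E
            (blowup_class gamma3_class (N div 3)) (blowup_adj gamma3_adj (N div 3)))"
    unfolding I3_def[symmetric]
  proof (intro exI[of _ "21 * 10 ^ 42 :: nat"] allI impI)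
    \<comment> \<open>The threshold is three times the bound on \<open>h\<close> and does not depend
      on \<open>\<Delta>\<close>, which enters only through
      \<open>\<Delta> \<le> 1 / 10 ^ 25\<close>.\<close>
    fix N :: nat and V :: "nat \<Rightarrow> 'a set" and E A
    assume N: "21 * 10 ^ 42 \<le> N" "3 dvd N" and G: "balanced_tripartite_graph N V E"
      and deg: "\<forall>i\<in>I3. \<forall>j\<in>I3. i \<noteq> j \<longrightarrow> (\<forall>v\<in>V i. real (card {u \<in> V j. E v u}) \<ge> (2/3) * real N)"
      and A: "\<forall>i\<in>I3. A i \<subseteq> V i \<and> card (A i) = N div 3"
      and dens: "\<forall>i\<in>I3. \<forall>j\<in>I3. i \<noteq> j \<longrightarrow> density E (A i) (A j) \<le> \<Delta>"
    define h where "h = N div 3"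
    have Nh: "N = 3 * h" using N(2) by (simp add: h_def)
    have "7 * 10 ^ 42 \<le> h" using N(1) Nh by simp
    hence h: "7 * 10 ^ 42 \<le> real h" using of_nat_mono[of "7 * 10 ^ 42" h, where 'a = real] by simp
    have tg: "tripartite_graph V E" and cV: "\<forall>i\<in>I3. card (V i) = N"
      using G unfolding balanced_tripartite_graph_def I3_def by blast+
    have finV: "finite (V i)" if "i \<in> I3" for i using tg that unfolding tripartite_graph_def I3_def by blast
    interpret tripartite V E h
    proof
      show "finite (V i)" if "i \<in> I3" for i by (rule finV[OF that])
      show "V i \<inter> V j = {}" if "i \<in> I3" "j \<in> I3" "i \<noteq> j" for i j
        using tg that unfolding tripartite_graph_def disjoint_family_on_def I3_def by blast
      show "E v u" if "E u v" for u v using tg that unfolding tripartite_graph_def by blast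
      show "\<exists>i\<in>I3. \<exists>j\<in>I3. i \<noteq> j \<and> u \<in> V i \<and> v \<in> V j" if "E u v" for u v
        using tg that unfolding tripartite_graph_def I3_def by blast
      show "card (V i) = 3 * h" if "i \<in> I3" for i using cV that Nh by simp
      show "nonnbrs E v (V j) \<le> real h" if ij: "i \<in> I3" "j \<in> I3" "i \<noteq> j" "v \<in> V i" for i j v
      proof -
        have "nbrs E v (V j) \<ge> (2/3) * real N" using deg ij unfolding nbrs_def by blast
        thus ?thesis using nbrs_plus_nonnbrs[OF finV[OF ij(2)], of E v] cV ij(2) Nh by simp
      qed
    qed
    have "sparse_triple (real h * real h / 10 ^ 25) A" unfolding sparse_triple_def
    proof (intro conjI ballI impI)
      show "A i \<subseteq> V i" "card (A i) = h" if "i \<in> I3" for i using A that h_def by auto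
      fix i j assume ij: "i \<in> I3" "j \<in> I3" "i \<noteq> j"
      have fA: "finite (A i)" "finite (A j)" using A ij finV finite_subset by metis+
      have c: "card (A i) = h" "card (A j) = h" using A ij h_def by auto
      have "density E (A i) (A j) \<le> 1 / 10 ^ 25" using dens ij \<Delta> by force
      hence "(\<Sum>v\<in>A i. nb v (A j)) / (real h * real h) \<le> 1 / 10 ^ 25"
        by (simp add: density_def edges_between_eq_sum_nbrs[OF fA] c)
      thus "(\<Sum>v\<in>A i. nb v (A j)) \<le> real h * real h / 10 ^ 25"
        using h by (simp add: divide_le_eq)
    qed
    from packing_or_gamma_split_of_sparse_triple[OF this h]
    show "has_disjoint_triangles E N \<or>
          tripartite_isomorphic V E (blowup_class gamma3_class (N div 3)) (blowup_adj gamma3_adj (N div 3))"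
    proof
      assume "triangle_packing vtx (3 * h)"
      thus ?thesis unfolding triangle_packing_def has_disjoint_triangles_def Nh by blast
    next
      assume "\<exists>L C D. gamma_split L C D"
      thus ?thesis using tripartite_isomorphic_of_gamma_split unfolding h_def by blast
    qed
  qed
qed

end
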